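(* Let $C,E\in B_i(S^1,\mathbb{R}^2)$. All infima below are over all smooth paths $c$ of immersions connecting $C$ to $E$. (i) If $\varphi(\ell)=\ell$, then $$\mathrm{dist}_{G^{\varphi}}(C,E)=\inf_{c}\alpha(c).$$ (ii) If $\varphi(\ell)=e^{A\ell}$ with a constant $A>0$, then $$\inf_{c}\sqrt{Ae}\,\alpha(c)\;\le\;\mathrm{dist}_{G^{\varphi}}(C,E)\;\le\;\inf_{c}\sqrt{Ae}\,e^{A\ell_{\max}(c)/2}\,\alpha(c).$$
   Context: $Imm(S^1,\mathbb{R}^2)$ is the space of $C^\infty$ immersions $S^1\to\mathbb{R}^2$, $B_i(S^1,\mathbb{R}^2)=Imm(S^1,\mathbb{R}^2)/Diff(S^1)$ is its quotient by reparametrization (composition from the right), and $\pi:Imm(S^1,\mathbb{R}^2)\to B_i(S^1,\mathbb{R}^2)$ is the projection. For an immersion $c$, put $c_\theta=dc/d\theta$, $n_c=ic_\theta/|c_\theta|$ (identifying $\mathbb{R}^2=\mathbb{C}$), and $\ell=\ell(c)=\int_{S^1}|c_\theta|\,d\theta$. For a positive function $\varphi$ of $\ell$, and $h,k\in C^\infty(S^1,\mathbb{R}^2)$ regarded as tangent vectors at $c$, $$G^{\varphi}_c(h,k)=\varphi(\ell(c))\int_{S^1}(h\cdot k)\,|c_\theta|\,d\theta .$$ A path connecting $C$ to $E$ is a smooth path $t\mapsto c(t,\cdot)\in Imm(S^1,\mathbb{R}^2)$, $0\le t\le 1$, with $\pi(c(0,\cdot))=C$ and $\pi(c(1,\cdot))=E$.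 Write $c_t=\partial c/\partial t$ and $c_t^{\perp}=(c_t\cdot n_c)n_c$. Then $$L_{G^{\varphi}}(c)=\int_0^1\sqrt{G^{\varphi}_c(c_t^{\perp},c_t^{\perp})}\,dt,\qquad \mathrm{dist}_{G^{\varphi}}(C,E)=\inf_c L_{G^{\varphi}}(c),$$ the infimum being over all paths connecting $C$ to $E$. The area swept out by the path $c$ is $\alpha(c)=\int_{S^1\times[0,1]}|\det dc(t,\theta)|\,d\theta\,dt$ (area in $\mathbb{R}^2$ counted with multiplicity), and $\ell_{\max}(c)=\max_{t}\ell(c(t,\cdot))$. *)

theory Defs
  imports "HOL-Analysis.Analysis"
begin

text \<open>
  The sets \<open>U\<close> of interest are open. Since the domain is Euclidean, asking that \<open>f\<close> be
  differentiable and that all its directional derivatives be \<open>C\<^sup>n\<close> amounts to \<open>f\<close> being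
  \<open>C\<^sup>n\<^sup>+\<^sup>1\<close>.
\<close>

primrec Ck_on :: "nat \<Rightarrow> ('a::euclidean_space \<Rightarrow> 'b::real_normed_vector) \<Rightarrow> 'a set \<Rightarrow> bool" where
  "Ck_on 0 f U \<longleftrightarrow> continuous_on U f"
| "Ck_on (Suc n) f U \<longleftrightarrow> (\<forall>x\<in>U. f differentiable (at x)) \<and>
     (\<forall>v. Ck_on n (\<lambda>x. frechet_derivative f (at x) v) U)"

text \<open>
  On a set that is not open, such as the strip \<open>[0,1] \<times> \<real>\<close>, smoothness means having a
  smooth extension to an open neighbourhood. On an open set nothing changes, as the
  derivatives only depend on \<open>f\<close> near the point.
\<close>

definition smooth_on :: "('a::euclidean_space \<Rightarrow> 'b::real_normed_vector) \<Rightarrow> 'a set \<Rightarrow> bool" where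
  "smooth_on f S \<longleftrightarrow>
     (\<exists>U g. open U \<and> S \<subseteq> U \<and> (\<forall>x\<in>S. g x = f x) \<and> (\<forall>n. Ck_on n g U))"

text \<open>
  The circle is \<open>\<real> / 2\<pi>\<int>\<close> and the plane is \<^typ>\<open>complex\<close>: maps on the circle are
  \<open>2\<pi>\<close>-periodic functions on \<open>\<real>\<close>, and diffeomorphisms of the circle are given by their
  lifts to \<open>\<real>\<close>. Orientation reversing diffeomorphisms are included.
\<close>

definition Imm :: "(real \<Rightarrow> complex) set" where
  "Imm = {c. smooth_on c UNIV \<and> (\<forall>\<theta>. c (\<theta> + 2 * pi) = c \<theta>) \<and>
             (\<forall>\<theta>. vector_derivative c (at \<theta>) \<noteq> 0)}"

definition Diff_lifts :: "(real \<Rightarrow> real) set" where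
  "Diff_lifts = {h. bij h \<and> smooth_on h UNIV \<and> smooth_on (inv h) UNIV \<and>
     ((\<forall>\<theta>. h (\<theta> + 2 * pi) = h \<theta> + 2 * pi) \<or> (\<forall>\<theta>. h (\<theta> + 2 * pi) = h \<theta> - 2 * pi))}"

definition reparam :: "((real \<Rightarrow> complex) \<times> (real \<Rightarrow> complex)) set" where
  "reparam = {(c, d). c \<in> Imm \<and> d \<in> Imm \<and> (\<exists>h\<in>Diff_lifts. d = c \<circ> h)}"

definition B_i :: "(real \<Rightarrow> complex) set set" where
  "B_i = Imm // reparam"

definition B_i_proj :: "(real \<Rightarrow> complex) \<Rightarrow> (real \<Rightarrow> complex) set" where
  "B_i_proj c = reparam `` {c}"

definition curve_length :: "(real \<Rightarrow> complex) \<Rightarrow> real" where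
  "curve_length c = integral {0..2 * pi} (\<lambda>\<theta>. norm (vector_derivative c (at \<theta>)))"

definition unit_normal :: "(real \<Rightarrow> complex) \<Rightarrow> real \<Rightarrow> complex" where
  "unit_normal c \<theta> =
     \<i> * vector_derivative c (at \<theta>) / of_real (norm (vector_derivative c (at \<theta>)))"

definition G_metric :: "(real \<Rightarrow> real) \<Rightarrow> (real \<Rightarrow> complex) \<Rightarrow> (real \<Rightarrow> complex) \<Rightarrow> (real \<Rightarrow> complex) \<Rightarrow> real" where
  "G_metric \<phi> c h k = \<phi> (curve_length c) *
     integral {0..2 * pi} (\<lambda>\<theta>. (h \<theta> \<bullet> k \<theta>) * norm (vector_derivative c (at \<theta>)))"

text \<open>A path of curves is written \<open>c t \<theta>\<close>; it is only constrained for \<open>t \<in> [0,1]\<close>.\<close>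

definition imm_paths ::
    "(real \<Rightarrow> complex) set \<Rightarrow> (real \<Rightarrow> complex) set \<Rightarrow> (real \<Rightarrow> real \<Rightarrow> complex) set" where
  "imm_paths C E = {c. smooth_on (\<lambda>(t, \<theta>). c t \<theta>) ({0..1} \<times> UNIV) \<and>
     (\<forall>t\<in>{0..1}. c t \<in> Imm) \<and> B_i_proj (c 0) = C \<and> B_i_proj (c 1) = E}"

definition time_deriv :: "(real \<Rightarrow> real \<Rightarrow> complex) \<Rightarrow> real \<Rightarrow> real \<Rightarrow> complex" where
  "time_deriv c t \<theta> = vector_derivative (\<lambda>s. c s \<theta>) (at t within {0..1})"

definition normal_velocity :: "(real \<Rightarrow> real \<Rightarrow> complex) \<Rightarrow> real \<Rightarrow> real \<Rightarrow> complex" where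
  "normal_velocity c t \<theta> =
     (time_deriv c t \<theta> \<bullet> unit_normal (c t) \<theta>) *\<^sub>R unit_normal (c t) \<theta>"

definition length_G :: "(real \<Rightarrow> real) \<Rightarrow> (real \<Rightarrow> real \<Rightarrow> complex) \<Rightarrow> real" where
  "length_G \<phi> c =
     integral {0..1} (\<lambda>t. sqrt (G_metric \<phi> (c t) (normal_velocity c t) (normal_velocity c t)))"

text \<open>
  The infimum is taken in \<^typ>\<open>ereal\<close>, so that it is \<open>\<infinity>\<close> when no path connects the two
  curves (for instance when the absolute values of their rotation numbers differ).
\<close>

definition dist_G ::
    "(real \<Rightarrow> real) \<Rightarrow> (real \<Rightarrow> complex) set \<Rightarrow> (real \<Rightarrow> complex) set \<Rightarrow> ereal" where
  "dist_G \<phi> C E = (INF c\<in>imm_paths C E. ereal (length_G \<phi> c))"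

definition jacobian :: "(real \<Rightarrow> real \<Rightarrow> complex) \<Rightarrow> real \<Rightarrow> real \<Rightarrow> real^2^2" where
  "jacobian c t \<theta> =
     (let u = time_deriv c t \<theta>; v = vector_derivative (c t) (at \<theta>)
      in vector [vector [Re u, Re v], vector [Im u, Im v]])"

definition swept_area :: "(real \<Rightarrow> real \<Rightarrow> complex) \<Rightarrow> real" where
  "swept_area c = integral ({0..1} \<times> {0..2 * pi}) (\<lambda>(t, \<theta>). \<bar>det (jacobian c t \<theta>)\<bar>)"

text \<open>
  For a smooth path the length is continuous in \<open>t\<close>, so the supremum is a maximum.
\<close>

definition max_length :: "(real \<Rightarrow> real \<Rightarrow> complex) \<Rightarrow> real" where
  "max_length c = (SUP t\<in>{0..1}. curve_length (c t))"

end

theory Submission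
  imports Defs "HOL-Real_Asymp.Real_Asymp"
begin

text \<open>
  The lower bounds are Cauchy-Schwarz. On one curve of a path, the area is swept out at the rate
  \<open>\<integral> \<bar>v\<bar> ds\<close>, where \<open>v\<close> is the normal speed and \<open>s\<close> the arc length, and this is at most
  \<open>sqrt (\<ell> * \<integral> v\<^sup>2 ds)\<close>, the speed of the path for the weight \<open>\<ell>\<close>. For the exponential weight one has
  \<open>exp (A * \<ell>) \<ge> A * exp 1 * \<ell>\<close> in addition.

  For the upper bounds, equality in Cauchy-Schwarz requires \<open>v\<close> to be constant along the curve. This
  can be approached by letting the curve wiggle. Let a curve of
  speed \<open>g = \<bar>c'\<bar>\<close> be displaced by a small vector field with normal part \<open>Q * g\<close>, so that the area
  \<open>m = \<integral> g\<^sup>2 \<bar>Q\<bar> d\<theta>\<close> is swept out. Put a zigzag with slopes \<open>\<plusminus> M * g * Q\<close>, high frequency and tiny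
  amplitude on the curve, move the wiggling curve across, and remove the zigzag. The zigzag makes
  the curve longer by at most \<open>M * m\<close>, while on its steep parts the normal speed drops to about
  the constant \<open>1 / M\<close>. It divides the energy density \<open>g\<^sup>3 * Q\<^sup>2\<close> by at least about the slope
  \<open>M * g * \<bar>Q\<bar>\<close>, so that the integral of the squared normal speed becomes at most about \<open>m / M\<close>.
  With \<open>M = e / m\<close> the move has length at most about \<open>sqrt (\<phi> (\<ell> + e) / e) * m\<close> for a nondecreasing
  weight \<open>\<phi>\<close>. Creating and removing the zigzag is free in the limit of vanishing amplitude, as
  for fixed slopes the length of the curve stays bounded. The tangential part of the
  displacement is carried out beforehand; it costs only to second order. All
  this is done in the lemmas \<open>connects_tangential\<close>, \<open>connects_zigzag\<close> and \<open>connects_sweep\<close>, and put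
  together in \<open>connects_displacement\<close>. The wiggles point in the normal direction of the unperturbed
  curve, hence all curves that occur are immersed.

  A given path is now replaced by many such moves (\<open>connects_nearby\<close>, \<open>connects_swept_area\<close>), which
  yields the bound \<open>sqrt (\<phi> (\<ell>\<^sub>m\<^sub>a\<^sub>x + e) / e) * \<alpha>\<close> for the distance, for every \<open>e > 0\<close>
  (\<open>dist_G_le\<close>). For \<open>\<phi> \<ell> = \<ell>\<close> let \<open>e\<close> tend to infinity; for \<open>\<phi> \<ell> = exp (A * \<ell>)\<close> take
  \<open>e = 1 / A\<close>.
\<close>

section \<open>Calculus of \<open>C\<^sup>n\<close> functions on open sets\<close>

lemma Ck_on_cong:
  assumes "open U" and "\<And>x. x \<in> U \<Longrightarrow> f x = g x" and "Ck_on n f U"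
  shows "Ck_on n g U"
  using assms(2,3)
proof (induction n arbitrary: f g)
  case 0
  then show ?case by (simp cong: continuous_on_cong)
next
  case (Suc n)
  have D: "(g has_derivative frechet_derivative f (at x)) (at x)" if x: "x \<in> U" for x
  proof -
    have "(f has_derivative frechet_derivative f (at x)) (at x)"
      using Suc.prems(2) x by (simp add: frechet_derivative_works)
    then show ?thesis
      by (rule has_derivative_transform_within_open[OF _ \<open>open U\<close> x]) (rule Suc.prems(1))
  qed
  have "Ck_on n (\<lambda>x. frechet_derivative g (at x) v) U" for v
    by (rule Suc.IH[of "\<lambda>x. frechet_derivative f (at x) v"])
       (use frechet_derivative_at[OF D] Suc.prems(2) in auto)
  then show ?case
    using D by (auto simp: differentiable_def)
qed

text \<open>
  The induction step for sums, products, compositions and the elementary functions: any derivative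
  will do, as derivatives are unique, and it remains to see that it is \<open>C\<^sup>n\<close>.
\<close>

lemma Ck_on_Suc_derivI:
  assumes "open U" and "\<And>x. x \<in> U \<Longrightarrow> (f has_derivative D x) (at x)"
    and "\<And>v. Ck_on n (\<lambda>x. D x v) U"
  shows "Ck_on (Suc n) f U"
proof -
  have "Ck_on n (\<lambda>x. frechet_derivative f (at x) v) U" for v
    by (rule Ck_on_cong[OF assms(1) _ assms(3)[of v]])
       (use frechet_derivative_at[OF assms(2)] in auto)
  then show ?thesis
    using assms(2) by (auto simp: differentiable_def)
qed

lemma Ck_on_SucD:
  assumes "Ck_on (Suc n) f U" "x \<in> U"
  shows "(f has_derivative frechet_derivative f (at x)) (at x)"
  using assms by (simp add: frechet_derivative_works)

lemma Ck_on_Suc_imp: "Ck_on (Suc n) f U \<Longrightarrow> Ck_on n f U"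
proof (induction n arbitrary: f)
  case 0
  then show ?case
    by (simp add: continuous_at_imp_continuous_on differentiable_imp_continuous_within)
next
  case (Suc n)
  then show ?case by (metis Ck_on.simps(2))
qed

lemma Ck_on_continuous: "Ck_on n f U \<Longrightarrow> continuous_on U f"
  by (induction n) (use Ck_on_Suc_imp in \<open>auto simp del: Ck_on.simps(2)\<close>)

lemma Ck_on_subset: "Ck_on n f U \<Longrightarrow> V \<subseteq> U \<Longrightarrow> Ck_on n f V"
  by (induction n arbitrary: f) (auto intro: continuous_on_subset)

lemma Ck_on_Un:
  assumes "open U" "open V"
  shows "Ck_on n f U \<Longrightarrow> Ck_on n f V \<Longrightarrow> Ck_on n f (U \<union> V)"
  by (induction n arbitrary: f) (use assms in \<open>auto intro: continuous_on_open_Un\<close>)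

lemma Ck_on_const:
  assumes "open U" shows "Ck_on n (\<lambda>x. c) U"
proof (induction n arbitrary: c)
  case (Suc n)
  show ?case
    by (rule Ck_on_Suc_derivI[OF assms has_derivative_const _]) (auto simp: Suc)
qed simp

lemma Ck_on_bounded_linear:
  assumes "open U" "bounded_linear L" "Ck_on n f U"
  shows "Ck_on n (\<lambda>x. L (f x)) U"
  using assms(3)
proof (induction n arbitrary: f)
  case 0
  then show ?case
    by (simp add: bounded_linear.continuous_on[OF assms(2)])
next
  case (Suc n)
  show ?case
  proof (rule Ck_on_Suc_derivI[OF assms(1) _ _])
    show "((\<lambda>x. L (f x)) has_derivative (\<lambda>v. L (frechet_derivative f (at x) v))) (at x)"
      if "x \<in> U" for x
      by (rule bounded_linear.has_derivative[OF assms(2) Ck_on_SucD[OF Suc.prems that]])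
    show "Ck_on n (\<lambda>x. L (frechet_derivative f (at x) v)) U" for v
      using Suc by simp
  qed
qed

lemma Ck_on_id:
  assumes "open U" shows "Ck_on n (\<lambda>x. x) U"
proof (cases n)
  case (Suc m)
  show ?thesis
    unfolding Suc
    by (rule Ck_on_Suc_derivI[OF assms has_derivative_ident _]) (rule Ck_on_const[OF assms])
qed simp

lemma Ck_on_add:
  assumes "open U" shows "Ck_on n f U \<Longrightarrow> Ck_on n g U \<Longrightarrow> Ck_on n (\<lambda>x. f x + g x) U"
proof (induction n arbitrary: f g)
  case 0
  then show ?case by (simp add: continuous_on_add)
next
  case (Suc n)
  show ?case
    by (rule Ck_on_Suc_derivI[OF assms has_derivative_add[OF Ck_on_SucD Ck_on_SucD] _])
       (use Suc in auto)
qed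

lemma Ck_on_bilinear:
  assumes "open U" "bounded_bilinear pr"
  shows "Ck_on n f U \<Longrightarrow> Ck_on n g U \<Longrightarrow> Ck_on n (\<lambda>x. pr (f x) (g x)) U"
proof (induction n arbitrary: f g)
  case 0
  then show ?case by (simp add: bounded_bilinear.continuous_on[OF assms(2)])
next
  case (Suc n)
  note S = Suc.prems[THEN Ck_on_Suc_imp]
  show ?case
    by (rule Ck_on_Suc_derivI[OF assms(1) bounded_bilinear.FDERIV[OF assms(2) Ck_on_SucD Ck_on_SucD] _])
       (use Suc S in \<open>auto intro!: Ck_on_add assms\<close>)
qed

lemma Ck_on_sum:
  assumes "open U" "finite I" "\<And>i. i \<in> I \<Longrightarrow> Ck_on n (f i) U"
  shows "Ck_on n (\<lambda>x. \<Sum>i\<in>I. f i x) U"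
  using assms(2,3)
  by (induction I) (auto intro!: Ck_on_const Ck_on_add assms(1))

text \<open>
  The outer function is only known to have \<open>C\<^sup>n\<close> derivatives in fixed directions, so the chain
  rule is used with the inner derivative expanded in the standard basis.
\<close>

lemma Ck_on_compose:
  fixes f :: "'a::euclidean_space \<Rightarrow> 'b::euclidean_space"
    and g :: "'b \<Rightarrow> 'c::real_normed_vector"
  assumes "open U" "open V" "f ` U \<subseteq> V"
  shows "Ck_on n f U \<Longrightarrow> Ck_on n g V \<Longrightarrow> Ck_on n (\<lambda>x. g (f x)) U"
proof (induction n arbitrary: g)
  case 0
  then show ?case
    using continuous_on_compose2[of V g U f] assms(3) by simp
next
  case (Suc n)
  let ?Df = "\<lambda>x. frechet_derivative f (at x)" and ?Dg = "\<lambda>y. frechet_derivative g (at y)"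
  show ?case
  proof (rule Ck_on_Suc_derivI[OF assms(1) _ _])
    fix x assume x: "x \<in> U"
    have f': "(f has_derivative ?Df x) (at x)" by (rule Ck_on_SucD[OF Suc.prems(1) x])
    have g': "(g has_derivative ?Dg (f x)) (at (f x))"
      using assms(3) x by (intro Ck_on_SucD[OF Suc.prems(2)]) auto
    have lin: "linear (?Dg (f x))" by (rule has_derivative_linear[OF g'])
    have "?Dg (f x) (?Df x v) = (\<Sum>b\<in>Basis. (?Df x v \<bullet> b) *\<^sub>R ?Dg (f x) b)" for v
    proof -
      have "?Dg (f x) (\<Sum>b\<in>Basis. (?Df x v \<bullet> b) *\<^sub>R b) = (\<Sum>b\<in>Basis. (?Df x v \<bullet> b) *\<^sub>R ?Dg (f x) b)"
        by (simp only: linear_sum[OF lin] linear_scale[OF lin])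
      then show ?thesis by (simp only: euclidean_representation)
    qed
    then show "((\<lambda>x. g (f x)) has_derivative
        (\<lambda>v. \<Sum>b\<in>Basis. (?Df x v \<bullet> b) *\<^sub>R ?Dg (f x) b)) (at x)"
      using has_derivative_compose[OF f' g'] by simp
  next
    fix v
    have "Ck_on n (\<lambda>x. ?Dg (f x) b) U" for b
      using Suc.IH[OF Ck_on_Suc_imp[OF Suc.prems(1)], of "\<lambda>y. ?Dg y b"] Suc.prems(2) by simp
    moreover have "Ck_on n (\<lambda>x. ?Df x v \<bullet> b) U" for b
      using Suc.prems(1) by (intro Ck_on_bounded_linear[OF assms(1) bounded_linear_inner_left]) simp
    ultimately show "Ck_on n (\<lambda>x. \<Sum>b\<in>Basis. (?Df x v \<bullet> b) *\<^sub>R ?Dg (f x) b) U"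
      by (intro Ck_on_sum Ck_on_bilinear[OF _ bounded_bilinear_scaleR] assms(1)) auto
  qed
qed

lemma Ck_on_minus: "open U \<Longrightarrow> Ck_on n f U \<Longrightarrow> Ck_on n (\<lambda>x. - f x) U"
  by (rule Ck_on_bounded_linear[OF _ bounded_linear_minus[OF bounded_linear_ident]])

lemma Ck_on_diff: "open U \<Longrightarrow> Ck_on n f U \<Longrightarrow> Ck_on n g U \<Longrightarrow> Ck_on n (\<lambda>x. f x - g x) U"
  using Ck_on_add[OF _ _ Ck_on_minus] by fastforce

lemma Ck_on_mult:
  fixes f g :: "'a::euclidean_space \<Rightarrow> 'b::real_normed_algebra"
  shows "open U \<Longrightarrow> Ck_on n f U \<Longrightarrow> Ck_on n g U \<Longrightarrow> Ck_on n (\<lambda>x. f x * g x) U"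
  by (rule Ck_on_bilinear[OF _ bounded_bilinear_mult])

lemma Ck_on_field_derivI:
  fixes f :: "'a::{real_normed_field,euclidean_space} \<Rightarrow> 'a"
  assumes "open U" "\<And>x. x \<in> U \<Longrightarrow> (f has_field_derivative f' x) (at x)" "Ck_on n f' U"
  shows "Ck_on (Suc n) f U"
  by (rule Ck_on_Suc_derivI[OF assms(1) assms(2)[unfolded has_field_derivative_def] _])
     (auto intro!: Ck_on_mult Ck_on_const assms)

lemma Ck_on_inverse':
  "Ck_on n (inverse :: 'a::{real_normed_field,euclidean_space} \<Rightarrow> 'a) (- {0})"
proof (induction n)
  case 0
  show ?case by (auto intro!: continuous_intros)
next
  case (Suc n)
  show ?case
  proof (rule Ck_on_field_derivI)
    show "(inverse has_field_derivative - (inverse x * inverse x)) (at x)" if "x \<in> - {0}" for x :: 'a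
      using DERIV_inverse[of x UNIV] that by simp
    show "Ck_on n (\<lambda>x::'a. - (inverse x * inverse x)) (- {0})"
      by (intro Ck_on_minus Ck_on_mult Suc) auto
  qed auto
qed

lemma Ck_on_inverse:
  fixes f :: "'a::euclidean_space \<Rightarrow> 'b::{real_normed_field,euclidean_space}"
  assumes "open U" "Ck_on n f U" "\<And>x. x \<in> U \<Longrightarrow> f x \<noteq> 0"
  shows "Ck_on n (\<lambda>x. inverse (f x)) U"
  by (rule Ck_on_compose[OF assms(1) _ _ assms(2) Ck_on_inverse']) (use assms in auto)

lemma Ck_on_divide:
  fixes f g :: "'a::euclidean_space \<Rightarrow> 'b::{real_normed_field,euclidean_space}"
  assumes "open U" "Ck_on n f U" "Ck_on n g U" "\<And>x. x \<in> U \<Longrightarrow> g x \<noteq> 0"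
  shows "Ck_on n (\<lambda>x. f x / g x) U"
  unfolding divide_inverse by (intro Ck_on_mult Ck_on_inverse assms)

lemma Ck_on_sqrt': "Ck_on n sqrt {0<..}"
proof (induction n)
  case 0
  show ?case by (auto intro!: continuous_intros)
next
  case (Suc n)
  show ?case
  proof (rule Ck_on_field_derivI)
    show "(sqrt has_field_derivative (inverse (sqrt x) / 2)) (at x)" if "x \<in> {0<..}" for x
      using DERIV_real_sqrt[of x] that by simp
    show "Ck_on n (\<lambda>x. inverse (sqrt x) / 2) {0<..}"
      by (intro Ck_on_divide Ck_on_inverse Suc Ck_on_const) auto
  qed auto
qed

lemma Ck_on_sqrt:
  assumes "open U" "Ck_on n f U" "\<And>x. x \<in> U \<Longrightarrow> f x > 0"
  shows "Ck_on n (\<lambda>x. sqrt (f x)) U"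
  by (rule Ck_on_compose[OF assms(1) _ _ assms(2) Ck_on_sqrt']) (use assms in auto)

lemma Ck_on_norm:
  fixes f :: "'a::euclidean_space \<Rightarrow> 'b::euclidean_space"
  assumes "open U" "Ck_on n f U" "\<And>x. x \<in> U \<Longrightarrow> f x \<noteq> 0"
  shows "Ck_on n (\<lambda>x. norm (f x)) U"
  unfolding norm_eq_sqrt_inner
  by (intro Ck_on_sqrt Ck_on_bilinear[OF _ bounded_bilinear_inner] assms) (use assms in auto)

lemma Ck_on_arcsin': "Ck_on n arcsin {-1<..<1}"
proof (cases n)
  case 0
  then show ?thesis by (auto intro!: continuous_intros)
next
  case (Suc m)
  have *: "x * x < 1" if "x \<in> {-1<..<1}" for x :: real
    using that abs_square_less_1[of x] by (auto simp: power2_eq_square abs_less_iff)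
  show ?thesis unfolding Suc
  proof (rule Ck_on_field_derivI)
    show "(arcsin has_field_derivative inverse (sqrt (1 - x * x))) (at x)" if "x \<in> {-1<..<1}" for x
      using DERIV_arcsin[of x] that by (simp add: power2_eq_square)
    show "Ck_on m (\<lambda>x. inverse (sqrt (1 - x * x))) {-1<..<1}"
      by (intro Ck_on_inverse Ck_on_sqrt Ck_on_diff Ck_on_const Ck_on_mult Ck_on_id)
         (use * in \<open>auto simp: less_imp_neq\<close>)
  qed auto
qed

lemma Ck_on_sin_cos: "Ck_on n (sin :: real \<Rightarrow> real) UNIV \<and> Ck_on n (cos :: real \<Rightarrow> real) UNIV"
proof (induction n)
  case 0
  show ?case by (auto intro!: continuous_intros)
next
  case (Suc n)
  then show ?case
    by (intro conjI Ck_on_field_derivI[where f = sin and f' = cos]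
          Ck_on_field_derivI[where f = cos and f' = "\<lambda>x. - sin x"] Ck_on_minus DERIV_sin DERIV_cos) auto
qed

section \<open>A smooth time change resting at both ends\<close>

text \<open>
  The functions \<open>x\<^sup>-\<^sup>k exp (-1/x)\<close> on the positive half line, extended by \<open>0\<close>: the family is
  closed under differentiation up to linear combinations, which yields smoothness at \<open>0\<close> at once.
\<close>

definition flat_exp :: "nat \<Rightarrow> real \<Rightarrow> real" where
  "flat_exp k x = (if x \<le> 0 then 0 else inverse x ^ k * exp (- inverse x))"

lemma DERIV_flat_exp:
  "(flat_exp k has_field_derivative (flat_exp (k + 2) x - k * flat_exp (k + 1) x)) (at x)"
proof (cases x "0::real" rule: linorder_cases)
  case less
  have "((\<lambda>x. 0) has_field_derivative 0) (at x)" by simp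
  then have "(flat_exp k has_field_derivative 0) (at x)"
    by (rule has_field_derivative_transform_within_open[where S = "{..<0}"])
       (use less in \<open>auto simp: flat_exp_def\<close>)
  then show ?thesis using less by (simp add: flat_exp_def)
next
  case greater
  have i: "(inverse has_field_derivative - (inverse x ^ 2)) (at x)"
    using DERIV_inverse[of x UNIV] greater by (simp add: power2_eq_square)
  have p: "((\<lambda>x. inverse x ^ k) has_field_derivative - (k * inverse x ^ (k + 1))) (at x)"
  proof (cases k)
    case (Suc j)
    show ?thesis
      using DERIV_power_Suc[OF i, of j] by (simp add: Suc algebra_simps power2_eq_square)
  qed simp
  have "((\<lambda>x. inverse x ^ k * exp (- inverse x)) has_field_derivative
      (flat_exp (k + 2) x - k * flat_exp (k + 1) x)) (at x)"
    using DERIV_mult[OF p DERIV_chain2[OF DERIV_exp DERIV_minus[OF i]]] greater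
    by (simp add: flat_exp_def algebra_simps power2_eq_square)
  then show ?thesis
    by (rule has_field_derivative_transform_within_open[where S = "{0<..}"])
       (use greater in \<open>auto simp: flat_exp_def\<close>)
next
  case equal
  have "((\<lambda>y. inverse y ^ (k+1) / exp (inverse y)) \<longlongrightarrow> 0) (at_right (0::real))"
    by (rule filterlim_compose[OF tendsto_power_div_exp_0 filterlim_inverse_at_top_right])
  then have R: "((\<lambda>y. (flat_exp k y - flat_exp k 0) / (y - 0)) \<longlongrightarrow> 0) (at_right (0::real))"
    by (rule Lim_transform_eventually)
       (auto simp: eventually_at_right_field flat_exp_def exp_minus field_simps intro!: exI[of _ 1])
  have L: "((\<lambda>y. (flat_exp k y - flat_exp k 0) / (y - 0)) \<longlongrightarrow> 0) (at_left (0::real))"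
    by (rule Lim_transform_eventually[OF tendsto_const])
       (auto simp: eventually_at_left_field flat_exp_def intro!: exI[of _ "-1"])
  have "((\<lambda>y. (flat_exp k y - flat_exp k 0) / (y - 0)) \<longlongrightarrow> 0) (at (0::real))"
    using L R by (simp add: filterlim_split_at)
  then show ?thesis
    using equal by (simp add: has_field_derivative_iff flat_exp_def)
qed

lemma Ck_on_flat_exp: "Ck_on n (flat_exp k) UNIV"
proof (induction n arbitrary: k)
  case 0
  show ?case
    using DERIV_flat_exp by (auto intro!: DERIV_continuous_on)
next
  case (Suc n)
  show ?case
    by (rule Ck_on_field_derivI[OF _ DERIV_flat_exp]) (auto intro!: Ck_on_diff Ck_on_mult Ck_on_const Suc)
qed

text \<open>
  Reparametrizing the time of a path by this step makes the path constant near both ends, so that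
  two paths with a common end curve can be joined to a smooth one.
\<close>

definition smooth_step :: "real \<Rightarrow> real" where
  "smooth_step x = flat_exp 0 (x - 1/3) / (flat_exp 0 (x - 1/3) + flat_exp 0 (2/3 - x))"

definition smooth_step' :: "real \<Rightarrow> real" where
  "smooth_step' x = (flat_exp 2 (x - 1/3) * flat_exp 0 (2/3 - x) + flat_exp 0 (x - 1/3) * flat_exp 2 (2/3 - x))
      / (flat_exp 0 (x - 1/3) + flat_exp 0 (2/3 - x))\<^sup>2"

lemma flat_exp_nonneg: "flat_exp k x \<ge> 0" and flat_exp_pos: "x > 0 \<Longrightarrow> flat_exp k x > 0"
  by (auto simp: flat_exp_def)

lemma smooth_step_denom_pos: "flat_exp 0 (x - 1/3) + flat_exp 0 (2/3 - x) > 0"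
proof (cases "x > 1/3")
  case True
  then show ?thesis using flat_exp_pos[of "x - 1/3" 0] flat_exp_nonneg[of 0 "2/3 - x"] by simp
next
  case False
  then show ?thesis using flat_exp_pos[of "2/3 - x" 0] flat_exp_nonneg[of 0 "x - 1/3"] by simp
qed

lemma smooth_step_range: "smooth_step x \<in> {0..1}"
  using smooth_step_denom_pos[of x] by (simp add: smooth_step_def flat_exp_nonneg)

lemma smooth_step_eq_0: "x \<le> 1/3 \<Longrightarrow> smooth_step x = 0"
  by (simp add: smooth_step_def flat_exp_def)

lemma smooth_step_eq_1: "x \<ge> 2/3 \<Longrightarrow> smooth_step x = 1"
  using smooth_step_denom_pos[of x] by (simp add: smooth_step_def flat_exp_def)

lemma Ck_on_smooth_step: "Ck_on n smooth_step UNIV"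
proof -
  have "Ck_on n (\<lambda>x. flat_exp 0 (x - 1/3)) UNIV" "Ck_on n (\<lambda>x. flat_exp 0 (2/3 - x)) UNIV"
    by (intro Ck_on_compose[OF _ _ _ _ Ck_on_flat_exp] Ck_on_diff Ck_on_id Ck_on_const; simp)+
  then show ?thesis
    unfolding smooth_step_def
    by (intro Ck_on_divide Ck_on_add) (use smooth_step_denom_pos in \<open>auto simp: less_imp_neq[THEN not_sym]\<close>)
qed

lemma DERIV_smooth_step: "(smooth_step has_field_derivative smooth_step' x) (at x)"
proof -
  define u where "u = (\<lambda>x. flat_exp 0 (x - 1/3))"
  define w where "w = (\<lambda>x. flat_exp 0 (2/3 - x))"
  have d: "(flat_exp 0 has_field_derivative flat_exp 2 y) (at y)" for y
    using DERIV_flat_exp[of 0 y] by (simp add: numeral_2_eq_2)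
  have "(u has_field_derivative flat_exp 2 (x - 1/3) * 1) (at x)"
    unfolding u_def by (rule DERIV_chain2[OF d]) (auto intro!: derivative_eq_intros)
  moreover have "(w has_field_derivative flat_exp 2 (2/3 - x) * - 1) (at x)"
    unfolding w_def by (rule DERIV_chain2[OF d]) (auto intro!: derivative_eq_intros)
  moreover have "u x + w x \<noteq> 0"
    using smooth_step_denom_pos[of x] by (simp add: u_def w_def)
  ultimately have "((\<lambda>x. u x / (u x + w x)) has_field_derivative
      (flat_exp 2 (x - 1/3) * w x + u x * flat_exp 2 (2/3 - x)) / (u x + w x)\<^sup>2) (at x)"
    by (auto intro!: derivative_eq_intros simp: power2_eq_square algebra_simps)
  then show ?thesis
    by (simp add: u_def w_def smooth_step_def[abs_def] smooth_step'_def)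
qed

lemma smooth_step'_nonneg: "smooth_step' x \<ge> 0"
  by (simp add: smooth_step'_def flat_exp_nonneg)

section \<open>Smooth paths of immersions\<close>

lemma smooth_on_open_iff:
  assumes "open U" shows "smooth_on f U \<longleftrightarrow> (\<forall>n. Ck_on n f U)"
proof
  assume "smooth_on f U"
  then obtain V g where "open V" "U \<subseteq> V" "\<forall>x\<in>U. g x = f x" "\<And>n. Ck_on n g V"
    unfolding smooth_on_def by auto
  then show "\<forall>n. Ck_on n f U"
    using Ck_on_cong[OF assms, of g f] Ck_on_subset by metis
qed (use assms in \<open>auto simp: smooth_on_def\<close>)

lemma Imm_iff:
  "c \<in> Imm \<longleftrightarrow> (\<forall>n. Ck_on n c UNIV) \<and> (\<forall>\<theta>. c (\<theta> + 2 * pi) = c \<theta>) \<and>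
     (\<forall>\<theta>. vector_derivative c (at \<theta>) \<noteq> 0)"
  by (simp add: Imm_def smooth_on_open_iff)

lemma Ck_on_Suc_has_vector_derivative:
  fixes f :: "real \<Rightarrow> 'b::real_normed_vector"
  assumes "Ck_on (Suc n) f U" "x \<in> U"
  shows "(f has_vector_derivative vector_derivative f (at x)) (at x)"
  using assms by (simp add: vector_derivative_works[symmetric])

lemma Ck_on_vector_derivative:
  fixes f :: "real \<Rightarrow> 'b::real_normed_vector"
  assumes "open U" "Ck_on (Suc n) f U"
  shows "Ck_on n (\<lambda>x. vector_derivative f (at x)) U"
proof (rule Ck_on_cong[OF assms(1)])
  show "Ck_on n (\<lambda>x. frechet_derivative f (at x) 1) U"
    using assms(2) by simp
  show "frechet_derivative f (at x) 1 = vector_derivative f (at x)" if "x \<in> U" for x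
    using frechet_derivative_at[OF Ck_on_Suc_has_vector_derivative[OF assms(2) that, unfolded has_vector_derivative_def]]
    by (metis scaleR_one)
qed

definition smooth_path :: "(real \<Rightarrow> real \<Rightarrow> complex) \<Rightarrow> bool" where
  "smooth_path p \<longleftrightarrow> smooth_on (\<lambda>(t, \<theta>). p t \<theta>) ({0..1} \<times> UNIV) \<and> (\<forall>t\<in>{0..1}. p t \<in> Imm)"

lemma smooth_pathI:
  assumes "\<And>n. Ck_on n (\<lambda>(t, \<theta>). p t \<theta>) UNIV" "\<And>t. t \<in> {0..1} \<Longrightarrow> p t \<in> Imm"
  shows "smooth_path p"
proof -
  have "smooth_on (\<lambda>(t, \<theta>). p t \<theta>) ({0..1} \<times> UNIV)"
    unfolding smooth_on_def
    by (rule exI[of _ UNIV], rule exI[of _ "\<lambda>(t, \<theta>). p t \<theta>"]) (use assms(1) in simp)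
  then show ?thesis using assms(2) by (simp add: smooth_path_def)
qed

lemma imm_paths_iff:
  "p \<in> imm_paths C E \<longleftrightarrow> smooth_path p \<and> B_i_proj (p 0) = C \<and> B_i_proj (p 1) = E"
  by (auto simp: imm_paths_def smooth_path_def)

lemma smooth_path_extension:
  assumes "smooth_path p"
  shows "\<exists>U g. open U \<and> {0..1} \<times> UNIV \<subseteq> U \<and> (\<forall>t \<theta>. t \<in> {0..1} \<longrightarrow> g (t, \<theta>) = p t \<theta>)
    \<and> (\<forall>n. Ck_on n g U)"
proof -
  obtain U g where "open U" "{0..1} \<times> UNIV \<subseteq> U" "\<forall>n. Ck_on n g U"
    and g: "\<forall>x\<in>{0..1} \<times> UNIV. g x = (\<lambda>(t, \<theta>). p t \<theta>) x"
    using assms unfolding smooth_path_def smooth_on_def by metis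
  moreover have "g (t, \<theta>) = p t \<theta>" if "t \<in> {0..1}" for t \<theta>
    using g[rule_format, of "(t, \<theta>)"] that by simp
  ultimately show ?thesis by blast
qed

abbreviation \<theta>_deriv :: "(real \<Rightarrow> real \<Rightarrow> complex) \<Rightarrow> real \<Rightarrow> real \<Rightarrow> complex" where
  "\<theta>_deriv p t \<theta> \<equiv> vector_derivative (p t) (at \<theta>)"

text \<open>
  Only a one-sided derivative in time is available at the times \<open>0\<close> and \<open>1\<close>; the smooth
  extension makes it the restriction of a function that is continuous in both variables.
\<close>

lemma smooth_path_partials:
  assumes "smooth_path p"
  shows continuous_on_time_deriv: "continuous_on ({0..1} \<times> UNIV) (\<lambda>(t, \<theta>). time_deriv p t \<theta>)"
    and continuous_on_\<theta>_deriv: "continuous_on ({0..1} \<times> UNIV) (\<lambda>(t, \<theta>). \<theta>_deriv p t \<theta>)"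
    and has_time_deriv: "t \<in> {0..1} \<Longrightarrow>
      ((\<lambda>s. p s \<theta>) has_vector_derivative time_deriv p t \<theta>) (at t within {0..1})"
    and has_\<theta>_deriv: "t \<in> {0..1} \<Longrightarrow> (p t has_vector_derivative \<theta>_deriv p t \<theta>) (at \<theta>)"
proof -
  obtain U g where U: "open U" "{0..1} \<times> UNIV \<subseteq> U" and
    g: "\<And>t \<theta>. t \<in> {0..1} \<Longrightarrow> g (t, \<theta>) = p t \<theta>" and C: "\<And>n. Ck_on n g U"
    using smooth_path_extension[OF assms(1)] by metis
  define D where "D = (\<lambda>z. frechet_derivative g (at z))"
  have D: "(g has_derivative D z) (at z)" if "z \<in> U" for z
    unfolding D_def by (rule Ck_on_SucD[OF C[of "Suc 0"] that])
  have cont: "continuous_on ({0..1} \<times> UNIV) (\<lambda>z. D z v)" for v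
  proof -
    have "continuous_on U (\<lambda>z. D z v)" using C[of "Suc 0"] unfolding D_def Ck_on.simps by blast
    then show ?thesis using U(2) by (rule continuous_on_subset)
  qed
  have 1: "((\<lambda>s. p s \<theta>) has_vector_derivative D (t, \<theta>) (1, 0)) (at t within {0..1})"
    if "t \<in> {0..1}" for t \<theta>
  proof -
    have gD: "(g has_derivative D (t, \<theta>)) (at (t, \<theta>))"
      by (rule D) (use U(2) that in blast)
    have "((\<lambda>s. g (s, \<theta>)) has_derivative (\<lambda>x. D (t, \<theta>) (x, 0))) (at t)"
      by (rule has_derivative_compose[of "\<lambda>s. (s, \<theta>)", OF _ gD]) (auto intro!: derivative_eq_intros)
    moreover have "(\<lambda>x. D (t, \<theta>) (x, 0)) = (\<lambda>x. x *\<^sub>R D (t, \<theta>) (1, 0))"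
    proof
      show "D (t, \<theta>) (x, 0) = x *\<^sub>R D (t, \<theta>) (1, 0)" for x
        using linear_scale[OF has_derivative_linear[OF gD], of x "(1, 0)"] by simp
    qed
    ultimately have "((\<lambda>s. g (s, \<theta>)) has_vector_derivative D (t, \<theta>) (1, 0)) (at t within {0..1})"
      unfolding has_vector_derivative_def by (metis has_derivative_at_withinI)
    then show ?thesis
      by (rule has_vector_derivative_transform[OF that, rotated]) (use g in auto)
  qed
  have 2: "(p t has_vector_derivative D (t, \<theta>) (0, 1)) (at \<theta>)"
    if "t \<in> {0..1}" for t \<theta>
  proof -
    have gD: "(g has_derivative D (t, \<theta>)) (at (t, \<theta>))"
      by (rule D) (use U(2) that in blast)
    have "((\<lambda>s. g (t, s)) has_derivative (\<lambda>x. D (t, \<theta>) (0, x))) (at \<theta>)"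
      by (rule has_derivative_compose[of "\<lambda>s. (t, s)", OF _ gD]) (auto intro!: derivative_eq_intros)
    moreover have "(\<lambda>x. D (t, \<theta>) (0, x)) = (\<lambda>x. x *\<^sub>R D (t, \<theta>) (0, 1))"
    proof
      show "D (t, \<theta>) (0, x) = x *\<^sub>R D (t, \<theta>) (0, 1)" for x
        using linear_scale[OF has_derivative_linear[OF gD], of x "(0, 1)"] by simp
    qed
    moreover have "(\<lambda>s. g (t, s)) = p t" using g[OF that] by auto
    ultimately show ?thesis unfolding has_vector_derivative_def by metis
  qed
  have td: "time_deriv p t \<theta> = D (t, \<theta>) (1, 0)" if "t \<in> {0..1}" for t \<theta>
    unfolding time_deriv_def
    by (rule vector_derivative_within_closed_interval[OF _ that 1[OF that]]) simp
  have \<theta>d: "\<theta>_deriv p t \<theta> = D (t, \<theta>) (0, 1)" if "t \<in> {0..1}" for t \<theta>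
    by (rule vector_derivative_at[OF 2[OF that]])
  show "continuous_on ({0..1} \<times> UNIV) (\<lambda>(t, \<theta>). time_deriv p t \<theta>)"
    using cont[of "(1, 0)"] by (rule continuous_on_eq) (use td in auto)
  show "continuous_on ({0..1} \<times> UNIV) (\<lambda>(t, \<theta>). \<theta>_deriv p t \<theta>)"
    using cont[of "(0, 1)"] by (rule continuous_on_eq) (use \<theta>d in auto)
  show "t \<in> {0..1} \<Longrightarrow> ((\<lambda>s. p s \<theta>) has_vector_derivative time_deriv p t \<theta>) (at t within {0..1})"
    using 1 td by simp
  show "t \<in> {0..1} \<Longrightarrow> (p t has_vector_derivative \<theta>_deriv p t \<theta>) (at \<theta>)"
    using 2 \<theta>d by simp
qed

lemma smooth_path_immersed: "smooth_path p \<Longrightarrow> t \<in> {0..1} \<Longrightarrow> \<theta>_deriv p t \<theta> \<noteq> 0"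
  by (auto simp: smooth_path_def Imm_def)

lemma integral_nonneg_real:
  fixes f :: "real \<Rightarrow> real"
  assumes "\<And>x. 0 \<le> f x"
  shows "0 \<le> integral S f"
  by (cases "f integrable_on S")
     (auto intro: Henstock_Kurzweil_Integration.integral_nonneg assms simp: not_integrable_integral)

lemma curve_length_nonneg: "0 \<le> curve_length c"
  unfolding curve_length_def by (rule integral_nonneg_real) simp

text \<open>
  For a velocity \<open>u\<close> along a curve with derivative \<open>w\<close>, the number \<open>Im (cnj w * u)\<close> is the
  signed area density \<open>det (w, u)\<close>, that is, the normal speed times \<open>norm w\<close>. Hence this is the
  integral of the squared normal speed against arc length.
\<close>

definition normal_energy :: "(real \<Rightarrow> complex) \<Rightarrow> (real \<Rightarrow> complex) \<Rightarrow> real" where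
  "normal_energy w u = integral {0..2 * pi} (\<lambda>\<theta>. (Im (cnj (w \<theta>) * u \<theta>))\<^sup>2 / norm (w \<theta>))"

lemma normal_energy_nonneg: "0 \<le> normal_energy w u"
  unfolding normal_energy_def by (rule integral_nonneg_real) simp

definition speed_G :: "(real \<Rightarrow> real) \<Rightarrow> (real \<Rightarrow> real \<Rightarrow> complex) \<Rightarrow> real \<Rightarrow> real" where
  "speed_G \<phi> p t = sqrt (\<phi> (curve_length (p t)) * normal_energy (\<theta>_deriv p t) (time_deriv p t))"

lemma G_metric_normal_velocity:
  assumes "\<And>\<theta>. \<theta>_deriv p t \<theta> \<noteq> 0"
  shows "G_metric \<phi> (p t) (normal_velocity p t) (normal_velocity p t)
    = \<phi> (curve_length (p t)) * normal_energy (\<theta>_deriv p t) (time_deriv p t)"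
proof -
  have "(normal_velocity p t \<theta> \<bullet> normal_velocity p t \<theta>) * norm (\<theta>_deriv p t \<theta>)
      = (Im (cnj (\<theta>_deriv p t \<theta>) * time_deriv p t \<theta>))\<^sup>2 / norm (\<theta>_deriv p t \<theta>)" for \<theta>
  proof -
    define w where "w = \<theta>_deriv p t \<theta>"
    define u where "u = time_deriv p t \<theta>"
    have w: "norm w > 0" using assms by (simp add: w_def)
    define n where "n = \<i> * w / of_real (norm w)"
    have "norm n = 1" using w by (simp add: n_def norm_mult norm_divide)
    then have nn: "n \<bullet> n = 1" by (simp add: dot_square_norm)
    have "n = (1 / norm w) *\<^sub>R (\<i> * w)"
      by (simp add: n_def scaleR_conv_of_real divide_inverse mult.commute)
    then have un: "u \<bullet> n = Im (cnj w * u) / norm w"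
      by (simp add: inner_complex_def algebra_simps diff_divide_distrib)
    have "((u \<bullet> n) *\<^sub>R n \<bullet> (u \<bullet> n) *\<^sub>R n) * norm w = (u \<bullet> n)\<^sup>2 * norm w"
      by (simp add: nn power2_eq_square)
    also have "\<dots> = (Im (cnj w * u))\<^sup>2 / norm w"
      unfolding un using w by (simp add: power2_eq_square)
    finally show ?thesis
      unfolding normal_velocity_def unit_normal_def w_def[symmetric] u_def[symmetric] n_def[symmetric] .
  qed
  then show ?thesis
    by (simp add: G_metric_def normal_energy_def)
qed

lemma length_G_eq:
  assumes "smooth_path p"
  shows "length_G \<phi> p = integral {0..1} (speed_G \<phi> p)"
  unfolding length_G_def speed_G_def
  by (rule integral_cong) (simp add: G_metric_normal_velocity smooth_path_immersed[OF assms])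

lemma continuous_on_integral_slice:
  fixes f :: "real \<Rightarrow> real \<Rightarrow> real"
  assumes "continuous_on ({0..1} \<times> UNIV) (\<lambda>(t, \<theta>). f t \<theta>)"
  shows "continuous_on {0..1} (\<lambda>t. integral {0..2*pi} (f t))"
proof -
  have "continuous_on ({0..1} \<times> cbox 0 (2*pi)) (\<lambda>(t, \<theta>). f t \<theta>)"
    by (rule continuous_on_subset[OF assms]) auto
  from integral_continuous_on_param[OF this] show ?thesis
    by (simp add: cbox_interval)
qed

lemma continuous_on_curve_length:
  assumes "smooth_path p" shows "continuous_on {0..1} (\<lambda>t. curve_length (p t))"
  unfolding curve_length_def
  using continuous_on_\<theta>_deriv[OF assms]
  by (intro continuous_on_integral_slice) (auto simp: case_prod_unfold intro!: continuous_intros)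

lemma continuous_on_speed_G:
  assumes "smooth_path p" "continuous_on UNIV \<phi>"
  shows "continuous_on {0..1} (speed_G \<phi> p)"
proof -
  have "continuous_on {0..1} (\<lambda>t. normal_energy (\<theta>_deriv p t) (time_deriv p t))"
    unfolding normal_energy_def
    using continuous_on_\<theta>_deriv[OF assms(1)] continuous_on_time_deriv[OF assms(1)] smooth_path_immersed[OF assms(1)]
    by (intro continuous_on_integral_slice) (auto simp: case_prod_unfold intro!: continuous_intros)
  moreover have "continuous_on {0..1} (\<lambda>t. \<phi> (curve_length (p t)))"
    by (rule continuous_on_compose2[OF assms(2) continuous_on_curve_length[OF assms(1)]]) simp
  ultimately show ?thesis
    unfolding speed_G_def[abs_def] by (intro continuous_intros)
qed

text \<open>
  A time change only multiplies the velocity by a constant on each curve. The two paths need to agree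
  near \<open>t\<close> only, which is the form required for piecewise defined paths.
\<close>

lemma speed_G_reparam:
  assumes p: "smooth_path p" and N: "open N" "t \<in> N" "t \<in> {0..1}"
    and r: "\<And>s. s \<in> N \<Longrightarrow> r s = p (\<gamma> s)" and \<gamma>: "\<And>s. \<gamma> s \<in> {0..1}"
    and d: "(\<gamma> has_field_derivative \<gamma>') (at t)"
  shows "speed_G \<phi> r t = \<bar>\<gamma>'\<bar> * speed_G \<phi> p (\<gamma> t)"
proof -
  have rt: "r t = p (\<gamma> t)" using r N by simp
  have u: "time_deriv r t \<theta> = \<gamma>' *\<^sub>R time_deriv p (\<gamma> t) \<theta>" for \<theta>
  proof -
    have "((\<lambda>s. p s \<theta>) \<circ> \<gamma> has_vector_derivative \<gamma>' *\<^sub>R time_deriv p (\<gamma> t) \<theta>) (at t within {0..1})"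
    proof (rule vector_diff_chain_within)
      show "(\<gamma> has_vector_derivative \<gamma>') (at t within {0..1})"
        using d by (simp add: has_real_derivative_iff_has_vector_derivative has_vector_derivative_at_within)
      show "((\<lambda>s. p s \<theta>) has_vector_derivative time_deriv p (\<gamma> t) \<theta>) (at (\<gamma> t) within \<gamma> ` {0..1})"
        by (rule has_vector_derivative_within_subset[OF has_time_deriv[OF p \<gamma>]]) (use \<gamma> in auto)
    qed
    moreover obtain e where "e > 0" "ball t e \<subseteq> N"
      using N openE by blast
    ultimately have "((\<lambda>s. r s \<theta>) has_vector_derivative \<gamma>' *\<^sub>R time_deriv p (\<gamma> t) \<theta>) (at t within {0..1})"
      by (elim has_vector_derivative_transform_within[OF _ _ N(3)])
         (use r in \<open>auto simp: dist_commute subset_iff\<close>)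
    then show ?thesis
      unfolding time_deriv_def by (rule vector_derivative_within_closed_interval[OF _ N(3), rotated]) simp
  qed
  have "normal_energy (\<theta>_deriv r t) (time_deriv r t)
      = \<gamma>'\<^sup>2 * normal_energy (\<theta>_deriv p (\<gamma> t)) (time_deriv p (\<gamma> t))"
    unfolding normal_energy_def rt u integral_mult_right[symmetric]
    by (rule integral_cong) (simp add: power2_eq_square algebra_simps)
  then show ?thesis
    unfolding speed_G_def rt by (simp add: real_sqrt_mult)
qed

lemma Ck_on_path_reparam:
  fixes \<gamma> :: "real \<Rightarrow> real"
  assumes "smooth_path p" "\<And>s. \<gamma> s \<in> {0..1}" "\<And>n. Ck_on n \<gamma> UNIV"
  shows "Ck_on n (\<lambda>(t, \<theta>). p (\<gamma> t) \<theta>) UNIV"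
proof -
  obtain U g where U: "open U" "{0..1} \<times> UNIV \<subseteq> U" and
    g: "\<And>t \<theta>. t \<in> {0..1} \<Longrightarrow> g (t, \<theta>) = p t \<theta>" and C: "\<And>n. Ck_on n g U"
    using smooth_path_extension[OF assms(1)] by metis
  have pr: "Ck_on n (fst :: real \<times> real \<Rightarrow> real) UNIV" "Ck_on n (snd :: real \<times> real \<Rightarrow> real) UNIV"
    using Ck_on_bounded_linear[OF open_UNIV bounded_linear_fst Ck_on_id]
      Ck_on_bounded_linear[OF open_UNIV bounded_linear_snd Ck_on_id] by auto
  have "Ck_on n (\<lambda>z::real \<times> real. \<gamma> (fst z)) UNIV"
    by (rule Ck_on_compose[OF _ _ _ pr(1) assms(3)]) auto
  then have "Ck_on n (\<lambda>z::real \<times> real. (\<gamma> (fst z), 0::real) + (0, snd z)) UNIV"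
    using pr(2)
    by (intro Ck_on_add Ck_on_bounded_linear[where L = "\<lambda>x. (x, 0)"] Ck_on_bounded_linear[where L = "\<lambda>x. (0, x)"]
        bounded_linear_Pair bounded_linear_ident bounded_linear_zero) auto
  from Ck_on_compose[OF open_UNIV U(1) _ this C]
  have "Ck_on n (\<lambda>z::real \<times> real. g ((\<gamma> (fst z), 0) + (0, snd z))) UNIV"
    using U(2) assms(2) by force
  moreover have "(\<lambda>z::real \<times> real. g ((\<gamma> (fst z), 0) + (0, snd z))) = (\<lambda>(t, \<theta>). p (\<gamma> t) \<theta>)"
    using g assms(2) by (auto simp: fun_eq_iff)
  ultimately show ?thesis by simp
qed

section \<open>Paths between parametrized curves\<close>

text \<open>
  The end curves are prescribed as parametrized curves, not up to reparametrization. This is the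
  stronger requirement, and it lets paths be joined end to end without any change of parameter. The
  slack \<open>\<eta>\<close> is there because the bound \<open>L\<close> need not be attained by a path.
\<close>

definition connects :: "(real \<Rightarrow> real) \<Rightarrow> real \<Rightarrow> (real \<Rightarrow> complex) \<Rightarrow> (real \<Rightarrow> complex) \<Rightarrow> bool" where
  "connects \<phi> L c d \<longleftrightarrow>
     (\<forall>\<eta>>0. \<exists>p. smooth_path p \<and> p 0 = c \<and> p 1 = d \<and> length_G \<phi> p \<le> L + \<eta>)"

lemma connects_mono: "connects \<phi> L c d \<Longrightarrow> L \<le> L' \<Longrightarrow> connects \<phi> L' c d"
  unfolding connects_def by (meson add_right_mono order_trans)

lemma connects_limit:
  assumes "\<And>\<eta>. \<eta> > 0 \<Longrightarrow> connects \<phi> (L + \<eta>) c d" shows "connects \<phi> L c d"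
  unfolding connects_def
proof (intro allI impI)
  fix \<eta> :: real assume "\<eta> > 0"
  then have "connects \<phi> (L + \<eta>/2) c d" "\<eta>/2 > 0" using assms by auto
  then have "\<exists>p. smooth_path p \<and> p 0 = c \<and> p 1 = d \<and> length_G \<phi> p \<le> L + \<eta>/2 + \<eta>/2"
    unfolding connects_def by blast
  then show "\<exists>p. smooth_path p \<and> p 0 = c \<and> p 1 = d \<and> length_G \<phi> p \<le> L + \<eta>"
    by (simp add: add.assoc)
qed

lemma connects_sym:
  assumes "connects \<phi> L c d" "continuous_on UNIV \<phi>" shows "connects \<phi> L d c"
  unfolding connects_def
proof (intro allI impI)
  fix \<eta> :: real assume "\<eta> > 0"
  then obtain p where p: "smooth_path p" "p 0 = c" "p 1 = d" "length_G \<phi> p \<le> L + \<eta>"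
    using assms(1) unfolding connects_def by blast
  define \<gamma> where "\<gamma> = (\<lambda>t. smooth_step (1 - t))"
  define r where "r = (\<lambda>t. p (\<gamma> t))"
  have \<gamma>: "\<gamma> s \<in> {0..1}" for s unfolding \<gamma>_def by (rule smooth_step_range)
  have C: "Ck_on n \<gamma> UNIV" for n
    unfolding \<gamma>_def by (rule Ck_on_compose[OF _ _ _ _ Ck_on_smooth_step]) (auto intro!: Ck_on_diff Ck_on_const Ck_on_id)
  have d: "(\<gamma> has_field_derivative - smooth_step' (1 - t)) (at t)" for t
  proof -
    have "((\<lambda>t. 1 - t) has_field_derivative - 1) (at t)" by (auto intro!: derivative_eq_intros)
    then show ?thesis unfolding \<gamma>_def using DERIV_chain2[OF DERIV_smooth_step] by force
  qed
  have sm: "smooth_path r"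
    using Ck_on_path_reparam[OF p(1) \<gamma> C] p(1) \<gamma>
    by (intro smooth_pathI) (auto simp: r_def smooth_path_def)
  have "speed_G \<phi> r t = smooth_step' (1 - t) * speed_G \<phi> p (\<gamma> t)" if "t \<in> {0..1}" for t
    using speed_G_reparam[OF p(1) open_UNIV _ that, of r \<gamma>, OF _ _ \<gamma> d] smooth_step'_nonneg[of "1 - t"]
    by (simp add: r_def)
  then have "length_G \<phi> r = integral {0..1} (\<lambda>t. smooth_step' (1 - t) * speed_G \<phi> p (\<gamma> t))"
    unfolding length_G_eq[OF sm] by (rule integral_cong)
  also have "\<dots> = length_G \<phi> p"
    using has_integral_substitution_general[where s="{}" and a=0 and b=1 and g=\<gamma> and c=0 and d=1 and
        g'="\<lambda>t. - smooth_step' (1 - t)", OF _ _ _ continuous_on_speed_G[OF p(1) assms(2)]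
          Ck_on_continuous[OF C, THEN continuous_on_subset] has_field_derivative_at_within[OF d]] \<gamma>
    by (simp add: \<gamma>_def smooth_step_eq_0 smooth_step_eq_1 image_subset_iff length_G_eq[OF p(1)]
        has_integral_iff integral_neg)
  finally show "\<exists>p. smooth_path p \<and> p 0 = d \<and> p 1 = c \<and> length_G \<phi> p \<le> L + \<eta>"
    using p sm by (intro exI[of _ r]) (simp add: r_def \<gamma>_def smooth_step_eq_0 smooth_step_eq_1)
qed

text \<open>
  Both paths are run through \<^const>\<open>smooth_step\<close>, each in half of the time.
\<close>

lemma connects_trans:
  assumes "connects \<phi> L1 c d" "connects \<phi> L2 d e" "continuous_on UNIV \<phi>"
  shows "connects \<phi> (L1 + L2) c e"
  unfolding connects_def
proof (intro allI impI)
  fix \<eta> :: real assume "\<eta> > 0"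
  then have "\<eta>/2 > 0" by simp
  obtain p where p: "smooth_path p" "p 0 = c" "p 1 = d" "length_G \<phi> p \<le> L1 + \<eta>/2"
    using assms(1) \<open>\<eta>/2 > 0\<close> unfolding connects_def by blast
  obtain q where q: "smooth_path q" "q 0 = d" "q 1 = e" "length_G \<phi> q \<le> L2 + \<eta>/2"
    using assms(2) \<open>\<eta>/2 > 0\<close> unfolding connects_def by blast
  define \<gamma> where "\<gamma> = (\<lambda>t. smooth_step (2 * t))"
  define \<delta> where "\<delta> = (\<lambda>t. smooth_step (2 * t - 1))"
  define r where "r = (\<lambda>t. if t \<le> 1/2 then p (\<gamma> t) else q (\<delta> t))"
  have \<gamma>: "\<gamma> s \<in> {0..1}" and \<delta>: "\<delta> s \<in> {0..1}" for s
    unfolding \<gamma>_def \<delta>_def by (rule smooth_step_range)+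
  have C\<gamma>: "Ck_on n \<gamma> UNIV" and C\<delta>: "Ck_on n \<delta> UNIV" for n
    unfolding \<gamma>_def \<delta>_def
    by (rule Ck_on_compose[OF _ _ _ _ Ck_on_smooth_step]; auto intro!: Ck_on_mult Ck_on_diff Ck_on_const Ck_on_id)+
  have d\<gamma>: "(\<gamma> has_field_derivative smooth_step' (2 * t) * 2) (at t)" for t
    unfolding \<gamma>_def by (rule DERIV_chain2[OF DERIV_smooth_step]) (auto intro!: derivative_eq_intros)
  have d\<delta>: "(\<delta> has_field_derivative smooth_step' (2 * t - 1) * 2) (at t)" for t
    unfolding \<delta>_def by (rule DERIV_chain2[OF DERIV_smooth_step]) (auto intro!: derivative_eq_intros)
  \<comment> \<open>both pieces rest at the common point \<open>d\<close> for \<open>t\<close> between \<open>1/3\<close> and \<open>2/3\<close>\<close>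
  have r1: "r t = p (\<gamma> t)" if "t < 2/3" for t
    using that p q by (auto simp: r_def \<gamma>_def \<delta>_def smooth_step_eq_0 smooth_step_eq_1)
  have r2: "r t = q (\<delta> t)" if "t > 1/3" for t
    using that p q by (auto simp: r_def \<gamma>_def \<delta>_def smooth_step_eq_0 smooth_step_eq_1)
  have "Ck_on n (\<lambda>(t, \<theta>). r t \<theta>) UNIV" for n
  proof -
    have "Ck_on n (\<lambda>(t, \<theta>). r t \<theta>) ({..<2/3} \<times> UNIV)"
      using Ck_on_subset[OF Ck_on_path_reparam[OF p(1) \<gamma> C\<gamma>]]
      by (rule Ck_on_cong[rotated 2]) (use r1 in \<open>auto intro!: open_Times\<close>)
    moreover have "Ck_on n (\<lambda>(t, \<theta>). r t \<theta>) ({1/3<..} \<times> UNIV)"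
      using Ck_on_subset[OF Ck_on_path_reparam[OF q(1) \<delta> C\<delta>]]
      by (rule Ck_on_cong[rotated 2]) (use r2 in \<open>auto intro!: open_Times\<close>)
    moreover have "{..<2/3} \<times> UNIV \<union> {1/3<..} \<times> UNIV = (UNIV :: (real \<times> real) set)"
      by auto
    ultimately show ?thesis
      using Ck_on_Un[of "{..<2/3} \<times> UNIV" "{1/3<..} \<times> UNIV" n "\<lambda>(t, \<theta>). r t \<theta>"] by (auto simp: open_Times)
  qed
  then have sm: "smooth_path r"
    using p(1) q(1) \<gamma> \<delta> by (intro smooth_pathI) (auto simp: smooth_path_def r_def)
  have s1: "speed_G \<phi> r t = (smooth_step' (2 * t) * 2) *\<^sub>R speed_G \<phi> p (\<gamma> t)" if "t \<in> {0..1/2}" for t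
    using speed_G_reparam[OF p(1) _ _ _ r1 \<gamma> d\<gamma>, of "{..<2/3}" t] that smooth_step'_nonneg[of "2 * t"]
    by simp
  have s2: "speed_G \<phi> r t = (smooth_step' (2 * t - 1) * 2) *\<^sub>R speed_G \<phi> q (\<delta> t)" if "t \<in> {1/2..1}" for t
    using speed_G_reparam[OF q(1) _ _ _ r2 \<delta> d\<delta>, of "{1/3<..}" t] that smooth_step'_nonneg[of "2 * t - 1"]
    by simp
  have "((\<lambda>t. (smooth_step' (2 * t) * 2) *\<^sub>R speed_G \<phi> p (\<gamma> t)) has_integral
      (integral {\<gamma> 0..\<gamma> (1/2)} (speed_G \<phi> p))) {0..1/2}"
    by (rule has_integral_substitution[OF _ _ _ continuous_on_speed_G[OF p(1) assms(3)]])
       (use \<gamma> d\<gamma> in \<open>auto simp: \<gamma>_def smooth_step_eq_0 smooth_step_eq_1 intro: has_field_derivative_at_within\<close>)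
  then have i1: "(speed_G \<phi> r has_integral length_G \<phi> p) {0..1/2}"
    by (subst has_integral_cong[OF s1]) (simp_all add: length_G_eq[OF p(1)] \<gamma>_def smooth_step_eq_0 smooth_step_eq_1)
  have "((\<lambda>t. (smooth_step' (2 * t - 1) * 2) *\<^sub>R speed_G \<phi> q (\<delta> t)) has_integral
      (integral {\<delta> (1/2)..\<delta> 1} (speed_G \<phi> q))) {1/2..1}"
    by (rule has_integral_substitution[OF _ _ _ continuous_on_speed_G[OF q(1) assms(3)]])
       (use \<delta> d\<delta> in \<open>auto simp: \<delta>_def smooth_step_eq_0 smooth_step_eq_1 intro: has_field_derivative_at_within\<close>)
  then have i2: "(speed_G \<phi> r has_integral length_G \<phi> q) {1/2..1}"
    by (subst has_integral_cong[OF s2]) (simp_all add: length_G_eq[OF q(1)] \<delta>_def smooth_step_eq_0 smooth_step_eq_1)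
  have "length_G \<phi> r = length_G \<phi> p + length_G \<phi> q"
    unfolding length_G_eq[OF sm]
    by (rule integral_unique, rule has_integral_combine[OF _ _ i1 i2]) auto
  then show "\<exists>p. smooth_path p \<and> p 0 = c \<and> p 1 = e \<and> length_G \<phi> p \<le> L1 + L2 + \<eta>"
    using p q sm by (intro exI[of _ r]) (auto simp: r_def \<gamma>_def \<delta>_def smooth_step_eq_0 smooth_step_eq_1)
qed

section \<open>Straight-line paths\<close>

text \<open>
  The properties of the weight on which the upper bounds rest. They are shared by \<open>l \<mapsto> l\<close> and
  \<open>l \<mapsto> exp (A * l)\<close> with \<open>A > 0\<close>.
\<close>

locale length_weight =
  fixes \<phi> :: "real \<Rightarrow> real"
  assumes continuous_weight: "continuous_on UNIV \<phi>"
    and mono_weight: "mono_on {0..} \<phi>"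
    and weight_0: "0 \<le> \<phi> 0"
begin

lemma weight_mono: "0 \<le> x \<Longrightarrow> x \<le> y \<Longrightarrow> \<phi> x \<le> \<phi> y"
  using mono_onD[OF mono_weight] by simp

lemma weight_nonneg: "0 \<le> x \<Longrightarrow> 0 \<le> \<phi> x"
  using weight_mono[of 0 x] weight_0 by simp

text \<open>
  The price of moving along a segment in the space of curves, in terms of bounds \<open>F\<close> for the length
  density and \<open>H\<close> for the energy density that hold all along the segment. Monotonicity of the weight
  is what allows the length to be replaced by its bound.
\<close>

lemma connects_affine:
  assumes A: "\<And>n. Ck_on n A UNIV" "\<And>\<theta>. A (\<theta> + 2 * pi) = A \<theta>"
      "\<And>\<theta>. (A has_vector_derivative A' \<theta>) (at \<theta>)"
    and B: "\<And>n. Ck_on n B UNIV" "\<And>\<theta>. B (\<theta> + 2 * pi) = B \<theta>"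
      "\<And>\<theta>. (B has_vector_derivative B' \<theta>) (at \<theta>)"
    and imm: "\<And>r \<theta>. r \<in> {0..1} \<Longrightarrow> A' \<theta> + r *\<^sub>R B' \<theta> \<noteq> 0"
    and cont: "continuous_on {0..2 * pi} F" "continuous_on {0..2 * pi} H"
    and F: "\<And>r \<theta>. r \<in> {0..1} \<Longrightarrow> \<theta> \<in> {0..2 * pi} \<Longrightarrow> norm (A' \<theta> + r *\<^sub>R B' \<theta>) \<le> F \<theta>"
    and H: "\<And>r \<theta>. r \<in> {0..1} \<Longrightarrow> \<theta> \<in> {0..2 * pi} \<Longrightarrow>
        (Im (cnj (A' \<theta> + r *\<^sub>R B' \<theta>) * B \<theta>))\<^sup>2 / norm (A' \<theta> + r *\<^sub>R B' \<theta>) \<le> H \<theta>"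
  shows "connects \<phi> (sqrt (\<phi> (integral {0..2 * pi} F) * integral {0..2 * pi} H)) A (\<lambda>\<theta>. A \<theta> + B \<theta>)"
proof -
  define p where "p = (\<lambda>r \<theta>. A \<theta> + r *\<^sub>R B \<theta>)"
  have p': "(p r has_vector_derivative A' \<theta> + r *\<^sub>R B' \<theta>) (at \<theta>)" for r \<theta>
    unfolding p_def by (auto intro!: derivative_eq_intros A(3) B(3))
  then have \<theta>d: "\<theta>_deriv p r \<theta> = A' \<theta> + r *\<^sub>R B' \<theta>" for r \<theta>
    by (rule vector_derivative_at)
  have td: "time_deriv p r \<theta> = B \<theta>" if "r \<in> {0..1}" for r \<theta>
    unfolding time_deriv_def
  proof (rule vector_derivative_within_closed_interval[OF _ that])
    show "((\<lambda>s. p s \<theta>) has_vector_derivative B \<theta>) (at r within {0..1})"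
      unfolding p_def by (auto intro!: derivative_eq_intros)
  qed simp
  have Ap: "Ck_on n (\<lambda>z::real \<times> real. A (snd z)) UNIV" and Bp: "Ck_on n (\<lambda>z::real \<times> real. B (snd z)) UNIV" for n
    using Ck_on_bounded_linear[OF open_UNIV bounded_linear_snd Ck_on_id[OF open_UNIV]]
    by (auto intro: Ck_on_compose[OF _ _ _ _ A(1)] Ck_on_compose[OF _ _ _ _ B(1)])
  have "Ck_on n (\<lambda>z::real \<times> real. A (snd z) + fst z *\<^sub>R B (snd z)) UNIV" for n
    by (intro Ck_on_add Ck_on_bilinear[OF _ bounded_bilinear_scaleR] Ap Bp
        Ck_on_bounded_linear[OF open_UNIV bounded_linear_fst Ck_on_id]) auto
  then have Ckp: "Ck_on n (\<lambda>(r, \<theta>). p r \<theta>) UNIV" for n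
    by (simp add: p_def case_prod_unfold)
  have "p r \<in> Imm" if "r \<in> {0..1}" for r
    unfolding Imm_iff
  proof (intro conjI allI)
    show "Ck_on n (p r) UNIV" for n
      unfolding p_def by (intro Ck_on_add A(1) B(1) Ck_on_bilinear[OF _ bounded_bilinear_scaleR] Ck_on_const) auto
    show "\<theta>_deriv p r \<theta> \<noteq> 0" for \<theta> using imm[OF that] by (simp add: \<theta>d)
  qed (simp add: p_def A(2) B(2))
  with Ckp have sm: "smooth_path p" by (rule smooth_pathI)
  have "continuous_on UNIV A" "continuous_on UNIV B"
    using A(1) B(1) Ck_on_continuous by blast+
  moreover have "continuous_on UNIV A'" "continuous_on UNIV B'"
    using Ck_on_vector_derivative[OF open_UNIV A(1), of 0] Ck_on_vector_derivative[OF open_UNIV B(1), of 0]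
      vector_derivative_at[OF A(3)] vector_derivative_at[OF B(3)] by auto
  ultimately have c: "continuous_on {0..2*pi} A" "continuous_on {0..2*pi} B"
      "continuous_on {0..2*pi} A'" "continuous_on {0..2*pi} B'"
    using continuous_on_subset by blast+
  have le: "speed_G \<phi> p r \<le> sqrt (\<phi> (integral {0..2 * pi} F) * integral {0..2 * pi} H)"
    if r: "r \<in> {0..1}" for r
  proof -
    have "curve_length (p r) \<le> integral {0..2*pi} F"
      unfolding curve_length_def \<theta>d
      by (intro integral_le integrable_continuous_real cont F r continuous_intros c)
    moreover have "normal_energy (\<theta>_deriv p r) (time_deriv p r) \<le> integral {0..2*pi} H"
      unfolding normal_energy_def \<theta>d td[OF r]
      by (intro integral_le integrable_continuous_real cont H r continuous_intros c) (use imm r in auto)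
    ultimately show ?thesis
      unfolding speed_G_def using curve_length_nonneg[of "p r"] normal_energy_nonneg[of "\<theta>_deriv p r" "time_deriv p r"]
      by (intro real_sqrt_le_mono mult_mono weight_mono weight_nonneg) auto
  qed
  have "length_G \<phi> p \<le> integral {0..1} (\<lambda>_::real. sqrt (\<phi> (integral {0..2 * pi} F) * integral {0..2 * pi} H))"
    unfolding length_G_eq[OF sm]
    by (intro integral_le integrable_continuous_real continuous_on_speed_G sm continuous_weight) (use le in auto)
  then show ?thesis
    unfolding connects_def using sm by (intro allI impI exI[of _ p]) (auto simp: p_def)
qed

end

lemma periodic_vector_derivative:
  fixes f :: "real \<Rightarrow> 'a::real_normed_vector"
  assumes "\<And>\<theta>. f (\<theta> + 2 * pi) = f \<theta>" and "\<And>\<theta>. (f has_vector_derivative f' \<theta>) (at \<theta>)"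
  shows "f' (\<theta> + 2 * pi) = f' \<theta>"
proof -
  have "(f \<circ> (\<lambda>x. x + 2 * pi) has_vector_derivative 1 *\<^sub>R f' (\<theta> + 2 * pi)) (at \<theta>)"
    by (rule vector_diff_chain_at[OF _ assms(2)]) (auto intro!: derivative_eq_intros)
  then have "(f has_vector_derivative f' (\<theta> + 2 * pi)) (at \<theta>)"
    by (simp add: o_def assms(1))
  then show ?thesis using assms(2) vector_derivative_unique_at by blast
qed

text \<open>
  Estimates on the compact interval \<open>[0, 2\<pi>]\<close> carry over to the whole line.
\<close>

lemma periodic_ex:
  fixes f :: "real \<Rightarrow> 'a"
  assumes "\<And>\<theta>. f (\<theta> + 2 * pi) = f \<theta>"
  shows "\<exists>\<theta>'\<in>{0..2 * pi}. f \<theta>' = f \<theta>"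
proof -
  have n: "f (\<theta> + 2 * pi * real n) = f \<theta>" for n \<theta>
    by (induction n) (use assms in \<open>auto simp: algebra_simps\<close>, metis assms add.assoc add.commute)
  define k where "k = \<lfloor>\<theta> / (2 * pi)\<rfloor>"
  define \<theta>' where "\<theta>' = \<theta> - 2 * pi * of_int k"
  have "of_int k \<le> \<theta> / (2 * pi)" "\<theta> / (2 * pi) < of_int k + 1"
    unfolding k_def by linarith+
  then have "\<theta>' \<in> {0..2*pi}"
    by (auto simp: \<theta>'_def field_simps)
  moreover have "f \<theta>' = f \<theta>"
  proof (cases "k \<ge> 0")
    case True
    then show ?thesis using n[of \<theta>' "nat k"] by (simp add: \<theta>'_def)
  next
    case False
    then show ?thesis using n[of \<theta> "nat (- k)"] by (simp add: \<theta>'_def)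
  qed
  ultimately show ?thesis by blast
qed

lemma periodic_bounded:
  fixes f :: "real \<Rightarrow> 'a::real_normed_vector"
  assumes "\<And>\<theta>. f (\<theta> + 2 * pi) = f \<theta>" "continuous_on UNIV f"
  shows "\<exists>K>0. \<forall>\<theta>. norm (f \<theta>) \<le> K"
proof -
  have "compact (f ` {0..2*pi})"
    by (intro compact_continuous_image continuous_on_subset[OF assms(2)]) auto
  then obtain K where "K > 0" "\<forall>x\<in>f ` {0..2*pi}. norm x \<le> K"
    using compact_imp_bounded bounded_pos by metis
  then show ?thesis
    using periodic_ex[of f, OF assms(1)] by (metis imageI)
qed

section \<open>Zigzags\<close>

text \<open>
  A smooth substitute for the triangle wave with slopes \<open>\<plusminus>1\<close>: the function
  \<open>k * sin x / sqrt (1 + (k * sin x)\<^sup>2)\<close> tends to the sign of \<open>sin x\<close> as \<open>k\<close> grows, its modulus never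
  exceeds \<open>1\<close>, and it has an elementary periodic primitive.
\<close>

definition zigzag :: "real \<Rightarrow> real \<Rightarrow> real" where
  "zigzag k x = - arcsin (k * cos x / sqrt (1 + k\<^sup>2))"

definition zigzag' :: "real \<Rightarrow> real \<Rightarrow> real" where
  "zigzag' k x = k * sin x / sqrt (1 + (k * sin x)\<^sup>2)"

lemma zigzag_arg: "- 1 < k * cos x / sqrt (1 + k\<^sup>2) \<and> k * cos x / sqrt (1 + k\<^sup>2) < 1"
proof -
  have "(k * cos x)\<^sup>2 \<le> k\<^sup>2 * 1"
    unfolding power_mult_distrib by (intro mult_left_mono) (auto simp: cos_squared_eq)
  then have "(k * cos x)\<^sup>2 < 1 + k\<^sup>2" by simp
  then have "\<bar>k * cos x\<bar> < sqrt (1 + k\<^sup>2)"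
    by (metis real_sqrt_abs real_sqrt_less_iff)
  moreover have "sqrt (1 + k\<^sup>2) > 0" by (simp add: add_pos_nonneg)
  ultimately show ?thesis
    by (auto simp: field_simps abs_less_iff)
qed

lemma zigzag_bound: "\<bar>zigzag k x\<bar> \<le> 2"
proof -
  have "\<bar>arcsin (k * cos x / sqrt (1 + k\<^sup>2))\<bar> \<le> pi/2"
    using zigzag_arg[of k x] arcsin_bounded[of "k * cos x / sqrt (1 + k\<^sup>2)"] by (auto simp: abs_le_iff)
  then show ?thesis using pi_less_4 by (simp add: zigzag_def)
qed

lemma zigzag'_bound: "\<bar>zigzag' k x\<bar> \<le> 1"
proof -
  have "\<bar>k * sin x\<bar> \<le> sqrt (1 + (k * sin x)\<^sup>2)"
    by (rule real_le_rsqrt) simp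
  moreover have "sqrt (1 + (k * sin x)\<^sup>2) > 0" by (simp add: add_pos_nonneg)
  ultimately show ?thesis by (simp add: zigzag'_def abs_divide)
qed

lemma DERIV_zigzag: "(zigzag k has_field_derivative zigzag' k x) (at x)"
proof -
  define q where "q = sqrt (1 + k\<^sup>2)"
  have q: "q > 0" "q\<^sup>2 = 1 + k\<^sup>2" by (simp_all add: q_def add_pos_nonneg)
  have "1 - (k * cos x / q)\<^sup>2 = (q\<^sup>2 - (k * cos x)\<^sup>2) / q\<^sup>2"
    using q(1) by (simp add: power_divide diff_divide_distrib)
  also have "q\<^sup>2 - (k * cos x)\<^sup>2 = 1 + (k * sin x)\<^sup>2"
    unfolding q(2) power_mult_distrib sin_squared_eq by algebra
  finally have "1 - (k * cos x / q)\<^sup>2 = (1 + (k * sin x)\<^sup>2) / q\<^sup>2" .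
  then have s: "sqrt (1 - (k * cos x / q)\<^sup>2) = sqrt (1 + (k * sin x)\<^sup>2) / q"
    using q(1) by (simp add: real_sqrt_divide)
  have "sqrt (1 + (k * sin x)\<^sup>2) > 0" by (simp add: add_pos_nonneg)
  then have "((\<lambda>x. - arcsin (k * cos x / q)) has_field_derivative k * sin x / sqrt (1 + (k * sin x)\<^sup>2)) (at x)"
    using zigzag_arg[of k x, folded q_def] q(1)
    by (auto intro!: derivative_eq_intros simp: s)
  then show ?thesis by (simp add: zigzag_def[abs_def] zigzag'_def q_def)
qed

lemma Ck_on_zigzag: "Ck_on n (zigzag k) UNIV"
proof -
  have "sqrt (1 + k\<^sup>2) \<noteq> 0" by (simp add: add_nonneg_eq_0_iff)
  then have "Ck_on n (\<lambda>x. k * cos x / sqrt (1 + k\<^sup>2)) UNIV"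
    by (intro Ck_on_divide Ck_on_mult Ck_on_const) (use Ck_on_sin_cos in auto)
  then show ?thesis
    unfolding zigzag_def[abs_def]
    by (intro Ck_on_minus Ck_on_compose[OF _ _ _ _ Ck_on_arcsin']) (use zigzag_arg[of k] in auto)
qed

lemma continuous_on_zigzag': "continuous_on S (zigzag' k)"
proof -
  have "sqrt (1 + (k * sin x)\<^sup>2) \<noteq> 0" for x by (simp add: add_nonneg_eq_0_iff)
  then show ?thesis unfolding zigzag'_def[abs_def] by (intro continuous_intros) auto
qed

text \<open>
  The slopes tend to \<open>\<plusminus>1\<close> except at the finitely many points where \<open>sin (N * \<theta>)\<close> vanishes, so
  dominated convergence applies.
\<close>

lemma zigzag'_corners_negligible:
  assumes "N > 0"
  shows "(\<lambda>k. integral {0..2 * pi} (\<lambda>\<theta>. 1 - \<bar>zigzag' (real k) (real N * \<theta>)\<bar>)) \<longlonglongrightarrow> 0"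
proof -
  define l where "l = (\<lambda>\<theta>. if sin (real N * \<theta>) = 0 then 1 else 0 :: real)"
  have lim: "(\<lambda>k. 1 - \<bar>zigzag' (real k) (real N * \<theta>)\<bar>) \<longlonglongrightarrow> l \<theta>" for \<theta>
  proof (cases "sin (real N * \<theta>) = 0")
    case True
    then show ?thesis by (simp add: zigzag'_def l_def)
  next
    case False
    define s where "s = \<bar>sin (real N * \<theta>)\<bar>"
    have "s > 0" using False by (simp add: s_def)
    then have "(\<lambda>k. 1 - real k * s / sqrt (1 + (real k * s)\<^sup>2)) \<longlonglongrightarrow> 0"
      by real_asymp
    moreover have "1 - real k * s / sqrt (1 + (real k * s)\<^sup>2) = 1 - \<bar>zigzag' (real k) (real N * \<theta>)\<bar>" for k
      by (simp add: zigzag'_def s_def abs_mult abs_divide power_mult_distrib)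
    ultimately show ?thesis using False by (simp add: l_def)
  qed
  have "(\<lambda>k. integral {0..2 * pi} (\<lambda>\<theta>. 1 - \<bar>zigzag' (real k) (real N * \<theta>)\<bar>)) \<longlonglongrightarrow> integral {0..2 * pi} l"
  proof (rule dominated_convergence(2)[where h = "\<lambda>_. 1"])
    show "(\<lambda>\<theta>. 1 - \<bar>zigzag' (real k) (real N * \<theta>)\<bar>) integrable_on {0..2 * pi}" for k
      by (intro integrable_continuous_real continuous_intros
          continuous_on_compose2[OF continuous_on_zigzag'[of UNIV]]) auto
    show "norm (1 - \<bar>zigzag' (real k) (real N * \<theta>)\<bar>) \<le> 1" for k \<theta>
      using zigzag'_bound[of "real k" "real N * \<theta>"] by (auto simp: abs_le_iff)
  qed (use lim in auto)
  also have "integral {0..2 * pi} l = 0"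
  proof -
    let ?S = "{\<theta> \<in> {0..2 * pi}. sin (real N * \<theta>) = 0}"
    have "?S \<subseteq> (\<lambda>i. of_int i * pi / real N) ` {0..2 * int N}"
    proof
      fix \<theta> assume \<theta>: "\<theta> \<in> ?S"
      then obtain i :: int where i: "real N * \<theta> = of_int i * pi"
        by (auto simp: sin_zero_iff_int2)
      have "0 \<le> real N * \<theta>" "real N * \<theta> \<le> real N * (2 * pi)"
        using \<theta> by (auto intro!: mult_left_mono)
      then have "0 \<le> of_int i * pi" "of_int i * pi \<le> of_int (2 * int N) * pi"
        unfolding i by (auto simp: algebra_simps)
      then have "0 \<le> i" "i \<le> 2 * int N"
        using pi_gt_zero by (simp_all only: mult_le_cancel_right_pos zero_le_mult_iff of_int_le_iff of_int_0_le_iff) auto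
      moreover have "\<theta> = of_int i * pi / real N"
        using i assms by (simp add: field_simps)
      ultimately show "\<theta> \<in> (\<lambda>i. of_int i * pi / real N) ` {0..2 * int N}" by auto
    qed
    then have "finite ?S" by (rule finite_subset) simp
    then have "(l has_integral 0) {0..2 * pi}"
      by (rule has_integral_spike_finite[OF _ _ has_integral_0]) (auto simp: l_def)
    then show ?thesis by (rule integral_unique)
  qed
  finally show ?thesis .
qed

section \<open>Displacements of a fixed curve\<close>

text \<open>
  Wiggling makes a moving curve cheap: let \<open>R\<close> be the tangent of a wiggling curve in units of the
  tangent of the unperturbed curve, and \<open>Y\<close> the slope of the wiggles. When the curve moves across
  the unperturbed one with unit speed, its energy density is \<open>(Re R)\<^sup>2 / norm R\<close>, and this is only
  about \<open>1 / \<bar>Y\<bar>\<close> on steep parts. The estimate is uniform in \<open>Y\<close> because \<open>\<bar>Y\<bar>\<close> exceeds \<open>norm R\<close>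
  by at most \<open>\<nu>\<close>.
\<close>

lemma energy_of_steep_tangent:
  assumes "norm (R - (1 + \<i> * of_real Y)) \<le> \<nu>" "\<nu> \<le> 1/4"
  shows "(Re R)\<^sup>2 / norm R * \<bar>Y\<bar> \<le> 1 + 4 * \<nu>"
proof -
  have "\<bar>Re (R - (1 + \<i> * of_real Y))\<bar> \<le> \<nu>" "\<bar>Im (R - (1 + \<i> * of_real Y))\<bar> \<le> \<nu>"
    using assms(1) abs_Re_le_cmod abs_Im_le_cmod order_trans by blast+
  then have re: "\<bar>Re R - 1\<bar> \<le> \<nu>" and im: "\<bar>Im R - Y\<bar> \<le> \<nu>" by simp_all
  have \<nu>: "0 \<le> \<nu>" using re by linarith
  have R: "0 < Re R" "Re R \<le> 1 + \<nu>" using re assms(2) by linarith+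
  have n: "Re R \<le> norm R" "\<bar>Im R\<bar> \<le> norm R" by (auto simp: complex_Re_le_cmod abs_Im_le_cmod)
  then have pos: "norm R > 0" using R by linarith
  have "Re R * \<bar>Y\<bar> \<le> Re R * (\<bar>Im R\<bar> + \<nu>)"
    using im R(1) by (intro mult_left_mono) linarith+
  also have "\<dots> \<le> (1 + \<nu>) * norm R + norm R * \<nu>"
    using n R \<nu> by (simp add: distrib_left) (intro add_mono mult_mono; simp)
  finally have "Re R * (Re R * \<bar>Y\<bar>) \<le> (1 + \<nu>) * ((1 + \<nu>) * norm R + norm R * \<nu>)"
    using R \<nu> by (intro mult_mono) (auto intro!: mult_nonneg_nonneg)
  also have "\<dots> = ((1 + \<nu>) * (1 + 2 * \<nu>)) * norm R" by (simp add: algebra_simps)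
  also have "\<dots> \<le> (1 + 4 * \<nu>) * norm R"
  proof (rule mult_right_mono)
    have "\<nu> * (2 * \<nu>) \<le> \<nu> * 1" using \<nu> assms(2) by (intro mult_left_mono) auto
    then show "(1 + \<nu>) * (1 + 2 * \<nu>) \<le> 1 + 4 * \<nu>" by (simp add: algebra_simps)
  qed simp
  finally show ?thesis
    using pos by (simp add: field_simps power2_eq_square)
qed

locale weighted_curve = length_weight +
  fixes c :: "real \<Rightarrow> complex"
  assumes c_Imm: "c \<in> Imm"
begin

text \<open>
  Displacements of \<open>c\<close> are written as \<open>w * \<tau>\<close> with a complex function \<open>w\<close>, so that \<open>Re w\<close> is the
  tangential and \<open>Im w\<close> the normal part. The derivative of \<open>c + w * \<tau>\<close> is then
  \<open>\<tau> * (1 + w' + w * z)\<close>, where \<open>z\<close> is the logarithmic derivative of \<open>\<tau>\<close>; its imaginary part is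
  the curvature of \<open>c\<close> times \<open>g\<close>.
\<close>

definition "\<tau> \<theta> = vector_derivative c (at \<theta>)"

definition "z \<theta> = vector_derivative \<tau> (at \<theta>) / \<tau> \<theta>"

definition "g \<theta> = norm (\<tau> \<theta>)"

lemma c_smooth: "Ck_on n c UNIV" and c_periodic: "c (\<theta> + 2 * pi) = c \<theta>" and \<tau>_nonzero: "\<tau> \<theta> \<noteq> 0"
  using c_Imm by (auto simp: Imm_iff \<tau>_def)

lemma g_pos: "g \<theta> > 0"
  by (simp add: g_def \<tau>_nonzero)

lemma c_deriv: "(c has_vector_derivative \<tau> \<theta>) (at \<theta>)"
  unfolding \<tau>_def by (rule Ck_on_Suc_has_vector_derivative[OF c_smooth UNIV_I])

lemma \<tau>_smooth: "Ck_on n \<tau> UNIV"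
  unfolding \<tau>_def[abs_def] by (rule Ck_on_vector_derivative[OF open_UNIV c_smooth])

lemma \<tau>_deriv: "(\<tau> has_vector_derivative z \<theta> * \<tau> \<theta>) (at \<theta>)"
  using Ck_on_Suc_has_vector_derivative[OF \<tau>_smooth UNIV_I] by (simp add: z_def \<tau>_nonzero)

lemma \<tau>_periodic: "\<tau> (\<theta> + 2 * pi) = \<tau> \<theta>"
  by (rule periodic_vector_derivative[OF c_periodic c_deriv])

lemma z_periodic: "z (\<theta> + 2 * pi) = z \<theta>"
proof -
  have "z (\<theta> + 2 * pi) * \<tau> (\<theta> + 2 * pi) = z \<theta> * \<tau> \<theta>"
    by (rule periodic_vector_derivative[OF \<tau>_periodic \<tau>_deriv])
  then show ?thesis by (simp add: \<tau>_periodic \<tau>_nonzero)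
qed

lemma g_periodic: "g (\<theta> + 2 * pi) = g \<theta>"
  by (simp add: g_def \<tau>_periodic)

lemma g_smooth: "Ck_on n g UNIV"
  unfolding g_def[abs_def] by (rule Ck_on_norm[OF open_UNIV \<tau>_smooth]) (simp add: \<tau>_nonzero)

lemma g_cont: "continuous_on S g"
  using Ck_on_continuous[OF g_smooth] continuous_on_subset by blast

lemma z_cont: "continuous_on S z"
proof -
  have "continuous_on UNIV z"
    unfolding z_def[abs_def]
    using Ck_on_continuous[OF Ck_on_vector_derivative[OF open_UNIV \<tau>_smooth]] Ck_on_continuous[OF \<tau>_smooth] \<tau>_nonzero
    by (intro continuous_intros) auto
  then show ?thesis using continuous_on_subset by blast
qed

lemma z_bounded: "\<exists>Z>0. \<forall>\<theta>. norm (z \<theta>) \<le> Z"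
  by (rule periodic_bounded[OF z_periodic z_cont])

lemma curve_length_eq: "curve_length c = integral {0..2 * pi} g"
  unfolding curve_length_def g_def[abs_def] \<tau>_def ..

text \<open>
  In the frame \<open>\<tau>\<close> the curve is immersed as soon as the quotient \<open>R\<close> of the two tangents has no
  zero. Purely normal wiggles, however steep, hardly affect the real part of \<open>R\<close>, so this stays true
  also where the area density vanishes.
\<close>

lemma connects_frame:
  assumes \<alpha>: "\<And>n. Ck_on n \<alpha> UNIV" "\<And>\<theta>. \<alpha> (\<theta> + 2 * pi) = \<alpha> \<theta>"
      "\<And>\<theta>. (\<alpha> has_vector_derivative \<alpha>' \<theta>) (at \<theta>)"
    and \<beta>: "\<And>n. Ck_on n \<beta> UNIV" "\<And>\<theta>. \<beta> (\<theta> + 2 * pi) = \<beta> \<theta>"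
      "\<And>\<theta>. (\<beta> has_vector_derivative \<beta>' \<theta>) (at \<theta>)"
    and R: "\<And>r \<theta>. R r \<theta> = 1 + (\<alpha>' \<theta> + \<alpha> \<theta> * z \<theta>) + r *\<^sub>R (\<beta>' \<theta> + \<beta> \<theta> * z \<theta>)"
    and imm: "\<And>r \<theta>. r \<in> {0..1} \<Longrightarrow> R r \<theta> \<noteq> 0"
    and cont: "continuous_on {0..2 * pi} F" "continuous_on {0..2 * pi} H"
    and F: "\<And>r \<theta>. r \<in> {0..1} \<Longrightarrow> g \<theta> * norm (R r \<theta>) \<le> F \<theta>"
    and H: "\<And>r \<theta>. r \<in> {0..1} \<Longrightarrow> g \<theta> ^ 3 * ((Im (cnj (R r \<theta>) * \<beta> \<theta>))\<^sup>2 / norm (R r \<theta>)) \<le> H \<theta>"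
  shows "connects \<phi> (sqrt (\<phi> (integral {0..2 * pi} F) * integral {0..2 * pi} H))
    (\<lambda>\<theta>. c \<theta> + \<alpha> \<theta> * \<tau> \<theta>) (\<lambda>\<theta>. c \<theta> + (\<alpha> \<theta> + \<beta> \<theta>) * \<tau> \<theta>)"
proof -
  have "connects \<phi> (sqrt (\<phi> (integral {0..2 * pi} F) * integral {0..2 * pi} H))
    (\<lambda>\<theta>. c \<theta> + \<alpha> \<theta> * \<tau> \<theta>) (\<lambda>\<theta>. (c \<theta> + \<alpha> \<theta> * \<tau> \<theta>) + \<beta> \<theta> * \<tau> \<theta>)"
  proof (rule connects_affine)
    show "Ck_on n (\<lambda>\<theta>. c \<theta> + \<alpha> \<theta> * \<tau> \<theta>) UNIV" "Ck_on n (\<lambda>\<theta>. \<beta> \<theta> * \<tau> \<theta>) UNIV" for n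
      by (intro Ck_on_add Ck_on_mult c_smooth \<tau>_smooth \<alpha>(1) \<beta>(1) open_UNIV)+
    show "((\<lambda>\<theta>. c \<theta> + \<alpha> \<theta> * \<tau> \<theta>) has_vector_derivative \<tau> \<theta> * (1 + (\<alpha>' \<theta> + \<alpha> \<theta> * z \<theta>))) (at \<theta>)" for \<theta>
      by (rule has_vector_derivative_eq_rhs,
          rule has_vector_derivative_add[OF c_deriv has_vector_derivative_mult[OF \<alpha>(3) \<tau>_deriv]])
         (simp add: algebra_simps)
    show "((\<lambda>\<theta>. \<beta> \<theta> * \<tau> \<theta>) has_vector_derivative \<tau> \<theta> * (\<beta>' \<theta> + \<beta> \<theta> * z \<theta>)) (at \<theta>)" for \<theta>
      by (rule has_vector_derivative_eq_rhs, rule has_vector_derivative_mult[OF \<beta>(3) \<tau>_deriv])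
         (simp add: algebra_simps)
    have *: "I\<^sup>2 / (x * n) = x ^ 3 * (X\<^sup>2 / n)" if "I = x\<^sup>2 * X" "x > 0" for I X x n :: real
      using that by (simp add: power2_eq_square power3_eq_cube)
    have eq: "\<tau> \<theta> * (1 + (\<alpha>' \<theta> + \<alpha> \<theta> * z \<theta>)) + r *\<^sub>R (\<tau> \<theta> * (\<beta>' \<theta> + \<beta> \<theta> * z \<theta>)) = \<tau> \<theta> * R r \<theta>" for r \<theta>
      unfolding R by (simp add: algebra_simps scaleR_conv_of_real)
    fix r \<theta> :: real assume r: "r \<in> {0..1}"
    show "\<tau> \<theta> * (1 + (\<alpha>' \<theta> + \<alpha> \<theta> * z \<theta>)) + r *\<^sub>R (\<tau> \<theta> * (\<beta>' \<theta> + \<beta> \<theta> * z \<theta>)) \<noteq> 0"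
      unfolding eq using \<tau>_nonzero imm r by simp
    show "norm (\<tau> \<theta> * (1 + (\<alpha>' \<theta> + \<alpha> \<theta> * z \<theta>)) + r *\<^sub>R (\<tau> \<theta> * (\<beta>' \<theta> + \<beta> \<theta> * z \<theta>))) \<le> F \<theta>"
      unfolding eq using F[OF r] by (simp add: norm_mult g_def)
    have "cnj (\<tau> \<theta> * R r \<theta>) * (\<beta> \<theta> * \<tau> \<theta>) = (\<tau> \<theta> * cnj (\<tau> \<theta>)) * (cnj (R r \<theta>) * \<beta> \<theta>)"
      by simp
    also have "\<dots> = of_real ((g \<theta>)\<^sup>2) * (cnj (R r \<theta>) * \<beta> \<theta>)"
      unfolding g_def by (simp only: complex_norm_square)
    finally have "Im (cnj (\<tau> \<theta> * R r \<theta>) * (\<beta> \<theta> * \<tau> \<theta>)) = (g \<theta>)\<^sup>2 * Im (cnj (R r \<theta>) * \<beta> \<theta>)"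
      by (simp only: Im_complex_of_real Re_complex_of_real complex.sel times_complex.sel)
    then have "(Im (cnj (\<tau> \<theta> * R r \<theta>) * (\<beta> \<theta> * \<tau> \<theta>)))\<^sup>2 / norm (\<tau> \<theta> * R r \<theta>)
        = g \<theta> ^ 3 * ((Im (cnj (R r \<theta>) * \<beta> \<theta>))\<^sup>2 / norm (R r \<theta>))"
      using * g_pos[of \<theta>] by (simp only: norm_mult g_def[symmetric])
    then show "(Im (cnj (\<tau> \<theta> * (1 + (\<alpha>' \<theta> + \<alpha> \<theta> * z \<theta>)) + r *\<^sub>R (\<tau> \<theta> * (\<beta>' \<theta> + \<beta> \<theta> * z \<theta>))) * (\<beta> \<theta> * \<tau> \<theta>)))\<^sup>2
        / norm (\<tau> \<theta> * (1 + (\<alpha>' \<theta> + \<alpha> \<theta> * z \<theta>)) + r *\<^sub>R (\<tau> \<theta> * (\<beta>' \<theta> + \<beta> \<theta> * z \<theta>))) \<le> H \<theta>"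
      unfolding eq using H[OF r] by simp
  qed (use cont in \<open>simp_all add: c_periodic \<alpha>(2) \<beta>(2) \<tau>_periodic\<close>)
  then show ?thesis by (simp add: algebra_simps)
qed

definition "G3 = integral {0..2 * pi} (\<lambda>\<theta>. g \<theta> ^ 3)"

lemma G3_nonneg: "0 \<le> G3"
  unfolding G3_def
  by (rule integral_nonneg_real) (simp add: g_pos less_imp_le)

text \<open>
  A tangential displacement costs only to second order: its normal speed is proportional to
  \<open>P * Im R\<close>, where \<open>P\<close> and the deviation of \<open>R\<close> from \<open>1\<close> are both small.
\<close>

lemma connects_tangential:
  fixes P P' :: "real \<Rightarrow> real"
  assumes P: "\<And>n. Ck_on n P UNIV" "\<And>\<theta>. P (\<theta> + 2 * pi) = P \<theta>"
      "\<And>\<theta>. (P has_real_derivative P' \<theta>) (at \<theta>)"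
    and \<rho>: "\<And>\<theta>. \<bar>P \<theta>\<bar> \<le> \<rho>" and \<mu>: "\<And>\<theta>. norm (of_real (P' \<theta>) + of_real (P \<theta>) * z \<theta>) \<le> \<mu>" "\<mu> \<le> 1/2"
  shows "connects \<phi> (\<rho> * \<mu> * sqrt (\<phi> (2 * curve_length c) * (2 * G3))) c (\<lambda>\<theta>. c \<theta> + of_real (P \<theta>) * \<tau> \<theta>)"
proof -
  define R where "R = (\<lambda>r \<theta>. 1 + (0 + 0 * z \<theta>) + r *\<^sub>R (of_real (P' \<theta>) + of_real (P \<theta>) * z \<theta>))"
  have \<rho>0: "0 \<le> \<rho>" "0 \<le> \<mu>" using \<rho>[of 0] norm_ge_zero[THEN order_trans, OF \<mu>(1)] by auto
  have E: "norm (R r \<theta> - 1) \<le> \<mu>" if "r \<in> {0..1}" for r \<theta>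
  proof -
    have "norm (R r \<theta> - 1) = r * norm (of_real (P' \<theta>) + of_real (P \<theta>) * z \<theta>)"
      using that by (simp add: R_def)
    also have "\<dots> \<le> 1 * \<mu>" using that \<mu> by (intro mult_mono) auto
    finally show ?thesis by simp
  qed
  have lo: "1/2 \<le> norm (R r \<theta>)" and hi: "norm (R r \<theta>) \<le> 2" if "r \<in> {0..1}" for r \<theta>
    using E[OF that, of \<theta>] \<mu>(2) norm_triangle_ineq2[of 1 "1 - R r \<theta>"] norm_triangle_ineq[of 1 "R r \<theta> - 1"]
    by (auto simp: norm_minus_commute)
  have "connects \<phi> (sqrt (\<phi> (integral {0..2 * pi} (\<lambda>\<theta>. g \<theta> * 2)) *
      integral {0..2 * pi} (\<lambda>\<theta>. g \<theta> ^ 3 * ((\<rho> * \<mu>)\<^sup>2 * 2))))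
    (\<lambda>\<theta>. c \<theta> + 0 * \<tau> \<theta>) (\<lambda>\<theta>. c \<theta> + (0 + of_real (P \<theta>)) * \<tau> \<theta>)"
  proof (rule connects_frame[where \<alpha>' = "\<lambda>_. 0" and R = R and \<beta>' = "\<lambda>\<theta>. of_real (P' \<theta>)"])
    fix r \<theta> :: real assume r: "r \<in> {0..1}"
    show "R r \<theta> \<noteq> 0" using lo[OF r, of \<theta>] by auto
    show "g \<theta> * norm (R r \<theta>) \<le> g \<theta> * 2" using hi[OF r] g_pos[of \<theta>] by simp
    have "Im (cnj (R r \<theta>) * of_real (P \<theta>)) = - Im (R r \<theta> - 1) * P \<theta>" by simp
    then have "\<bar>Im (cnj (R r \<theta>) * of_real (P \<theta>))\<bar> = \<bar>Im (R r \<theta> - 1)\<bar> * \<bar>P \<theta>\<bar>"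
      by (simp add: abs_mult)
    also have "\<dots> \<le> \<mu> * \<rho>"
      using E[OF r, of \<theta>] abs_Im_le_cmod[of "R r \<theta> - 1"] \<rho> \<rho>0 by (intro mult_mono) auto
    finally have "(Im (cnj (R r \<theta>) * of_real (P \<theta>)))\<^sup>2 \<le> (\<rho> * \<mu>)\<^sup>2"
      by (simp add: abs_le_square_iff[symmetric] \<rho>0 mult.commute)
    then have "(Im (cnj (R r \<theta>) * of_real (P \<theta>)))\<^sup>2 / norm (R r \<theta>) \<le> (\<rho> * \<mu>)\<^sup>2 / (1/2)"
      using lo[OF r] by (intro frac_le) auto
    then show "g \<theta> ^ 3 * ((Im (cnj (R r \<theta>) * of_real (P \<theta>)))\<^sup>2 / norm (R r \<theta>)) \<le> g \<theta> ^ 3 * ((\<rho> * \<mu>)\<^sup>2 * 2)"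
      using g_pos[of \<theta>] by (intro mult_left_mono) auto
  qed (auto simp: R_def P(2) intro!: Ck_on_const Ck_on_bounded_linear[OF _ bounded_linear_of_real] P(1)
      has_vector_derivative_of_real P(3) continuous_intros g_cont)
  moreover have "sqrt (\<phi> (integral {0..2 * pi} (\<lambda>\<theta>. g \<theta> * 2)) *
      integral {0..2 * pi} (\<lambda>\<theta>. g \<theta> ^ 3 * ((\<rho> * \<mu>)\<^sup>2 * 2))) = \<rho> * \<mu> * sqrt (\<phi> (2 * curve_length c) * (2 * G3))"
  proof -
    have "\<phi> (integral {0..2 * pi} (\<lambda>\<theta>. g \<theta> * 2)) * integral {0..2 * pi} (\<lambda>\<theta>. g \<theta> ^ 3 * ((\<rho> * \<mu>)\<^sup>2 * 2))
        = (\<rho> * \<mu>)\<^sup>2 * (\<phi> (2 * curve_length c) * (2 * G3))"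
      by (simp add: curve_length_eq G3_def integral_mult_left mult_ac)
    then show ?thesis using \<rho>0 by (simp only: real_sqrt_mult[of "(\<rho> * \<mu>)\<^sup>2"]) simp
  qed
  ultimately show ?thesis by simp
qed

text \<open>
  Adding a zigzag \<open>\<zeta>\<close> in the normal direction costs no more than a constant times its amplitude
  \<open>\<epsilon>\<close>, where the constant depends on a bound for the slope of \<open>\<zeta>\<close> but not on its frequency.
\<close>

lemma connects_zigzag:
  fixes \<zeta> \<zeta>' :: "real \<Rightarrow> real"
  assumes \<alpha>: "\<And>n. Ck_on n \<alpha> UNIV" "\<And>\<theta>. \<alpha> (\<theta> + 2 * pi) = \<alpha> \<theta>"
      "\<And>\<theta>. (\<alpha> has_vector_derivative \<alpha>' \<theta>) (at \<theta>)" "\<And>\<theta>. norm (\<alpha>' \<theta> + \<alpha> \<theta> * z \<theta>) \<le> 1/4"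
    and \<zeta>: "\<And>n. Ck_on n \<zeta> UNIV" "\<And>\<theta>. \<zeta> (\<theta> + 2 * pi) = \<zeta> \<theta>"
      "\<And>\<theta>. (\<zeta> has_real_derivative \<zeta>' \<theta>) (at \<theta>)"
    and \<epsilon>: "\<And>\<theta>. \<bar>\<zeta> \<theta>\<bar> \<le> \<epsilon>" and \<zeta>z: "\<And>\<theta>. \<bar>\<zeta> \<theta>\<bar> * norm (z \<theta>) \<le> 1/4"
    and B: "\<And>\<theta>. \<bar>\<zeta>' \<theta>\<bar> \<le> B"
  shows "connects \<phi> (\<epsilon> * sqrt (\<phi> ((2 + B) * curve_length c) * ((2 + B) * G3)))
    (\<lambda>\<theta>. c \<theta> + \<alpha> \<theta> * \<tau> \<theta>) (\<lambda>\<theta>. c \<theta> + (\<alpha> \<theta> + \<i> * of_real (\<zeta> \<theta>)) * \<tau> \<theta>)"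
proof -
  define R where "R = (\<lambda>r \<theta>. 1 + (\<alpha>' \<theta> + \<alpha> \<theta> * z \<theta>) +
    r *\<^sub>R (\<i> * of_real (\<zeta>' \<theta>) + \<i> * of_real (\<zeta> \<theta>) * z \<theta>))"
  have e0: "0 \<le> \<epsilon>" "0 \<le> B" using \<epsilon>[of 0] B[of 0] by linarith+
  have E: "norm (R r \<theta> - 1 - \<i> * of_real (r * \<zeta>' \<theta>)) \<le> 1/2" if "r \<in> {0..1}" for r \<theta>
  proof -
    have "R r \<theta> - 1 - \<i> * of_real (r * \<zeta>' \<theta>) = (\<alpha>' \<theta> + \<alpha> \<theta> * z \<theta>) + r *\<^sub>R (\<i> * of_real (\<zeta> \<theta>) * z \<theta>)"
      by (simp add: R_def scaleR_conv_of_real algebra_simps)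
    also have "norm \<dots> \<le> 1/4 + r * (\<bar>\<zeta> \<theta>\<bar> * norm (z \<theta>))"
      using \<alpha>(4)[of \<theta>] that by (intro norm_triangle_le) (simp add: norm_mult)
    also have "\<dots> \<le> 1/4 + 1 * (1/4)"
      using that \<zeta>z[of \<theta>] by (intro add_mono mult_mono) auto
    finally show ?thesis by simp
  qed
  have lo: "R r \<theta> \<noteq> 0" if "r \<in> {0..1}" for r \<theta>
    using E[OF that, of \<theta>] abs_Re_le_cmod[of "R r \<theta> - 1 - \<i> * of_real (r * \<zeta>' \<theta>)"] by auto
  have hi: "norm (R r \<theta>) \<le> 2 + B" if r: "r \<in> {0..1}" for r \<theta>
  proof -
    have "\<bar>r * \<zeta>' \<theta>\<bar> \<le> 1 * B" using r B[of \<theta>] unfolding abs_mult by (intro mult_mono) auto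
    then have "norm (1 + \<i> * of_real (r * \<zeta>' \<theta>)) \<le> 1 + B"
      by (intro norm_triangle_le) (simp add: norm_mult)
    then show ?thesis
      using E[OF r, of \<theta>] norm_triangle_ineq[of "R r \<theta> - 1 - \<i> * of_real (r * \<zeta>' \<theta>)" "1 + \<i> * of_real (r * \<zeta>' \<theta>)"]
      by simp
  qed
  have "connects \<phi> (sqrt (\<phi> (integral {0..2 * pi} (\<lambda>\<theta>. g \<theta> * (2 + B))) *
      integral {0..2 * pi} (\<lambda>\<theta>. g \<theta> ^ 3 * (\<epsilon>\<^sup>2 * (2 + B)))))
    (\<lambda>\<theta>. c \<theta> + \<alpha> \<theta> * \<tau> \<theta>) (\<lambda>\<theta>. c \<theta> + (\<alpha> \<theta> + \<i> * of_real (\<zeta> \<theta>)) * \<tau> \<theta>)"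
  proof (rule connects_frame[where \<alpha>' = \<alpha>' and R = R and \<beta>' = "\<lambda>\<theta>. \<i> * of_real (\<zeta>' \<theta>)"])
    show "((\<lambda>\<theta>. \<i> * of_real (\<zeta> \<theta>)) has_vector_derivative \<i> * of_real (\<zeta>' \<theta>)) (at \<theta>)" for \<theta>
      by (rule has_vector_derivative_mult_right[OF has_vector_derivative_of_real[OF \<zeta>(3)]])
    fix r \<theta> :: real assume r: "r \<in> {0..1}"
    show "R r \<theta> \<noteq> 0" by (rule lo[OF r])
    show "g \<theta> * norm (R r \<theta>) \<le> g \<theta> * (2 + B)" using hi[OF r] g_pos[of \<theta>] by simp
    have "\<bar>Im (cnj (R r \<theta>) * (\<i> * of_real (\<zeta> \<theta>)))\<bar> \<le> norm (R r \<theta>) * \<epsilon>"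
      using \<epsilon>[of \<theta>] by (intro order_trans[OF abs_Im_le_cmod]) (simp add: norm_mult mult_left_mono)
    then have "(Im (cnj (R r \<theta>) * (\<i> * of_real (\<zeta> \<theta>))))\<^sup>2 \<le> (norm (R r \<theta>) * \<epsilon>)\<^sup>2"
      using e0 by (intro abs_le_square_iff[THEN iffD1]) simp
    then have "(Im (cnj (R r \<theta>) * (\<i> * of_real (\<zeta> \<theta>))))\<^sup>2 / norm (R r \<theta>) \<le> \<epsilon>\<^sup>2 * norm (R r \<theta>)"
      using lo[OF r, of \<theta>] by (simp add: divide_le_eq power2_eq_square mult_ac)
    also have "\<dots> \<le> \<epsilon>\<^sup>2 * (2 + B)" using hi[OF r] by (intro mult_left_mono) auto
    finally show "g \<theta> ^ 3 * ((Im (cnj (R r \<theta>) * (\<i> * of_real (\<zeta> \<theta>))))\<^sup>2 / norm (R r \<theta>)) \<le> g \<theta> ^ 3 * (\<epsilon>\<^sup>2 * (2 + B))"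
      using g_pos[of \<theta>] by (intro mult_left_mono) auto
  qed (auto simp: R_def \<zeta>(2) \<alpha>(2) intro!: Ck_on_mult Ck_on_const Ck_on_bounded_linear[OF _ bounded_linear_of_real] \<zeta>(1) \<alpha>(1)
      \<alpha>(3) continuous_intros g_cont)
  moreover have "sqrt (\<phi> (integral {0..2 * pi} (\<lambda>\<theta>. g \<theta> * (2 + B))) *
      integral {0..2 * pi} (\<lambda>\<theta>. g \<theta> ^ 3 * (\<epsilon>\<^sup>2 * (2 + B))))
      = \<epsilon> * sqrt (\<phi> ((2 + B) * curve_length c) * ((2 + B) * G3))"
  proof -
    have "\<phi> (integral {0..2 * pi} (\<lambda>\<theta>. g \<theta> * (2 + B))) * integral {0..2 * pi} (\<lambda>\<theta>. g \<theta> ^ 3 * (\<epsilon>\<^sup>2 * (2 + B)))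
        = \<epsilon>\<^sup>2 * (\<phi> ((2 + B) * curve_length c) * ((2 + B) * G3))"
      by (simp only: curve_length_eq G3_def integral_mult_left) (simp add: mult_ac)
    then show ?thesis using e0 by (simp only: real_sqrt_mult[of "\<epsilon>\<^sup>2"]) simp
  qed
  ultimately show ?thesis by simp
qed

text \<open>
  The main saving. The tangents carry wiggles of slope \<open>Y = M * g * Q * y\<close> with \<open>\<bar>y\<bar>\<close> close to \<open>1\<close>,
  and the whole curve is displaced by the normal part \<open>Q\<close>, which sweeps out the area \<open>m\<close>. The
  wiggles add at most the integral of \<open>g * \<bar>Y\<bar>\<close>, hence at most \<open>M * m\<close>, to the length. By
  \<open>energy_of_steep_tangent\<close> the energy density is at most about
  \<open>g\<^sup>3 * Q\<^sup>2 / \<bar>Y\<bar> = g\<^sup>2 * \<bar>Q\<bar> / M\<close>, with integral \<open>m / M\<close>. The product of the two bounds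
  is \<open>m\<^sup>2\<close>, the least value that Cauchy-Schwarz allows, since the slope is proportional to \<open>g * Q\<close>.
  The last term accounts for the corners, where \<open>\<bar>y\<bar>\<close> is far from \<open>1\<close>.
\<close>

lemma connects_sweep:
  fixes Q Q' y :: "real \<Rightarrow> real"
  assumes \<alpha>: "\<And>n. Ck_on n \<alpha> UNIV" "\<And>\<theta>. \<alpha> (\<theta> + 2 * pi) = \<alpha> \<theta>"
      "\<And>\<theta>. (\<alpha> has_vector_derivative \<alpha>' \<theta>) (at \<theta>)"
    and Q: "\<And>n. Ck_on n Q UNIV" "\<And>\<theta>. Q (\<theta> + 2 * pi) = Q \<theta>"
      "\<And>\<theta>. (Q has_real_derivative Q' \<theta>) (at \<theta>)"
    and M: "M > 0" and B: "\<And>\<theta>. M * g \<theta> * \<bar>Q \<theta>\<bar> \<le> B" and D: "\<And>\<theta>. (g \<theta>)\<^sup>2 * \<bar>Q \<theta>\<bar> / M * (2 * B) \<le> D"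
    and y: "continuous_on {0..2 * pi} y" "\<And>\<theta>. \<bar>y \<theta>\<bar> \<le> 1"
    and steep: "\<And>r \<theta>. r \<in> {0..1} \<Longrightarrow> norm (1 + (\<alpha>' \<theta> + \<alpha> \<theta> * z \<theta>) +
        r *\<^sub>R (\<i> * of_real (Q' \<theta>) + \<i> * of_real (Q \<theta>) * z \<theta>) - (1 + \<i> * of_real (M * g \<theta> * Q \<theta> * y \<theta>))) \<le> \<nu>"
    and \<nu>: "\<nu> \<le> 1/4"
    and m: "integral {0..2 * pi} (\<lambda>\<theta>. (g \<theta>)\<^sup>2 * \<bar>Q \<theta>\<bar>) \<le> m"
  shows "connects \<phi> (sqrt (\<phi> ((1 + \<nu>) * curve_length c + M * m) *
      ((1 + 4 * \<nu>) * (m / M) + D * integral {0..2 * pi} (\<lambda>\<theta>. 1 - \<bar>y \<theta>\<bar>))))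
    (\<lambda>\<theta>. c \<theta> + \<alpha> \<theta> * \<tau> \<theta>) (\<lambda>\<theta>. c \<theta> + (\<alpha> \<theta> + \<i> * of_real (Q \<theta>)) * \<tau> \<theta>)"
proof -
  define R where "R = (\<lambda>r \<theta>. 1 + (\<alpha>' \<theta> + \<alpha> \<theta> * z \<theta>) +
    r *\<^sub>R (\<i> * of_real (Q' \<theta>) + \<i> * of_real (Q \<theta>) * z \<theta>))"
  define Y where "Y = (\<lambda>\<theta>. M * g \<theta> * Q \<theta> * y \<theta>)"
  have E: "norm (R r \<theta> - (1 + \<i> * of_real (Y \<theta>))) \<le> \<nu>" if "r \<in> {0..1}" for r \<theta>
    using steep[OF that] by (simp add: R_def Y_def)
  have \<nu>0: "0 \<le> \<nu>" by (rule order_trans[OF norm_ge_zero E[of 0 0]]) simp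
  have Y: "\<bar>Y \<theta>\<bar> = M * g \<theta> * \<bar>Q \<theta>\<bar> * \<bar>y \<theta>\<bar>" for \<theta>
    using M g_pos[of \<theta>] by (simp add: Y_def abs_mult)
  have re: "\<bar>Re (R r \<theta>) - 1\<bar> \<le> \<nu>" if "r \<in> {0..1}" for r \<theta>
    using E[OF that, of \<theta>] abs_Re_le_cmod[of "R r \<theta> - (1 + \<i> * of_real (Y \<theta>))"] by simp
  have contQ: "continuous_on {0..2 * pi} Q"
    using Ck_on_continuous[OF Q(1)] continuous_on_subset by blast
  let ?F = "\<lambda>\<theta>. (1 + \<nu>) * g \<theta> + M * ((g \<theta>)\<^sup>2 * \<bar>Q \<theta>\<bar>)"
  let ?H = "\<lambda>\<theta>. (1 + 4 * \<nu>) / M * ((g \<theta>)\<^sup>2 * \<bar>Q \<theta>\<bar>) + D * (1 - \<bar>y \<theta>\<bar>)"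
  have "connects \<phi> (sqrt (\<phi> (integral {0..2 * pi} ?F) * integral {0..2 * pi} ?H))
    (\<lambda>\<theta>. c \<theta> + \<alpha> \<theta> * \<tau> \<theta>) (\<lambda>\<theta>. c \<theta> + (\<alpha> \<theta> + \<i> * of_real (Q \<theta>)) * \<tau> \<theta>)"
  proof (rule connects_frame[where \<alpha>' = \<alpha>' and R = R and \<beta>' = "\<lambda>\<theta>. \<i> * of_real (Q' \<theta>)"])
    show "((\<lambda>\<theta>. \<i> * of_real (Q \<theta>)) has_vector_derivative \<i> * of_real (Q' \<theta>)) (at \<theta>)" for \<theta>
      by (rule has_vector_derivative_mult_right[OF has_vector_derivative_of_real[OF Q(3)]])
    fix r \<theta> :: real assume r: "r \<in> {0..1}"
    have pos: "0 < Re (R r \<theta>)" "Re (R r \<theta>) \<le> 2" using re[OF r, of \<theta>] \<nu> by linarith+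
    then show R0: "R r \<theta> \<noteq> 0" by auto
    have "norm (1 + \<i> * of_real (Y \<theta>)) \<le> 1 + \<bar>Y \<theta>\<bar>"
      by (intro norm_triangle_le) (simp add: norm_mult)
    moreover have "\<bar>Y \<theta>\<bar> \<le> M * g \<theta> * \<bar>Q \<theta>\<bar>"
      unfolding Y using y(2)[of \<theta>] M g_pos[of \<theta>] by (intro mult_left_le) auto
    ultimately have "norm (R r \<theta>) \<le> (1 + \<nu>) + M * g \<theta> * \<bar>Q \<theta>\<bar>"
      using E[OF r, of \<theta>] norm_triangle_ineq[of "R r \<theta> - (1 + \<i> * of_real (Y \<theta>))" "1 + \<i> * of_real (Y \<theta>)"]
      by simp
    then have "g \<theta> * norm (R r \<theta>) \<le> g \<theta> * ((1 + \<nu>) + M * g \<theta> * \<bar>Q \<theta>\<bar>)"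
      using g_pos[of \<theta>] by simp
    then show "g \<theta> * norm (R r \<theta>) \<le> ?F \<theta>" by (simp add: algebra_simps power2_eq_square)
    define K where "K = (Re (R r \<theta>))\<^sup>2 / norm (R r \<theta>)"
    have n: "Re (R r \<theta>) \<le> norm (R r \<theta>)" "0 < norm (R r \<theta>)" using R0 by (auto simp: complex_Re_le_cmod)
    have "K \<le> Re (R r \<theta>)"
      unfolding K_def using n pos by (simp add: divide_le_eq power2_eq_square mult_left_mono)
    then have K: "0 \<le> K" "K \<le> 2" using pos n by (auto simp: K_def)
    define b where "b = M * g \<theta> * \<bar>Q \<theta>\<bar>"
    have b: "0 \<le> b" "b \<le> B" using M g_pos[of \<theta>] B[of \<theta>] by (auto simp: b_def)
    have "K * b = K * \<bar>Y \<theta>\<bar> + K * (b * (1 - \<bar>y \<theta>\<bar>))"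
      by (simp add: Y b_def algebra_simps)
    also have "\<dots> \<le> (1 + 4 * \<nu>) + 2 * (B * (1 - \<bar>y \<theta>\<bar>))"
      using energy_of_steep_tangent[OF E[OF r, of \<theta>] \<nu>] K b y(2)[of \<theta>]
      by (intro add_mono mult_mono) (auto simp: K_def)
    finally have Kb: "K * b \<le> (1 + 4 * \<nu>) + 2 * (B * (1 - \<bar>y \<theta>\<bar>))" .
    have "(Im (cnj (R r \<theta>) * (\<i> * of_real (Q \<theta>))))\<^sup>2 / norm (R r \<theta>) = \<bar>Q \<theta>\<bar> * \<bar>Q \<theta>\<bar> * K"
      by (simp add: K_def power_mult_distrib) (simp add: power2_eq_square)
    then have "g \<theta> ^ 3 * ((Im (cnj (R r \<theta>) * (\<i> * of_real (Q \<theta>))))\<^sup>2 / norm (R r \<theta>))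
        = (g \<theta>)\<^sup>2 * \<bar>Q \<theta>\<bar> / M * (K * b)"
      using M by (simp only: b_def) (simp add: power2_eq_square power3_eq_cube)
    also have "\<dots> \<le> (g \<theta>)\<^sup>2 * \<bar>Q \<theta>\<bar> / M * ((1 + 4 * \<nu>) + 2 * (B * (1 - \<bar>y \<theta>\<bar>)))"
      using M by (intro mult_left_mono[OF Kb]) auto
    also have "\<dots> = (1 + 4 * \<nu>) / M * ((g \<theta>)\<^sup>2 * \<bar>Q \<theta>\<bar>) + (g \<theta>)\<^sup>2 * \<bar>Q \<theta>\<bar> / M * (2 * B) * (1 - \<bar>y \<theta>\<bar>)"
      by (simp add: algebra_simps add_divide_distrib diff_divide_distrib)
    also have "\<dots> \<le> ?H \<theta>"
      using D[of \<theta>] y(2)[of \<theta>] by (intro add_left_mono mult_right_mono) auto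
    finally show "g \<theta> ^ 3 * ((Im (cnj (R r \<theta>) * (\<i> * of_real (Q \<theta>))))\<^sup>2 / norm (R r \<theta>)) \<le> ?H \<theta>" .
  qed (use M in \<open>auto simp: R_def Q(2) \<alpha>(2) intro!: Ck_on_mult Ck_on_const Ck_on_bounded_linear[OF _ bounded_linear_of_real] Q(1) \<alpha>(1)
      \<alpha>(3) continuous_intros g_cont contQ y(1)\<close>)
  moreover have "sqrt (\<phi> (integral {0..2 * pi} ?F) * integral {0..2 * pi} ?H)
     \<le> sqrt (\<phi> ((1 + \<nu>) * curve_length c + M * m) *
      ((1 + 4 * \<nu>) * (m / M) + D * integral {0..2 * pi} (\<lambda>\<theta>. 1 - \<bar>y \<theta>\<bar>)))"
  proof -
    have int: "(\<lambda>\<theta>. (g \<theta>)\<^sup>2 * \<bar>Q \<theta>\<bar>) integrable_on {0..2 * pi}" "g integrable_on {0..2 * pi}"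
        "(\<lambda>\<theta>. 1 - \<bar>y \<theta>\<bar>) integrable_on {0..2 * pi}"
      by (intro integrable_continuous_real continuous_intros g_cont contQ y(1))+
    have m0: "0 \<le> integral {0..2 * pi} (\<lambda>\<theta>. (g \<theta>)\<^sup>2 * \<bar>Q \<theta>\<bar>)"
      and y0: "0 \<le> integral {0..2 * pi} (\<lambda>\<theta>. 1 - \<bar>y \<theta>\<bar>)"
      by (rule Henstock_Kurzweil_Integration.integral_nonneg[OF int(1)], simp)
         (rule Henstock_Kurzweil_Integration.integral_nonneg[OF int(3)], use y(2) in simp)
    have "0 \<le> M * g 0 * \<bar>Q 0\<bar>" using M g_pos[of 0] by simp
    then have "0 \<le> B" using B[of 0] by linarith
    then have "0 \<le> (g 0)\<^sup>2 * \<bar>Q 0\<bar> / M * (2 * B)" using M by simp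
    then have D0: "0 \<le> D" using D[of 0] by linarith
    have "integral {0..2 * pi} ?F = (1 + \<nu>) * curve_length c + M * integral {0..2 * pi} (\<lambda>\<theta>. (g \<theta>)\<^sup>2 * \<bar>Q \<theta>\<bar>)"
      by (simp add: integral_add int integrable_on_mult_right curve_length_eq)
    moreover have "integral {0..2 * pi} ?H = (1 + 4 * \<nu>) / M * integral {0..2 * pi} (\<lambda>\<theta>. (g \<theta>)\<^sup>2 * \<bar>Q \<theta>\<bar>)
        + D * integral {0..2 * pi} (\<lambda>\<theta>. 1 - \<bar>y \<theta>\<bar>)"
      by (simp only: integral_add int integrable_on_mult_right integral_mult_right)
    moreover have "(1 + 4 * \<nu>) / M * integral {0..2 * pi} (\<lambda>\<theta>. (g \<theta>)\<^sup>2 * \<bar>Q \<theta>\<bar>) \<le> (1 + 4 * \<nu>) / M * m"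
      using M \<nu>0 by (intro mult_left_mono[OF m]) auto
    moreover have "M * integral {0..2 * pi} (\<lambda>\<theta>. (g \<theta>)\<^sup>2 * \<bar>Q \<theta>\<bar>) \<le> M * m"
      using M by (intro mult_left_mono[OF m]) auto
    ultimately show ?thesis
      using M \<nu>0 m0 y0 D0 curve_length_nonneg[of c]
      by (intro real_sqrt_le_mono mult_mono weight_mono weight_nonneg) (auto intro!: add_nonneg_nonneg mult_nonneg_nonneg order_trans[OF m0 m])
  qed
  ultimately show ?thesis by (rule connects_mono)
qed

end

context weighted_curve
begin

text \<open>
  The four stages of a small displacement: the tangential part, growing the zigzag, sweeping
  normally, and removing the zigzag. Let the frequency \<open>N\<close> of the zigzag tend to infinity with fixed
  slopes. Its amplitude tends to \<open>0\<close>, and growing and removing it become free. Then let \<open>k\<close> tend to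
  infinity, so that the corners no longer count. The slope factor \<open>M = e / m\<close> makes the wiggles add
  the length \<open>e\<close>, and the sweep costs \<open>m * sqrt (\<phi> (length + e) / e)\<close> up to the error \<open>\<mu>\<close>, which
  bounds the \<open>C\<^sup>1\<close> size of the displacement. In all stages the tangents differ by at most
  \<open>3 * \<mu> \<le> 1/4\<close> from what the slopes alone would give.
\<close>

lemma connects_displacement:
  assumes w: "\<And>n. Ck_on n w UNIV" "\<And>\<theta>. w (\<theta> + 2 * pi) = w \<theta>"
      "\<And>\<theta>. (w has_vector_derivative w' \<theta>) (at \<theta>)"
    and \<rho>: "\<And>\<theta>. norm (w \<theta>) \<le> \<rho>"
    and \<mu>: "\<And>\<theta>. norm (w' \<theta>) + norm (w \<theta>) * norm (z \<theta>) \<le> \<mu>" "0 < \<mu>" "\<mu> \<le> 1/12"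
    and m: "integral {0..2 * pi} (\<lambda>\<theta>. (g \<theta>)\<^sup>2 * \<bar>Im (w \<theta>)\<bar>) \<le> m" "0 < m"
    and e: "0 < e"
  shows "connects \<phi> (\<rho> * \<mu> * sqrt (\<phi> (2 * curve_length c) * (2 * G3))
      + m * sqrt (\<phi> ((1 + 3 * \<mu>) * curve_length c + e) * (1 + 12 * \<mu>) / e))
    c (\<lambda>\<theta>. c \<theta> + w \<theta> * \<tau> \<theta>)"
proof -
  define P P' Q Q' where "P = (\<lambda>\<theta>. Re (w \<theta>))" "P' = (\<lambda>\<theta>. Re (w' \<theta>))"
    and "Q = (\<lambda>\<theta>. Im (w \<theta>))" "Q' = (\<lambda>\<theta>. Im (w' \<theta>))"
  note PQ_def = this
  have w_eq: "w \<theta> = of_real (P \<theta>) + \<i> * of_real (Q \<theta>)"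
    for \<theta>
    by (simp add: PQ_def complex_eq_iff)
  have P: "Ck_on n P UNIV" "P (\<theta> + 2 * pi) = P \<theta>" "(P has_real_derivative P' \<theta>) (at \<theta>)"
    and Q: "Ck_on n Q UNIV" "Q (\<theta> + 2 * pi) = Q \<theta>" "(Q has_real_derivative Q' \<theta>) (at \<theta>)" for n \<theta>
    unfolding PQ_def
    using Ck_on_bounded_linear[OF open_UNIV bounded_linear_Re w(1)[of n]] w(2)
      Ck_on_bounded_linear[OF open_UNIV bounded_linear_Im w(1)[of n]]
      bounded_linear.has_vector_derivative[OF bounded_linear_Re w(3)]
      bounded_linear.has_vector_derivative[OF bounded_linear_Im w(3)]
    by (simp_all add: has_real_derivative_iff_has_vector_derivative)
  have Pz: "norm (of_real (P' \<theta>) + of_real (P \<theta>) * z \<theta>) \<le> \<mu>"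
    and Qz: "norm (\<i> * of_real (Q' \<theta>) + \<i> * of_real (Q \<theta>) * z \<theta>) \<le> \<mu>"
    and wz: "norm (w' \<theta> + w \<theta> * z \<theta>) \<le> \<mu>" for \<theta>
  proof -
    have "norm (of_real (P' \<theta>) + of_real (P \<theta>) * z \<theta>) \<le> \<bar>P' \<theta>\<bar> + \<bar>P \<theta>\<bar> * norm (z \<theta>)"
      by (intro norm_triangle_le) (simp add: norm_mult)
    also have "\<dots> \<le> norm (w' \<theta>) + norm (w \<theta>) * norm (z \<theta>)"
      unfolding PQ_def by (intro add_mono mult_right_mono abs_Re_le_cmod) auto
    finally show "norm (of_real (P' \<theta>) + of_real (P \<theta>) * z \<theta>) \<le> \<mu>" using \<mu>(1)[of \<theta>] by simp
    have "norm (\<i> * of_real (Q' \<theta>) + \<i> * of_real (Q \<theta>) * z \<theta>) \<le> \<bar>Q' \<theta>\<bar> + \<bar>Q \<theta>\<bar> * norm (z \<theta>)"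
      by (intro norm_triangle_le) (simp add: norm_mult)
    also have "\<dots> \<le> norm (w' \<theta>) + norm (w \<theta>) * norm (z \<theta>)"
      unfolding PQ_def by (intro add_mono mult_right_mono abs_Im_le_cmod) auto
    finally show "norm (\<i> * of_real (Q' \<theta>) + \<i> * of_real (Q \<theta>) * z \<theta>) \<le> \<mu>" using \<mu>(1)[of \<theta>] by simp
    show "norm (w' \<theta> + w \<theta> * z \<theta>) \<le> \<mu>"
      using \<mu>(1)[of \<theta>] norm_triangle_ineq[of "w' \<theta>" "w \<theta> * z \<theta>"] by (simp add: norm_mult)
  qed
  define M where "M = e / m"
  have M: "M > 0" "M * m = e" using e m(2) by (simp_all add: M_def)
  define b where "b = (\<lambda>\<theta>. M * g \<theta> * Q \<theta>)"
  have b: "Ck_on n b UNIV" "b (\<theta> + 2 * pi) = b \<theta>" for n \<theta>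
    unfolding b_def using Q(2) g_periodic by (auto intro!: Ck_on_mult Ck_on_const Q(1) g_smooth)
  define b' where "b' \<theta> = vector_derivative b (at \<theta>)" for \<theta>
  have b_deriv: "(b has_vector_derivative b' \<theta>) (at \<theta>)" for \<theta>
    unfolding b'_def by (rule Ck_on_Suc_has_vector_derivative[OF b(1) UNIV_I])
  have b'_cont: "continuous_on UNIV b'"
    unfolding b'_def by (rule Ck_on_continuous[OF Ck_on_vector_derivative[OF open_UNIV b(1)]])
  obtain B where B: "B > 0" "\<And>\<theta>. \<bar>b \<theta>\<bar> \<le> B"
    using periodic_bounded[of b, OF b(2) Ck_on_continuous[OF b(1)]] by (auto simp del: Ck_on.simps)
  obtain B' where B': "B' > 0" "\<And>\<theta>. \<bar>b' \<theta>\<bar> \<le> B'"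
    using periodic_bounded[of b', OF periodic_vector_derivative[OF b(2) b_deriv] b'_cont] by auto
  obtain Z where Z: "Z > 0" "\<And>\<theta>. norm (z \<theta>) \<le> Z" using z_bounded by blast
  obtain D where D: "D > 0" "\<And>\<theta>. \<bar>(g \<theta>)\<^sup>2 * Q \<theta> / M * (2 * B)\<bar> \<le> D"
  proof -
    have "continuous_on UNIV (\<lambda>\<theta>. (g \<theta>)\<^sup>2 * Q \<theta> / M * (2 * B))"
      using M(1) Ck_on_continuous[OF Q(1)] by (intro continuous_intros g_cont) auto
    from periodic_bounded[OF _ this] show ?thesis
      using that by (auto simp: g_periodic Q(2))
  qed
  have g0: "0 \<le> g \<theta>" for \<theta> using g_pos[of \<theta>] by simp
  \<comment> \<open>\<open>2 * B' + B\<close> bounds the derivative of \<open>b \<theta> * zigzag k (N * \<theta>) / N\<close> for all \<open>k\<close> and \<open>N \<ge> 1\<close>\<close>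
  define c1 where "c1 = sqrt (\<phi> ((2 + (2 * B' + B)) * curve_length c) * ((2 + (2 * B' + B)) * G3))"
  have c1: "0 \<le> c1"
    unfolding c1_def using B(1) B'(1) G3_nonneg curve_length_nonneg[of c]
    by (intro real_sqrt_ge_zero mult_nonneg_nonneg weight_nonneg) auto
  define \<Phi> where "\<Phi> = \<phi> ((1 + 3 * \<mu>) * curve_length c + e)"
  have \<Phi>: "0 \<le> \<Phi>"
    unfolding \<Phi>_def using \<mu>(2) e curve_length_nonneg[of c] by (intro weight_nonneg add_nonneg_nonneg mult_nonneg_nonneg) auto
  show ?thesis
  proof (rule connects_limit)
    fix \<eta> :: real assume \<eta>: "\<eta> > 0"
    obtain N :: nat where N: "2 * (B' + B * Z) / \<mu> + 8 * B * c1 / \<eta> + 1 \<le> real N"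
      using real_arch_simple by blast
    have "0 \<le> 2 * (B' + B * Z) / \<mu>" "0 \<le> 8 * B * c1 / \<eta>"
      using B B' Z \<mu>(2) c1 \<eta> by simp_all
    then have N1: "1 \<le> real N" and "2 * (B' + B * Z) / \<mu> \<le> real N" and "8 * B * c1 / \<eta> \<le> real N"
      using N by linarith+
    then have N\<mu>: "2 * (B' + B * Z) / real N \<le> \<mu>" and N\<eta>: "2 * B / real N * c1 \<le> \<eta> / 4"
      using \<mu>(2) \<eta> by (simp_all add: field_simps)
    have N0: "N > 0" using N1 by simp
    have "(\<lambda>k. sqrt (\<Phi> * (D * integral {0..2 * pi} (\<lambda>\<theta>. 1 - \<bar>zigzag' (real k) (real N * \<theta>)\<bar>)))) \<longlonglongrightarrow> sqrt (\<Phi> * (D * 0))"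
      by (intro tendsto_intros zigzag'_corners_negligible N0)
    then have "eventually (\<lambda>k. sqrt (\<Phi> * (D * integral {0..2 * pi} (\<lambda>\<theta>. 1 - \<bar>zigzag' (real k) (real N * \<theta>)\<bar>))) < \<eta> / 2) sequentially"
      using \<eta> by (intro order_tendstoD(2)) auto
    then obtain k :: nat where
      k: "sqrt (\<Phi> * (D * integral {0..2 * pi} (\<lambda>\<theta>. 1 - \<bar>zigzag' (real k) (real N * \<theta>)\<bar>))) < \<eta> / 2"
      by (auto simp: eventually_sequentially)
    define y where "y = (\<lambda>\<theta>. zigzag' (real k) (real N * \<theta>))"
    define \<zeta> where "\<zeta> = (\<lambda>\<theta>. b \<theta> * (zigzag (real k) (real N * \<theta>) / real N))"
    define \<zeta>' where "\<zeta>' = (\<lambda>\<theta>. b' \<theta> * (zigzag (real k) (real N * \<theta>) / real N) + b \<theta> * y \<theta>)"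
    have s: "\<bar>zigzag (real k) (real N * \<theta>) / real N\<bar> \<le> 2 / real N" for \<theta>
      using zigzag_bound[of "real k" "real N * \<theta>"] N1 by (simp add: abs_divide divide_right_mono)
    have \<zeta>: "Ck_on n \<zeta> UNIV" for n
    proof -
      have "Ck_on n (\<lambda>\<theta>. zigzag (real k) (real N * \<theta>)) UNIV"
        by (rule Ck_on_compose[OF _ _ _ _ Ck_on_zigzag]) (auto intro!: Ck_on_mult Ck_on_const Ck_on_id)
      then show ?thesis
        unfolding \<zeta>_def by (intro Ck_on_mult Ck_on_divide b(1) Ck_on_const) (use N0 in auto)
    qed
    have \<zeta>p: "\<zeta> (\<theta> + 2 * pi) = \<zeta> \<theta>" for \<theta>
    proof -
      have "real N * (\<theta> + 2 * pi) = real N * \<theta> + 2 * real N * pi" by (simp add: algebra_simps)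
      then have "cos (real N * (\<theta> + 2 * pi)) = cos (real N * \<theta>)"
        by (simp only: cos_add sin_2npi cos_2npi)
      then show ?thesis by (simp add: \<zeta>_def zigzag_def b(2))
    qed
    have \<zeta>d: "(\<zeta> has_real_derivative \<zeta>' \<theta>) (at \<theta>)" for \<theta>
    proof -
      have "((\<lambda>\<theta>. zigzag (real k) (real N * \<theta>)) has_real_derivative y \<theta> * real N) (at \<theta>)"
        unfolding y_def by (rule DERIV_chain2[OF DERIV_zigzag]) (auto intro!: derivative_eq_intros)
      from DERIV_cdivide[OF this, of "real N"]
      have d: "((\<lambda>\<theta>. zigzag (real k) (real N * \<theta>) / real N) has_real_derivative y \<theta>) (at \<theta>)"
        using N0 by simp
      show ?thesis
        using DERIV_mult[OF b_deriv[unfolded has_real_derivative_iff_has_vector_derivative[symmetric], of \<theta>] d]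
        unfolding \<zeta>_def \<zeta>'_def by (simp add: algebra_simps)
    qed
    have \<zeta>\<epsilon>: "\<bar>\<zeta> \<theta>\<bar> \<le> 2 * B / real N" for \<theta>
    proof -
      have "\<bar>\<zeta> \<theta>\<bar> \<le> B * (2 / real N)"
        unfolding \<zeta>_def abs_mult using B(1) by (intro mult_mono B(2) s) auto
      then show ?thesis by (simp add: mult.commute)
    qed
    have b's: "\<bar>b' \<theta> * (zigzag (real k) (real N * \<theta>) / real N)\<bar> \<le> 2 * B' / real N" for \<theta>
    proof -
      have "\<bar>b' \<theta> * (zigzag (real k) (real N * \<theta>) / real N)\<bar> \<le> B' * (2 / real N)"
        unfolding abs_mult using B'(1) by (intro mult_mono B'(2) s) auto
      then show ?thesis by (simp add: mult.commute)
    qed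
    have \<zeta>z': "\<bar>\<zeta> \<theta>\<bar> * norm (z \<theta>) \<le> 2 * (B * Z) / real N" for \<theta>
    proof -
      have "\<bar>\<zeta> \<theta>\<bar> * norm (z \<theta>) \<le> 2 * B / real N * Z"
        using B(1) by (intro mult_mono \<zeta>\<epsilon> Z(2)) auto
      then show ?thesis by simp
    qed
    have err: "2 * B' / real N + 2 * (B * Z) / real N \<le> \<mu>"
      using N\<mu> by (simp add: add_divide_distrib distrib_left)
    have "0 \<le> 2 * B' / real N" using B' by simp
    then have \<zeta>z: "\<bar>\<zeta> \<theta>\<bar> * norm (z \<theta>) \<le> 1/4" for \<theta>
      using \<zeta>z'[of \<theta>] err \<mu>(3) by linarith
    have "2 * B' / real N \<le> 2 * B'" using B'(1) N1 by (simp add: field_simps)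
    moreover have "\<bar>b \<theta> * y \<theta>\<bar> \<le> B * 1" for \<theta>
      unfolding abs_mult y_def using B(1) by (intro mult_mono B(2) zigzag'_bound) auto
    ultimately have \<zeta>'B: "\<bar>\<zeta>' \<theta>\<bar> \<le> 2 * B' + B" for \<theta>
      using b's[of \<theta>] abs_triangle_ineq[of "b' \<theta> * (zigzag (real k) (real N * \<theta>) / real N)" "b \<theta> * y \<theta>"]
      unfolding \<zeta>'_def by (smt (verit, ccfv_threshold))
    have PC: "Ck_on n (\<lambda>\<theta>. complex_of_real (P \<theta>)) UNIV" for n
      by (intro Ck_on_bounded_linear[OF _ bounded_linear_of_real] P(1)) simp
    have 1: "connects \<phi> (\<rho> * \<mu> * sqrt (\<phi> (2 * curve_length c) * (2 * G3))) c (\<lambda>\<theta>. c \<theta> + of_real (P \<theta>) * \<tau> \<theta>)"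
    proof (rule connects_tangential[OF P(1) P(2) P(3) _ Pz])
      show "\<bar>P \<theta>\<bar> \<le> \<rho>" for \<theta>
        using \<rho>[of \<theta>] abs_Re_le_cmod[of "w \<theta>"] by (simp add: PQ_def)
    qed (use \<mu>(3) in simp)
    have 2: "connects \<phi> (2 * B / real N * c1) (\<lambda>\<theta>. c \<theta> + of_real (P \<theta>) * \<tau> \<theta>)
        (\<lambda>\<theta>. c \<theta> + (of_real (P \<theta>) + \<i> * of_real (\<zeta> \<theta>)) * \<tau> \<theta>)"
      unfolding c1_def
    proof (rule connects_zigzag[OF PC _ has_vector_derivative_of_real[OF P(3)] _ \<zeta> \<zeta>p \<zeta>d \<zeta>\<epsilon> \<zeta>z \<zeta>'B])
      show "norm (complex_of_real (P' \<theta>) + complex_of_real (P \<theta>) * z \<theta>) \<le> 1/4" for \<theta>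
        using Pz[of \<theta>] \<mu>(3) by linarith
    qed (simp add: P(2))
    \<comment> \<open>removing the zigzag is the reverse of adding it to the displaced curve\<close>
    have 4: "connects \<phi> (2 * B / real N * c1) (\<lambda>\<theta>. c \<theta> + w \<theta> * \<tau> \<theta>)
        (\<lambda>\<theta>. c \<theta> + (w \<theta> + \<i> * of_real (\<zeta> \<theta>)) * \<tau> \<theta>)"
      unfolding c1_def
    proof (rule connects_zigzag[OF w _ \<zeta> \<zeta>p \<zeta>d \<zeta>\<epsilon> \<zeta>z \<zeta>'B])
      show "norm (w' \<theta> + w \<theta> * z \<theta>) \<le> 1/4" for \<theta>
        using wz[of \<theta>] \<mu>(3) by linarith
    qed
    define \<alpha> where "\<alpha> = (\<lambda>\<theta>. of_real (P \<theta>) + \<i> * of_real (\<zeta> \<theta>))"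
    define \<alpha>' where "\<alpha>' = (\<lambda>\<theta>. of_real (P' \<theta>) + \<i> * of_real (\<zeta>' \<theta>))"
    have \<alpha>: "Ck_on n \<alpha> UNIV" "\<alpha> (\<theta> + 2 * pi) = \<alpha> \<theta>" "(\<alpha> has_vector_derivative \<alpha>' \<theta>) (at \<theta>)" for n \<theta>
      unfolding \<alpha>_def \<alpha>'_def
      by (auto intro!: Ck_on_add PC Ck_on_mult Ck_on_const Ck_on_bounded_linear[OF _ bounded_linear_of_real] \<zeta>
          has_vector_derivative_add has_vector_derivative_of_real P(3) has_vector_derivative_mult_right \<zeta>d
          simp: P(2) \<zeta>p)
    have 3: "connects \<phi> (sqrt (\<phi> ((1 + 3 * \<mu>) * curve_length c + M * m) *
        ((1 + 4 * (3 * \<mu>)) * (m / M) + D * integral {0..2 * pi} (\<lambda>\<theta>. 1 - \<bar>y \<theta>\<bar>))))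
       (\<lambda>\<theta>. c \<theta> + \<alpha> \<theta> * \<tau> \<theta>) (\<lambda>\<theta>. c \<theta> + (\<alpha> \<theta> + \<i> * of_real (Q \<theta>)) * \<tau> \<theta>)"
    proof (rule connects_sweep[OF \<alpha> Q M(1)])
      show "M * g \<theta> * \<bar>Q \<theta>\<bar> \<le> B" for \<theta>
        using B(2)[of \<theta>] M(1) g0[of \<theta>] by (simp add: b_def abs_mult)
      show "(g \<theta>)\<^sup>2 * \<bar>Q \<theta>\<bar> / M * (2 * B) \<le> D" for \<theta>
        using D(2)[of \<theta>] M(1) B(1) by (simp add: abs_mult)
      show "continuous_on {0..2 * pi} y"
        unfolding y_def by (rule continuous_on_compose2[OF continuous_on_zigzag'[of UNIV]]) (auto intro!: continuous_intros)
      show "\<bar>y \<theta>\<bar> \<le> 1" for \<theta> unfolding y_def by (rule zigzag'_bound)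
      show "integral {0..2 * pi} (\<lambda>\<theta>. (g \<theta>)\<^sup>2 * \<bar>Q \<theta>\<bar>) \<le> m" using m(1) by (simp add: PQ_def)
      show "3 * \<mu> \<le> 1/4" using \<mu>(3) by simp
      fix r \<theta> :: real assume r: "r \<in> {0..1}"
      let ?X = "complex_of_real (P' \<theta>) + of_real (P \<theta>) * z \<theta>"
      let ?Y = "\<i> * of_real (Q' \<theta>) + \<i> * of_real (Q \<theta>) * z \<theta>"
      let ?U = "\<i> * of_real (b' \<theta> * (zigzag (real k) (real N * \<theta>) / real N))"
      let ?V = "\<i> * of_real (\<zeta> \<theta>) * z \<theta>"
      have "1 + (\<alpha>' \<theta> + \<alpha> \<theta> * z \<theta>) + r *\<^sub>R ?Y - (1 + \<i> * of_real (M * g \<theta> * Q \<theta> * y \<theta>))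
          = (?X + ?U) + (?V + r *\<^sub>R ?Y)"
        unfolding \<alpha>_def \<alpha>'_def \<zeta>'_def b_def by (simp add: algebra_simps scaleR_conv_of_real)
      also have "norm \<dots> \<le> (norm ?X + norm ?U) + (norm ?V + norm (r *\<^sub>R ?Y))"
        by (intro norm_triangle_mono norm_triangle_ineq)
      also have "\<dots> \<le> (\<mu> + 2 * B' / real N) + (2 * (B * Z) / real N + 1 * \<mu>)"
      proof (intro add_mono Pz)
        show "norm ?U \<le> 2 * B' / real N" using b's[of \<theta>] by (simp only: norm_mult norm_of_real norm_ii mult_1)
        show "norm ?V \<le> 2 * (B * Z) / real N" using \<zeta>z'[of \<theta>] by (simp add: norm_mult)
        show "norm (r *\<^sub>R ?Y) \<le> 1 * \<mu>"
          unfolding norm_scaleR using r Qz[of \<theta>] by (intro mult_mono) auto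
      qed
      also have "\<dots> \<le> 3 * \<mu>" using err by linarith
      finally show "norm (1 + (\<alpha>' \<theta> + \<alpha> \<theta> * z \<theta>) + r *\<^sub>R ?Y - (1 + \<i> * of_real (M * g \<theta> * Q \<theta> * y \<theta>))) \<le> 3 * \<mu>" .
    qed
    have "sqrt (\<phi> ((1 + 3 * \<mu>) * curve_length c + M * m) *
        ((1 + 4 * (3 * \<mu>)) * (m / M) + D * integral {0..2 * pi} (\<lambda>\<theta>. 1 - \<bar>y \<theta>\<bar>)))
      \<le> sqrt (\<Phi> * ((1 + 4 * (3 * \<mu>)) * (m / M))) + sqrt (\<Phi> * (D * integral {0..2 * pi} (\<lambda>\<theta>. 1 - \<bar>y \<theta>\<bar>)))"
    proof -
      have "0 \<le> integral {0..2 * pi} (\<lambda>\<theta>. 1 - \<bar>y \<theta>\<bar>)"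
        by (rule Henstock_Kurzweil_Integration.integral_nonneg)
           (auto simp: y_def zigzag'_bound intro!: integrable_continuous_real continuous_intros
             continuous_on_compose2[OF continuous_on_zigzag'[of UNIV]])
      then show ?thesis
        unfolding M(2) \<Phi>_def[symmetric] distrib_left using \<Phi> D(1) M(1) m(2) \<mu>(2)
        by (intro sqrt_add_le_add_sqrt mult_nonneg_nonneg) auto
    qed
    also have "sqrt (\<Phi> * ((1 + 4 * (3 * \<mu>)) * (m / M))) = m * sqrt (\<Phi> * (1 + 12 * \<mu>) / e)"
    proof -
      have "\<Phi> * ((1 + 4 * (3 * \<mu>)) * (m / M)) = m\<^sup>2 * (\<Phi> * (1 + 12 * \<mu>) / e)"
        using m(2) e by (simp add: M_def field_simps power2_eq_square)
      then show ?thesis using m(2) by (simp only: real_sqrt_mult[of "m\<^sup>2"]) simp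
    qed
    finally have 3: "connects \<phi> (m * sqrt (\<Phi> * (1 + 12 * \<mu>) / e) + \<eta> / 2)
       (\<lambda>\<theta>. c \<theta> + \<alpha> \<theta> * \<tau> \<theta>) (\<lambda>\<theta>. c \<theta> + (\<alpha> \<theta> + \<i> * of_real (Q \<theta>)) * \<tau> \<theta>)"
      using k unfolding y_def by (intro connects_mono[OF 3[unfolded y_def]]) linarith
    moreover have "(\<lambda>\<theta>. c \<theta> + (\<alpha> \<theta> + \<i> * of_real (Q \<theta>)) * \<tau> \<theta>) = (\<lambda>\<theta>. c \<theta> + (w \<theta> + \<i> * of_real (\<zeta> \<theta>)) * \<tau> \<theta>)"
      unfolding \<alpha>_def w_eq by (simp add: algebra_simps)
    ultimately have 3: "connects \<phi> (m * sqrt (\<Phi> * (1 + 12 * \<mu>) / e) + \<eta> / 2)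
       (\<lambda>\<theta>. c \<theta> + (of_real (P \<theta>) + \<i> * of_real (\<zeta> \<theta>)) * \<tau> \<theta>) (\<lambda>\<theta>. c \<theta> + (w \<theta> + \<i> * of_real (\<zeta> \<theta>)) * \<tau> \<theta>)"
      unfolding \<alpha>_def by simp
    \<comment> \<open>the errors are \<open>\<eta> / 4\<close> for each change of the zigzag and \<open>\<eta> / 2\<close> for the corners\<close>
    note connects_trans[OF connects_trans[OF connects_trans[OF 1 2] 3] connects_sym[OF 4]]
    from this[OF continuous_weight continuous_weight continuous_weight continuous_weight]
    show "connects \<phi> (\<rho> * \<mu> * sqrt (\<phi> (2 * curve_length c) * (2 * G3))
      + m * sqrt (\<phi> ((1 + 3 * \<mu>) * curve_length c + e) * (1 + 12 * \<mu>) / e) + \<eta>)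
      c (\<lambda>\<theta>. c \<theta> + w \<theta> * \<tau> \<theta>)"
      by (rule connects_mono) (use N\<eta> in \<open>simp add: \<Phi>_def\<close>)
  qed
qed

end

section \<open>The area swept out by a path\<close>

definition area_rate :: "(real \<Rightarrow> real \<Rightarrow> complex) \<Rightarrow> real \<Rightarrow> real" where
  "area_rate p t = integral {0..2 * pi} (\<lambda>\<theta>. \<bar>Im (cnj (\<theta>_deriv p t \<theta>) * time_deriv p t \<theta>)\<bar>)"

lemma area_rate_nonneg: "0 \<le> area_rate p t"
  unfolding area_rate_def by (rule integral_nonneg_real) simp

lemma continuous_on_area_density:
  assumes "smooth_path p"
  shows "continuous_on ({0..1} \<times> UNIV) (\<lambda>(t, \<theta>). \<bar>Im (cnj (\<theta>_deriv p t \<theta>) * time_deriv p t \<theta>)\<bar>)"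
  using continuous_on_\<theta>_deriv[OF assms] continuous_on_time_deriv[OF assms]
  by (auto simp: case_prod_unfold intro!: continuous_intros)

lemma continuous_on_area_rate: "smooth_path p \<Longrightarrow> continuous_on {0..1} (area_rate p)"
  unfolding area_rate_def[abs_def] by (intro continuous_on_integral_slice continuous_on_area_density)

lemma swept_area_eq:
  assumes "smooth_path p"
  shows "swept_area p = integral {0..1} (area_rate p)"
proof -
  let ?f = "\<lambda>(t, \<theta>). \<bar>Im (cnj (\<theta>_deriv p t \<theta>) * time_deriv p t \<theta>)\<bar>"
  have d: "\<bar>det (jacobian p t \<theta>)\<bar> = ?f (t, \<theta>)" for t \<theta>
    by (simp add: jacobian_def Let_def det_2 abs_minus_commute algebra_simps)
  have box: "{0..1} \<times> {0..2 * pi} = cbox (0, 0) (1::real, 2 * pi)"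
    unfolding cbox_Pair_eq by (simp add: cbox_interval)
  have "swept_area p = integral ({0..1} \<times> {0..2 * pi}) ?f"
    unfolding swept_area_def by (rule integral_cong) (auto simp: d)
  also have "\<dots> = integral (cbox (0, 0) (1, 2 * pi)) ?f" by (simp only: box)
  also have "\<dots> = integral (cbox 0 1) (\<lambda>t. integral (cbox 0 (2 * pi)) (\<lambda>\<theta>. ?f (t, \<theta>)))"
  proof (rule integral_prod_continuous)
    show "continuous_on (cbox (0, 0) (1, 2 * pi)) ?f"
      unfolding box[symmetric] by (rule continuous_on_subset[OF continuous_on_area_density[OF assms]]) auto
  qed
  also have "\<dots> = integral {0..1} (area_rate p)"
    by (simp add: area_rate_def[abs_def] cbox_interval)
  finally show ?thesis .
qed

section \<open>Length is bounded below by area\<close>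

lemma continuous_on_slice:
  assumes "continuous_on ({0..1} \<times> UNIV) (\<lambda>(t, \<theta>). F t \<theta>)" and "t \<in> {0..1}"
  shows "continuous_on S (F t)"
proof -
  have "continuous_on S (\<lambda>\<theta>. (\<lambda>(t, \<theta>). F t \<theta>) (t, \<theta>))"
    by (rule continuous_on_compose2[OF assms(1)]) (use assms(2) in \<open>auto intro!: continuous_intros\<close>)
  then show ?thesis by simp
qed

text \<open>
  Cauchy-Schwarz for the normal speed and the constant \<open>1\<close> on one curve, in the form of the
  discriminant of the quadratic polynomial \<open>E - 2 * A * x + L * x\<^sup>2\<close>.
\<close>

lemma area_rate_le_speed:
  assumes p: "smooth_path p" and t: "t \<in> {0..1}"
  shows "area_rate p t \<le> speed_G (\<lambda>l. l) p t"
proof -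
  define w where "w = \<theta>_deriv p t"
  define I where "I = (\<lambda>\<theta>. Im (cnj (w \<theta>) * time_deriv p t \<theta>))"
  define L where "L = integral {0..2 * pi} (\<lambda>\<theta>. norm (w \<theta>))"
  define A where "A = integral {0..2 * pi} (\<lambda>\<theta>. \<bar>I \<theta>\<bar>)"
  define E where "E = integral {0..2 * pi} (\<lambda>\<theta>. (I \<theta>)\<^sup>2 / norm (w \<theta>))"
  have w0: "norm (w \<theta>) > 0" for \<theta>
    using smooth_path_immersed[OF p t] by (simp add: w_def)
  note slice = continuous_on_slice[OF _ t]
  have c: "continuous_on {0..2 * pi} w" "continuous_on {0..2 * pi} I"
    unfolding I_def w_def
    by (intro continuous_intros slice[OF continuous_on_\<theta>_deriv[OF p]] slice[OF continuous_on_time_deriv[OF p]])+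
  have int: "(\<lambda>\<theta>. norm (w \<theta>)) integrable_on {0..2 * pi}" "(\<lambda>\<theta>. \<bar>I \<theta>\<bar>) integrable_on {0..2 * pi}"
      "(\<lambda>\<theta>. (I \<theta>)\<^sup>2 / norm (w \<theta>)) integrable_on {0..2 * pi}"
    by (intro integrable_continuous_real continuous_intros c; use w0 in simp)+
  have A0: "0 \<le> A" and L0: "0 \<le> L" and E0: "0 \<le> E"
    unfolding A_def L_def E_def by (intro Henstock_Kurzweil_Integration.integral_nonneg int; simp)+
  have quad: "2 * x * A \<le> E + x\<^sup>2 * L" for x
  proof -
    have "2 * x * A = integral {0..2 * pi} (\<lambda>\<theta>. 2 * x * \<bar>I \<theta>\<bar>)"
      by (simp add: A_def)
    also have "\<dots> \<le> integral {0..2 * pi} (\<lambda>\<theta>. (I \<theta>)\<^sup>2 / norm (w \<theta>) + x\<^sup>2 * norm (w \<theta>))"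
    proof (rule integral_le)
      fix \<theta>
      have "0 \<le> (\<bar>I \<theta>\<bar> - x * norm (w \<theta>))\<^sup>2 / norm (w \<theta>)" by simp
      also have "\<dots> = (I \<theta>)\<^sup>2 / norm (w \<theta>) + x\<^sup>2 * norm (w \<theta>) - 2 * x * \<bar>I \<theta>\<bar>"
        using w0[of \<theta>] by (simp add: field_simps power2_eq_square)
      finally show "2 * x * \<bar>I \<theta>\<bar> \<le> (I \<theta>)\<^sup>2 / norm (w \<theta>) + x\<^sup>2 * norm (w \<theta>)" by simp
    qed (intro integrable_on_mult_right integrable_add int)+
    also have "\<dots> = E + x\<^sup>2 * L"
      by (simp add: E_def L_def integral_add int integrable_on_mult_right)
    finally show ?thesis .
  qed
  have "A\<^sup>2 \<le> L * E"
  proof (cases "L = 0")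
    case True
    have "A = 0"
    proof (rule ccontr)
      assume "A \<noteq> 0"
      then have "A > 0" using A0 by simp
      then show False using quad[of "(E + 1) / (2 * A)"] True by simp
    qed
    then show ?thesis using L0 E0 by simp
  next
    case False
    then have "L > 0" using L0 by simp
    then show ?thesis using quad[of "A / L"] by (simp add: field_simps power2_eq_square)
  qed
  then have "A \<le> sqrt (L * E)" by (rule real_le_rsqrt)
  then show ?thesis
    by (simp add: area_rate_def speed_G_def normal_energy_def curve_length_def A_def E_def L_def I_def w_def)
qed

lemma swept_area_le_length:
  assumes p: "smooth_path p"
  shows "swept_area p \<le> length_G (\<lambda>l. l) p"
  unfolding swept_area_eq[OF p] length_G_eq[OF p]
  by (intro integral_le integrable_continuous_real continuous_on_area_rate continuous_on_speed_G p
      area_rate_le_speed continuous_intros)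

text \<open>
  The graph of \<open>x \<mapsto> exp x\<close> lies above its tangent at \<open>x = 1\<close>, which is \<open>x \<mapsto> exp 1 * x\<close>. This is
  where the constant \<open>A * exp 1\<close> comes from.
\<close>

lemma exp_weight_ge_linear:
  fixes A l :: real shows "A * exp 1 * l \<le> exp (A * l)"
proof -
  have "A * l \<le> exp (A * l - 1)" using exp_ge_add_one_self[of "A * l - 1"] by simp
  then have "exp 1 * (A * l) \<le> exp 1 * exp (A * l - 1)" by simp
  also have "\<dots> = exp (A * l)" by (simp add: exp_add[symmetric])
  finally show ?thesis by (simp add: mult_ac)
qed

lemma swept_area_le_length_exp:
  assumes p: "smooth_path p" and A: "A > 0"
  shows "sqrt (A * exp 1) * swept_area p \<le> length_G (\<lambda>l. exp (A * l)) p"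
proof -
  have "sqrt (A * exp 1) * swept_area p \<le> sqrt (A * exp 1) * length_G (\<lambda>l. l) p"
    using A by (intro mult_left_mono swept_area_le_length p) auto
  also have "\<dots> = integral {0..1} (\<lambda>t. sqrt (A * exp 1) * speed_G (\<lambda>l. l) p t)"
    by (simp add: length_G_eq[OF p])
  also have "\<dots> \<le> integral {0..1} (speed_G (\<lambda>l. exp (A * l)) p)"
  proof (intro integral_le integrable_continuous_real continuous_on_speed_G p continuous_intros)
    fix t :: real
    show "sqrt (A * exp 1) * speed_G (\<lambda>l. l) p t \<le> speed_G (\<lambda>l. exp (A * l)) p t"
      unfolding speed_G_def real_sqrt_mult[symmetric] mult.assoc[symmetric]
      by (intro real_sqrt_le_mono mult_right_mono exp_weight_ge_linear normal_energy_nonneg)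
  qed
  finally show ?thesis by (simp add: length_G_eq[OF p])
qed

section \<open>Length can be brought down to area\<close>

lemma (in weighted_curve) connects_refl: "connects \<phi> 0 c c"
  using connects_tangential[of "\<lambda>_. 0" "\<lambda>_. 0" 0 0] by (simp add: Ck_on_const)

context length_weight
begin

text \<open>
  Infinitesimal form of the upper bound, with the base curve \<open>p t0\<close> fixed. The displacement
  \<open>h = p t - p t0\<close> is small in \<open>C\<^sup>1\<close>, and it is \<open>(t - t0) * u\<close> up to an error that is small compared
  with \<open>t - t0\<close>. Hence the area it sweeps is close to \<open>\<bar>t - t0\<bar>\<close> times the area rate at \<open>t0\<close>.
\<close>

lemma connects_nearby:
  assumes p: "smooth_path p" and t0: "t0 \<in> {0..1}" and e: "e > 0" and \<eta>: "\<eta> > 0"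
  shows "\<exists>d>0. \<forall>t\<in>{0..1}. \<bar>t - t0\<bar> < d \<longrightarrow> connects \<phi>
    (\<bar>t - t0\<bar> * (sqrt (\<phi> (curve_length (p t0) + e) / e) * area_rate p t0 + \<eta>)) (p t0) (p t)"
proof -
  have pI: "p t \<in> Imm" if "t \<in> {0..1}" for t using p that by (simp add: smooth_path_def)
  interpret weighted_curve \<phi> "p t0"
    by unfold_locales (rule pI[OF t0])
  have \<tau>: "\<tau> \<theta> = \<theta>_deriv p t0 \<theta>" for \<theta> by (simp add: \<tau>_def)
  define l where "l = curve_length (p t0)"
  define f where "f = area_rate p t0"
  define u where "u = time_deriv p t0"
  have l: "0 \<le> l" unfolding l_def by (rule curve_length_nonneg)
  have f: "0 \<le> f" unfolding f_def by (rule area_rate_nonneg)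
  note slice = continuous_on_slice[OF _ t0]
  have u_cont: "continuous_on {0..2 * pi} u"
    unfolding u_def by (rule slice[OF continuous_on_time_deriv[OF p]])
  obtain U where U: "U > 0" "\<And>\<theta>. \<theta> \<in> {0..2 * pi} \<Longrightarrow> norm (u \<theta>) \<le> U"
    using compact_imp_bounded[OF compact_continuous_image[OF u_cont compact_Icc]] by (auto simp: bounded_pos)
  obtain Z where Z: "Z > 0" "\<And>\<theta>. norm (z \<theta>) \<le> Z" using z_bounded by blast
  obtain K where K: "K > 0" "\<And>\<theta>. norm (inverse (\<tau> \<theta>)) \<le> K"
  proof -
    have "continuous_on UNIV (\<lambda>\<theta>. inverse (\<tau> \<theta>))"
      using Ck_on_continuous[OF \<tau>_smooth] \<tau>_nonzero by (intro continuous_intros) auto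
    from periodic_bounded[OF _ this] show ?thesis using that by (auto simp: \<tau>_periodic)
  qed
  \<comment> \<open>\<open>\<Psi> \<mu>\<close> is the cost per unit of time; it is continuous at \<open>\<mu> = 0\<close>, and \<open>\<mu>\<close> is chosen close to \<open>0\<close>\<close>
  define k1 where "k1 = K * (U + 1) * sqrt (\<phi> (2 * l) * (2 * G3))"
  define \<Psi> where "\<Psi> = (\<lambda>\<mu>. k1 * \<mu> + (f + \<mu> * (l + 1)) * sqrt (\<phi> ((1 + 3 * \<mu>) * l + e) * (1 + 12 * \<mu>) / e))"
  have "continuous_on UNIV \<Psi>"
    unfolding \<Psi>_def using e
    by (intro continuous_intros continuous_on_compose2[OF continuous_weight]) auto
  then have "(\<Psi> \<longlongrightarrow> \<Psi> 0) (at_right 0)"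
    by (auto simp: continuous_on_def intro: tendsto_within_subset)
  moreover have "\<Psi> 0 < sqrt (\<phi> (l + e) / e) * f + \<eta>"
    using \<eta> by (simp add: \<Psi>_def mult.commute)
  ultimately have "eventually (\<lambda>\<mu>. \<Psi> \<mu> < sqrt (\<phi> (l + e) / e) * f + \<eta>) (at_right 0)"
    by (rule order_tendstoD(2))
  moreover have "eventually (\<lambda>\<mu>. 0 < \<mu> \<and> \<mu> < 1/12) (at_right (0::real))"
    by (auto simp: eventually_at_right_field intro!: exI[of _ "1/12"])
  ultimately have "eventually (\<lambda>\<mu>. \<Psi> \<mu> < sqrt (\<phi> (l + e) / e) * f + \<eta> \<and> 0 < \<mu> \<and> \<mu> < 1/12) (at_right 0)"
    by (rule eventually_conj)
  then obtain \<mu> where \<mu>: "\<Psi> \<mu> < sqrt (\<phi> (l + e) / e) * f + \<eta>" "0 < \<mu>" "\<mu> < 1/12"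
    using eventually_happens trivial_limit_at_right_real by blast
  define \<nu> where "\<nu> = min 1 (min \<mu> (\<mu> / (K * (1 + 2 * Z))))"
  have \<nu>: "0 < \<nu>" "\<nu> \<le> 1" "\<nu> \<le> \<mu>" "K * \<nu> * (1 + 2 * Z) \<le> \<mu>"
  proof -
    have KZ: "0 < K * (1 + 2 * Z)" using K(1) Z(1) by simp
    have "\<nu> \<le> \<mu> / (K * (1 + 2 * Z))" by (simp add: \<nu>_def)
    then show "K * \<nu> * (1 + 2 * Z) \<le> \<mu>" using KZ by (simp add: pos_le_divide_eq mult_ac)
    show "0 < \<nu>" using \<mu>(2) KZ by (simp add: \<nu>_def)
  qed (auto simp: \<nu>_def)
  have comp: "compact ({0..1} \<times> {0..2 * pi} :: (real \<times> real) set)" by (intro compact_Times compact_Icc)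
  have uc: "\<exists>d>0. \<forall>t\<in>{0..1}. \<forall>\<theta>\<in>{0..2 * pi}. \<bar>t - t0\<bar> < d \<longrightarrow> norm (F t \<theta> - F t0 \<theta>) < \<nu>"
    if "continuous_on ({0..1} \<times> UNIV) (\<lambda>(t, \<theta>). F t \<theta>)" for F :: "real \<Rightarrow> real \<Rightarrow> complex"
  proof -
    have "uniformly_continuous_on ({0..1} \<times> {0..2 * pi}) (\<lambda>(t, \<theta>). F t \<theta>)"
      by (rule compact_uniformly_continuous[OF continuous_on_subset[OF that] comp]) auto
    then obtain d where d: "d > 0" "\<And>x x'. x \<in> {0..1} \<times> {0..2 * pi} \<Longrightarrow> x' \<in> {0..1} \<times> {0..2 * pi} \<Longrightarrow>
        dist x' x < d \<Longrightarrow> dist (case x' of (t, \<theta>) \<Rightarrow> F t \<theta>) (case x of (t, \<theta>) \<Rightarrow> F t \<theta>) < \<nu>"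
      using \<nu>(1) unfolding uniformly_continuous_on_def by metis
    have "norm (F t \<theta> - F t0 \<theta>) < \<nu>" if "t \<in> {0..1}" "\<theta> \<in> {0..2 * pi}" "\<bar>t - t0\<bar> < d" for t \<theta>
      using d(2)[of "(t0, \<theta>)" "(t, \<theta>)"] that t0 by (simp add: dist_Pair_Pair dist_norm)
    then show ?thesis using d(1) by blast
  qed
  obtain d1 where d1: "d1 > 0" "\<And>t \<theta>. t \<in> {0..1} \<Longrightarrow> \<theta> \<in> {0..2 * pi} \<Longrightarrow> \<bar>t - t0\<bar> < d1 \<Longrightarrow>
      norm (\<theta>_deriv p t \<theta> - \<theta>_deriv p t0 \<theta>) < \<nu>"
    using uc[OF continuous_on_\<theta>_deriv[OF p]] by metis
  obtain d2 where d2: "d2 > 0" "\<And>t \<theta>. t \<in> {0..1} \<Longrightarrow> \<theta> \<in> {0..2 * pi} \<Longrightarrow> \<bar>t - t0\<bar> < d2 \<Longrightarrow>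
      norm (time_deriv p t \<theta> - u \<theta>) < \<nu>"
    using uc[OF continuous_on_time_deriv[OF p]] unfolding u_def by metis
  define d where "d = min d1 (min d2 (\<nu> / (U + 1)))"
  have "d > 0" using d1 d2 \<nu> U by (simp add: d_def)
  moreover have "connects \<phi> (\<bar>t - t0\<bar> * (sqrt (\<phi> (l + e) / e) * f + \<eta>)) (p t0) (p t)"
    if t: "t \<in> {0..1}" and td: "\<bar>t - t0\<bar> < d" for t
  proof (cases "t = t0")
    case True
    then show ?thesis using connects_refl by simp
  next
    case False
    define h where "h = (\<lambda>\<theta>. p t \<theta> - p t0 \<theta>)"
    define h' where "h' = (\<lambda>\<theta>. \<theta>_deriv p t \<theta> - \<theta>_deriv p t0 \<theta>)"
    have h: "Ck_on n h UNIV" "h (\<theta> + 2 * pi) = h \<theta>" "(h has_vector_derivative h' \<theta>) (at \<theta>)" for n \<theta>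
      unfolding h_def h'_def using pI[OF t] pI[OF t0]
      by (auto simp: Imm_iff intro!: Ck_on_diff has_vector_derivative_diff has_\<theta>_deriv[OF p] t t0)
    have h1: "norm (h \<theta> - (t - t0) *\<^sub>R u \<theta>) \<le> \<nu> * \<bar>t - t0\<bar>" if \<theta>: "\<theta> \<in> {0..2 * pi}" for \<theta>
    proof -
      let ?S = "closed_segment t0 t"
      have S: "s \<in> {0..1}" "\<bar>s - t0\<bar> < d2" if "s \<in> ?S" for s
        using that t t0 td by (auto simp: closed_segment_eq_real_ivl d_def split: if_splits)
      have "norm ((p t \<theta> - t *\<^sub>R u \<theta>) - (p t0 \<theta> - t0 *\<^sub>R u \<theta>)) \<le> \<nu> * norm (t - t0)"
      proof (rule differentiable_bound[where S = ?S and f' = "\<lambda>s x. x *\<^sub>R (time_deriv p s \<theta> - u \<theta>)"])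
        fix s assume s: "s \<in> ?S"
        have "((\<lambda>s. p s \<theta> - s *\<^sub>R u \<theta>) has_vector_derivative time_deriv p s \<theta> - u \<theta>) (at s within {0..1})"
          by (intro has_vector_derivative_diff has_time_deriv[OF p S(1)[OF s]])
             (auto intro!: derivative_eq_intros)
        then have "((\<lambda>s. p s \<theta> - s *\<^sub>R u \<theta>) has_vector_derivative time_deriv p s \<theta> - u \<theta>) (at s within ?S)"
          by (rule has_vector_derivative_within_subset) (use S(1) in blast)
        then show "((\<lambda>s. p s \<theta> - s *\<^sub>R u \<theta>) has_derivative (\<lambda>x. x *\<^sub>R (time_deriv p s \<theta> - u \<theta>))) (at s within ?S)"
          by (simp add: has_vector_derivative_def)
        show "onorm (\<lambda>x. x *\<^sub>R (time_deriv p s \<theta> - u \<theta>)) \<le> \<nu>"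
          using d2(2)[OF S(1)[OF s] \<theta> S(2)[OF s]]
          by (intro onorm_bound) (auto simp: mult.commute[of \<nu>] intro!: mult_left_mono \<nu>(1)[THEN less_imp_le])
      qed auto
      then show ?thesis by (simp add: h_def algebra_simps)
    qed
    have h2: "norm (h \<theta>) \<le> (U + 1) * \<bar>t - t0\<bar>" for \<theta>
    proof -
      obtain \<theta>' where \<theta>': "\<theta>' \<in> {0..2 * pi}" "h \<theta>' = h \<theta>"
        using periodic_ex[of h, OF h(2)] by blast
      have "norm (h \<theta>') \<le> \<nu> * \<bar>t - t0\<bar> + \<bar>t - t0\<bar> * norm (u \<theta>')"
        using h1[OF \<theta>'(1)] norm_triangle_ineq[of "h \<theta>' - (t - t0) *\<^sub>R u \<theta>'" "(t - t0) *\<^sub>R u \<theta>'"] by simp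
      also have "\<dots> \<le> 1 * \<bar>t - t0\<bar> + \<bar>t - t0\<bar> * U"
        using \<nu> U(2)[OF \<theta>'(1)] by (intro add_mono mult_right_mono mult_left_mono) auto
      finally show ?thesis using \<theta>'(2) by (simp add: algebra_simps)
    qed
    have h3: "norm (h \<theta>) \<le> \<nu>" for \<theta>
    proof -
      have "(U + 1) * \<bar>t - t0\<bar> \<le> (U + 1) * (\<nu> / (U + 1))"
        using td U(1) by (intro mult_left_mono) (auto simp: d_def)
      then show ?thesis using h2[of \<theta>] U(1) by simp
    qed
    have h4: "norm (h' \<theta>) \<le> \<nu>" for \<theta>
    proof -
      obtain \<theta>' where \<theta>': "\<theta>' \<in> {0..2 * pi}" "h' \<theta>' = h' \<theta>"
        using periodic_ex[of h', OF periodic_vector_derivative[OF h(2,3)]] by blast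
      have "norm (h' \<theta>') < \<nu>"
        unfolding h'_def by (rule d1(2)[OF t \<theta>'(1)]) (use td in \<open>simp add: d_def\<close>)
      then show ?thesis using \<theta>'(2) by simp
    qed
    define w where "w = (\<lambda>\<theta>. h \<theta> * inverse (\<tau> \<theta>))"
    define w' where "w' = (\<lambda>\<theta>. (h' \<theta> - h \<theta> * z \<theta>) * inverse (\<tau> \<theta>))"
    have inv: "((\<lambda>\<theta>. inverse (\<tau> \<theta>)) has_vector_derivative - (z \<theta> * inverse (\<tau> \<theta>))) (at \<theta>)" for \<theta>
    proof -
      have "((\<lambda>\<theta>. inverse (\<tau> \<theta>)) has_derivative (\<lambda>x. - (inverse (\<tau> \<theta>) * (x *\<^sub>R (z \<theta> * \<tau> \<theta>)) * inverse (\<tau> \<theta>)))) (at \<theta>)"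
        by (rule Deriv.has_derivative_inverse[OF \<tau>_nonzero \<tau>_deriv[unfolded has_vector_derivative_def]])
      then show ?thesis
        unfolding has_vector_derivative_def by (rule has_derivative_eq_rhs) (auto simp: fun_eq_iff \<tau>_nonzero)
    qed
    have w: "Ck_on n w UNIV" "w (\<theta> + 2 * pi) = w \<theta>" "(w has_vector_derivative w' \<theta>) (at \<theta>)" for n \<theta>
    proof -
      show "Ck_on n w UNIV" unfolding w_def by (intro Ck_on_mult Ck_on_inverse \<tau>_smooth \<tau>_nonzero h(1) open_UNIV)
      show "w (\<theta> + 2 * pi) = w \<theta>" by (simp add: w_def h(2) \<tau>_periodic)
      show "(w has_vector_derivative w' \<theta>) (at \<theta>)"
        unfolding w_def w'_def
        by (rule has_vector_derivative_eq_rhs[OF has_vector_derivative_mult[OF h(3) inv]]) (simp add: algebra_simps)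
    qed
    have bnd: "norm (x * inverse (\<tau> \<theta>)) \<le> K * norm x" for x \<theta>
      unfolding norm_mult using K(2)[of \<theta>] by (subst mult.commute) (rule mult_right_mono, auto)
    have w\<rho>: "norm (w \<theta>) \<le> K * ((U + 1) * \<bar>t - t0\<bar>)" for \<theta>
      unfolding w_def using bnd[of "h \<theta>" \<theta>] mult_left_mono[OF h2[of \<theta>], of K] K(1) by linarith
    have w\<mu>: "norm (w' \<theta>) + norm (w \<theta>) * norm (z \<theta>) \<le> \<mu>" for \<theta>
    proof -
      have "norm (h \<theta>) * norm (z \<theta>) \<le> \<nu> * Z" using h3[of \<theta>] Z(2)[of \<theta>] \<nu>(1) by (intro mult_mono) auto
      then have "norm (h' \<theta> - h \<theta> * z \<theta>) \<le> \<nu> + \<nu> * Z"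
        using h4[of \<theta>] norm_triangle_ineq4[of "h' \<theta>" "h \<theta> * z \<theta>"] by (simp add: norm_mult)
      then have "K * norm (h' \<theta> - h \<theta> * z \<theta>) \<le> K * (\<nu> + \<nu> * Z)" using K(1) by simp
      then have 1: "norm (w' \<theta>) \<le> K * (\<nu> + \<nu> * Z)"
        using bnd[of "h' \<theta> - h \<theta> * z \<theta>" \<theta>] unfolding w'_def by linarith
      have "norm (w \<theta>) \<le> K * \<nu>"
        using bnd[of "h \<theta>" \<theta>] mult_left_mono[OF h3[of \<theta>], of K] K(1) unfolding w_def by linarith
      then have "norm (w \<theta>) * norm (z \<theta>) \<le> K * \<nu> * Z"
        using Z(2)[of \<theta>] K(1) \<nu>(1) by (intro mult_mono) auto
      with 1 have "norm (w' \<theta>) + norm (w \<theta>) * norm (z \<theta>) \<le> K * \<nu> * (1 + 2 * Z)"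
        by (simp add: algebra_simps)
      then show ?thesis using \<nu>(4) by linarith
    qed
    \<comment> \<open>the summand \<open>\<mu> * (l + 1)\<close> absorbs the linearization error and keeps \<open>m\<close> positive where no area is swept\<close>
    define m where "m = \<bar>t - t0\<bar> * (f + \<mu> * (l + 1))"
    have m0: "0 < m"
      unfolding m_def using False f l \<mu>(2) by (intro mult_pos_pos add_nonneg_pos) auto
    have g2: "(g \<theta>)\<^sup>2 * \<bar>Im (w \<theta>)\<bar> = \<bar>Im (cnj (\<tau> \<theta>) * h \<theta>)\<bar>" for \<theta>
    proof -
      have "cnj (\<tau> \<theta>) * h \<theta> = (\<tau> \<theta> * cnj (\<tau> \<theta>)) * w \<theta>" by (simp add: w_def \<tau>_nonzero)
      also have "\<dots> = of_real ((g \<theta>)\<^sup>2) * w \<theta>" unfolding g_def by (simp only: complex_norm_square)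
      finally have "Im (cnj (\<tau> \<theta>) * h \<theta>) = (g \<theta>)\<^sup>2 * Im (w \<theta>)"
        by (simp only: Im_complex_of_real Re_complex_of_real times_complex.sel)
      then show ?thesis by (simp add: abs_mult)
    qed
    have m1: "integral {0..2 * pi} (\<lambda>\<theta>. (g \<theta>)\<^sup>2 * \<bar>Im (w \<theta>)\<bar>) \<le> m"
    proof -
      have \<tau>c: "continuous_on {0..2 * pi} \<tau>" and hc: "continuous_on {0..2 * pi} h"
        using Ck_on_continuous[OF \<tau>_smooth] Ck_on_continuous[OF h(1)] continuous_on_subset by blast+
      have "integral {0..2 * pi} (\<lambda>\<theta>. \<bar>Im (cnj (\<tau> \<theta>) * h \<theta>)\<bar>)
          \<le> integral {0..2 * pi} (\<lambda>\<theta>. \<bar>t - t0\<bar> * \<bar>Im (cnj (\<tau> \<theta>) * u \<theta>)\<bar> + \<nu> * \<bar>t - t0\<bar> * g \<theta>)"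
      proof (rule integral_le)
        fix \<theta> assume \<theta>: "\<theta> \<in> {0..2 * pi}"
        have "cnj (\<tau> \<theta>) * h \<theta> = (t - t0) *\<^sub>R (cnj (\<tau> \<theta>) * u \<theta>) + cnj (\<tau> \<theta>) * (h \<theta> - (t - t0) *\<^sub>R u \<theta>)"
          by (simp add: algebra_simps)
        then have "\<bar>Im (cnj (\<tau> \<theta>) * h \<theta>)\<bar> \<le> \<bar>Im ((t - t0) *\<^sub>R (cnj (\<tau> \<theta>) * u \<theta>))\<bar>
            + \<bar>Im (cnj (\<tau> \<theta>) * (h \<theta> - (t - t0) *\<^sub>R u \<theta>))\<bar>"
          using abs_triangle_ineq by (simp only: plus_complex.sel)
        also have "\<bar>Im ((t - t0) *\<^sub>R (cnj (\<tau> \<theta>) * u \<theta>))\<bar> = \<bar>t - t0\<bar> * \<bar>Im (cnj (\<tau> \<theta>) * u \<theta>)\<bar>"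
          by (simp only: scaleR_complex.sel abs_mult)
        also have "\<bar>Im (cnj (\<tau> \<theta>) * (h \<theta> - (t - t0) *\<^sub>R u \<theta>))\<bar> \<le> g \<theta> * (\<nu> * \<bar>t - t0\<bar>)"
          using h1[OF \<theta>] g_pos[of \<theta>]
          by (intro order_trans[OF abs_Im_le_cmod]) (simp only: norm_mult complex_mod_cnj g_def, simp)
        finally show "\<bar>Im (cnj (\<tau> \<theta>) * h \<theta>)\<bar> \<le> \<bar>t - t0\<bar> * \<bar>Im (cnj (\<tau> \<theta>) * u \<theta>)\<bar> + \<nu> * \<bar>t - t0\<bar> * g \<theta>"
          by (simp add: mult_ac)
      qed (intro integrable_continuous_real continuous_intros \<tau>c hc u_cont g_cont)+
      also have "\<dots> = \<bar>t - t0\<bar> * f + \<nu> * \<bar>t - t0\<bar> * l"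
      proof -
        have "(\<lambda>\<theta>. \<bar>Im (cnj (\<tau> \<theta>) * u \<theta>)\<bar>) integrable_on {0..2 * pi}" "g integrable_on {0..2 * pi}"
          by (intro integrable_continuous_real continuous_intros \<tau>c u_cont g_cont)+
        moreover have "f = integral {0..2 * pi} (\<lambda>\<theta>. \<bar>Im (cnj (\<tau> \<theta>) * u \<theta>)\<bar>)"
          by (simp add: f_def area_rate_def u_def \<tau>)
        ultimately show ?thesis
          by (simp only: integral_add integrable_on_mult_right integral_mult_right l_def curve_length_eq)
      qed
      also have "\<dots> = \<bar>t - t0\<bar> * (f + \<nu> * l)" by (simp add: algebra_simps)
      also have "\<dots> \<le> m"
        unfolding m_def using \<nu>(1,3) l by (intro mult_left_mono add_left_mono mult_mono) auto
      finally show ?thesis by (simp only: g2)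
    qed
    have "connects \<phi> (K * ((U + 1) * \<bar>t - t0\<bar>) * \<mu> * sqrt (\<phi> (2 * curve_length (p t0)) * (2 * G3))
        + m * sqrt (\<phi> ((1 + 3 * \<mu>) * curve_length (p t0) + e) * (1 + 12 * \<mu>) / e))
      (p t0) (\<lambda>\<theta>. p t0 \<theta> + w \<theta> * \<tau> \<theta>)"
      using \<mu>(3) by (intro connects_displacement[OF w w\<rho> w\<mu> \<mu>(2) _ m1 m0 e]) simp
    moreover have "(\<lambda>\<theta>. p t0 \<theta> + w \<theta> * \<tau> \<theta>) = p t"
      by (simp add: fun_eq_iff w_def h_def mult.assoc \<tau>_nonzero)
    moreover have "K * ((U + 1) * \<bar>t - t0\<bar>) * \<mu> * sqrt (\<phi> (2 * curve_length (p t0)) * (2 * G3))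
        + m * sqrt (\<phi> ((1 + 3 * \<mu>) * curve_length (p t0) + e) * (1 + 12 * \<mu>) / e) = \<bar>t - t0\<bar> * \<Psi> \<mu>"
    proof -
      have "K * ((U + 1) * a) * \<mu> * X + a * q * Y = a * (K * (U + 1) * X * \<mu> + q * Y)" for a X q Y :: real
        by (simp add: algebra_simps)
      then show ?thesis unfolding m_def \<Psi>_def k1_def l_def .
    qed
    moreover have "\<bar>t - t0\<bar> * \<Psi> \<mu> \<le> \<bar>t - t0\<bar> * (sqrt (\<phi> (l + e) / e) * f + \<eta>)"
      using \<mu>(1) by (intro mult_left_mono) auto
    ultimately show ?thesis using connects_mono by metis
  qed
  ultimately show ?thesis unfolding l_def f_def by blast
qed

lemma curve_length_le_max_length:
  assumes "smooth_path p" "t \<in> {0..1}" shows "curve_length (p t) \<le> max_length p"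
  unfolding max_length_def
  by (rule cSUP_upper[OF assms(2)])
     (intro bounded_imp_bdd_above compact_imp_bounded compact_continuous_image continuous_on_curve_length assms(1) compact_Icc)

text \<open>
  The infinitesimal estimates hold near each time with a neighbourhood that depends on it; bisection
  (\<open>Bolzano\<close>) joins them to the whole interval, since the bound is additive in the interval.
\<close>

lemma connects_swept_area:
  assumes p: "smooth_path p" and e: "e > 0"
  shows "connects \<phi> (sqrt (\<phi> (max_length p + e) / e) * swept_area p) (p 0) (p 1)"
proof (rule connects_limit)
  fix \<eta> :: real assume \<eta>: "\<eta> > 0"
  define K where "K = sqrt (\<phi> (max_length p + e) / e)"
  have Kt: "sqrt (\<phi> (curve_length (p t) + e) / e) \<le> K" if "t \<in> {0..1}" for t
    unfolding K_def using curve_length_le_max_length[OF p that] curve_length_nonneg[of "p t"] e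
    by (intro real_sqrt_le_mono divide_right_mono weight_mono) auto
  have K0: "0 \<le> K"
    using Kt[of 0] weight_nonneg[of "curve_length (p 0) + e"] curve_length_nonneg[of "p 0"] e
    by (auto intro: order_trans[rotated])
  let ?f = "area_rate p"
  have fc: "continuous_on {0..1} ?f" by (rule continuous_on_area_rate[OF p])
  have fint: "?f integrable_on {a..b}" if "0 \<le> a" "b \<le> 1" for a b
    by (intro integrable_continuous_real continuous_on_subset[OF fc]) (use that in auto)
  define P where "P = (\<lambda>a b. 0 \<le> a \<longrightarrow> a \<le> b \<longrightarrow> b \<le> 1 \<longrightarrow>
    connects \<phi> (K * integral {a..b} ?f + \<eta> * (b - a)) (p a) (p b))"
  have "P 0 1"
  proof (rule Bolzano)
    show "P a c" if "P a b" "P b c" "a \<le> b" "b \<le> c" for a b c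
      unfolding P_def
    proof (intro impI)
      assume ac: "0 \<le> a" "c \<le> 1"
      have "connects \<phi> ((K * integral {a..b} ?f + \<eta> * (b - a)) + (K * integral {b..c} ?f + \<eta> * (c - b))) (p a) (p c)"
        by (rule connects_trans[OF _ _ continuous_weight, of _ _ "p b"]) (use that ac in \<open>auto simp: P_def\<close>)
      moreover have i: "integral {a..b} ?f + integral {b..c} ?f = integral {a..c} ?f"
        using that ac by (intro Henstock_Kurzweil_Integration.integral_combine fint) auto
      have "(K * integral {a..b} ?f + \<eta> * (b - a)) + (K * integral {b..c} ?f + \<eta> * (c - b))
          = K * integral {a..c} ?f + \<eta> * (c - a)"
        unfolding i[symmetric] by (simp add: algebra_simps)
      ultimately show "connects \<phi> (K * integral {a..c} ?f + \<eta> * (c - a)) (p a) (p c)" by simp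
    qed
  next
    fix x :: real assume x: "0 \<le> x" "x \<le> 1"
    then have xi: "x \<in> {0..1}" by simp
    obtain d1 where d1: "d1 > 0" "\<And>t. t \<in> {0..1} \<Longrightarrow> \<bar>t - x\<bar> < d1 \<Longrightarrow> connects \<phi>
        (\<bar>t - x\<bar> * (sqrt (\<phi> (curve_length (p x) + e) / e) * ?f x + \<eta> / 2)) (p x) (p t)"
      using connects_nearby[OF p xi e, of "\<eta> / 2"] \<eta> by (metis half_gt_zero)
    define \<delta> where "\<delta> = \<eta> / (2 * (K + 1))"
    have \<delta>: "\<delta> > 0" "K * \<delta> \<le> \<eta> / 2"
      using K0 \<eta> by (simp_all add: \<delta>_def field_simps)
    obtain d2 where d2: "d2 > 0" "\<And>t. t \<in> {0..1} \<Longrightarrow> \<bar>t - x\<bar> < d2 \<Longrightarrow> \<bar>?f t - ?f x\<bar> < \<delta>"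
      using fc xi \<delta>(1) unfolding continuous_on_iff dist_real_def by metis
    have "P a b" if ab: "a \<le> x" "x \<le> b" "b - a < min d1 d2" for a b
      unfolding P_def
    proof (intro impI)
      assume a: "0 \<le> a" and b: "b \<le> 1"
      let ?L = "K * ?f x + \<eta> / 2"
      have near: "connects \<phi> (\<bar>t - x\<bar> * ?L) (p x) (p t)" if t: "t \<in> {0..1}" "\<bar>t - x\<bar> < d1" for t
      proof (rule connects_mono[OF d1(2)[OF t]])
        show "\<bar>t - x\<bar> * (sqrt (\<phi> (curve_length (p x) + e) / e) * ?f x + \<eta> / 2) \<le> \<bar>t - x\<bar> * ?L"
          using Kt[OF xi] area_rate_nonneg[of p x] by (intro mult_left_mono add_right_mono mult_right_mono) auto
      qed
      have "connects \<phi> (\<bar>a - x\<bar> * ?L + \<bar>b - x\<bar> * ?L) (p a) (p b)"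
        using ab a b x
        by (intro connects_trans[OF connects_sym[OF near continuous_weight] near continuous_weight]) auto
      moreover have "\<bar>a - x\<bar> * y + \<bar>b - x\<bar> * y = (b - a) * y" for y
        using ab by (simp add: algebra_simps)
      moreover have "(b - a) * ?L \<le> K * integral {a..b} ?f + \<eta> * (b - a)"
      proof -
        have "integral {a..b} (\<lambda>_. ?f x - \<delta>) \<le> integral {a..b} ?f"
        proof (rule integral_le)
          show "?f x - \<delta> \<le> ?f s" if "s \<in> {a..b}" for s
            using d2(2)[of s] that ab a b by (auto simp: abs_less_iff)
        qed (use a b fint in auto)
        then have "(b - a) * (?f x - \<delta>) \<le> integral {a..b} ?f" using ab by simp
        then have "K * ((b - a) * (?f x - \<delta>)) \<le> K * integral {a..b} ?f" using K0 by (rule mult_left_mono)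
        moreover have "(b - a) * (K * \<delta>) \<le> (b - a) * (\<eta> / 2)" using \<delta>(2) ab by (intro mult_left_mono) auto
        moreover have "(b - a) * ?L = K * ((b - a) * (?f x - \<delta>)) + (b - a) * (K * \<delta>) + (b - a) * (\<eta> / 2)"
          by (simp add: algebra_simps)
        moreover have "\<eta> * (b - a) = (b - a) * (\<eta> / 2) + (b - a) * (\<eta> / 2)"
          by (simp add: field_simps)
        ultimately show ?thesis by linarith
      qed
      ultimately show "connects \<phi> (K * integral {a..b} ?f + \<eta> * (b - a)) (p a) (p b)"
        using connects_mono by metis
    qed
    then show "\<exists>d>0. \<forall>a b. a \<le> x \<and> x \<le> b \<and> b - a < d \<longrightarrow> P a b"
      using d1(1) d2(1) by (intro exI[of _ "min d1 d2"]) auto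
  qed simp
  then show "connects \<phi> (sqrt (\<phi> (max_length p + e) / e) * swept_area p + \<eta>) (p 0) (p 1)"
    by (simp add: P_def K_def swept_area_eq[OF p])
qed

text \<open>
  One estimate for both upper bounds: \<open>e\<close> is the length that the wiggles add to the curves, and it can
  be chosen freely. The best choice depends on the weight.
\<close>

lemma dist_G_le:
  assumes p: "p \<in> imm_paths C E" and e: "e > 0"
  shows "dist_G \<phi> C E \<le> ereal (sqrt (\<phi> (max_length p + e) / e) * swept_area p)"
proof (rule ereal_le_epsilon2)
  have sm: "smooth_path p" and CE: "B_i_proj (p 0) = C" "B_i_proj (p 1) = E"
    using p by (auto simp: imm_paths_iff)
  fix \<eta> :: real assume "0 < \<eta>"
  then obtain q where q: "smooth_path q" "q 0 = p 0" "q 1 = p 1"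
      "length_G \<phi> q \<le> sqrt (\<phi> (max_length p + e) / e) * swept_area p + \<eta>"
    using connects_swept_area[OF sm e] unfolding connects_def by blast
  then have "q \<in> imm_paths C E" using CE by (simp add: imm_paths_iff)
  then have "dist_G \<phi> C E \<le> ereal (length_G \<phi> q)"
    unfolding dist_G_def by (rule INF_lower)
  also have "\<dots> \<le> ereal (sqrt (\<phi> (max_length p + e) / e) * swept_area p) + ereal \<eta>"
    using q(4) by simp
  finally show "dist_G \<phi> C E \<le> ereal (sqrt (\<phi> (max_length p + e) / e) * swept_area p) + ereal \<eta>" .
qed

end

theorem theorem1:
  fixes C E :: "(real \<Rightarrow> complex) set"
  assumes "C \<in> B_i" and "E \<in> B_i"
  shows "dist_G (\<lambda>l. l) C E = (INF c\<in>imm_paths C E. ereal (swept_area c)) \<and>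
    (\<forall>A::real. A > 0 \<longrightarrow>
      (INF c\<in>imm_paths C E. ereal (sqrt (A * exp 1) * swept_area c))
        \<le> dist_G (\<lambda>l. exp (A * l)) C E \<and>
      dist_G (\<lambda>l. exp (A * l)) C E
        \<le> (INF c\<in>imm_paths C E.
             ereal (sqrt (A * exp 1) * exp (A * max_length c / 2) * swept_area c)))"
proof (intro conjI allI impI)
  interpret linear: length_weight "\<lambda>l. l"
    by unfold_locales (auto simp: mono_on_def)
  show "dist_G (\<lambda>l. l) C E = (INF c\<in>imm_paths C E. ereal (swept_area c))"
  proof (rule antisym)
    show "dist_G (\<lambda>l. l) C E \<le> (INF c\<in>imm_paths C E. ereal (swept_area c))"
    proof (rule INF_greatest)
      fix p assume p: "p \<in> imm_paths C E"
      \<comment> \<open>for the weight \<open>l\<close> longer wiggles are always better\<close>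
      have "((\<lambda>e. sqrt ((max_length p + e) / e) * swept_area p) \<longlongrightarrow> sqrt 1 * swept_area p) at_top"
      proof (intro tendsto_intros)
        have "((\<lambda>e. (a + e) / e) \<longlongrightarrow> 1) at_top" for a :: real by real_asymp
        then show "((\<lambda>e. (max_length p + e) / e) \<longlongrightarrow> 1) at_top" .
      qed
      then have "((\<lambda>e. ereal (sqrt ((max_length p + e) / e) * swept_area p)) \<longlongrightarrow> ereal (swept_area p)) at_top"
        by simp
      then show "dist_G (\<lambda>l. l) C E \<le> ereal (swept_area p)"
      proof (rule tendsto_lowerbound)
        show "eventually (\<lambda>e. dist_G (\<lambda>l. l) C E \<le> ereal (sqrt ((max_length p + e) / e) * swept_area p)) at_top"
          using eventually_gt_at_top[of 0] by eventually_elim (rule linear.dist_G_le[OF p])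
      qed simp
    qed
    show "(INF c\<in>imm_paths C E. ereal (swept_area c)) \<le> dist_G (\<lambda>l. l) C E"
      unfolding dist_G_def by (rule INF_mono) (auto simp: imm_paths_iff intro!: swept_area_le_length)
  qed
next
  fix A :: real assume A: "A > 0"
  interpret expo: length_weight "\<lambda>l. exp (A * l)"
    by unfold_locales (auto simp: mono_on_def A intro!: continuous_intros)
  show "(INF c\<in>imm_paths C E. ereal (sqrt (A * exp 1) * swept_area c)) \<le> dist_G (\<lambda>l. exp (A * l)) C E"
    unfolding dist_G_def by (rule INF_mono) (auto simp: imm_paths_iff intro!: swept_area_le_length_exp A)
  show "dist_G (\<lambda>l. exp (A * l)) C E \<le> (INF c\<in>imm_paths C E.
             ereal (sqrt (A * exp 1) * exp (A * max_length c / 2) * swept_area c))"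
  proof (rule INF_greatest)
    fix p assume p: "p \<in> imm_paths C E"
    \<comment> \<open>for the weight \<open>exp (A * l)\<close> the quotient \<open>exp (A * e) / e\<close> is smallest at \<open>e = 1 / A\<close>\<close>
    have "exp (A * (max_length p + 1 / A)) / (1 / A) = (A * exp 1) * (exp (A * max_length p / 2))\<^sup>2"
      using A by (simp add: distrib_left exp_add power2_eq_square flip: exp_add)
    then have "sqrt (exp (A * (max_length p + 1 / A)) / (1 / A)) = sqrt (A * exp 1) * exp (A * max_length p / 2)"
      by (simp only: real_sqrt_mult) simp
    then show "dist_G (\<lambda>l. exp (A * l)) C E \<le> ereal (sqrt (A * exp 1) * exp (A * max_length p / 2) * swept_area p)"
      using expo.dist_G_le[OF p, of "1 / A"] A by simp
  qed
qed

end
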